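(* Let $\Omega\subset\mathbb R^{2n}$ be a domain containing $0$ and let $H\in C^\infty(\Omega,\mathbb R)$ have an elliptic critical point at $x=0$, with $$H(x)=H_{[2]}(x)+\mathcal H(x),\qquad H_{[2]}(x)=\sum_{i=1}^n\omega_i\,(x_i^2+x_{i+n}^2),\qquad \mathcal H(x)=O(|x|^3),$$ where $\omega=(\omega_1,\dots,\omega_n)\in\mathbb R^n$ and the quadratic form $H_{[2]}$ has non-trivial zeros. Let $\mathbb Z_+^n$ denote the set of vectors with non-negative integer entries, and for $h\in\mathbb Z_+^n$ put $|h|:=\sum_{i=1}^n h_i$. Assume: (1) There is an integer $N\ge 3$ such that $\langle\omega,h\rangle\neq 0$ for every $h\in\mathbb Z_+^n\setminus\{0\}$ with $|h|\le N-1$. (2) There is a vector $k=(k_1,\dots,k_n)\in\mathbb Z_+^n\setminus\{0\}$ with $|k|=N$ and $\langle\omega,k\rangle=0$. Moreover, if $k'\in\mathbb Z_+^n\setminus\{0\}$ is not an integer multiple of $k$ and $\langle\omega,k'\rangle=0$, then $|k'|>3N-1$. (3) $I=k$ is a channel of instability, that is, $H^B_{[j]}(k)=0$ for every integer $j$ with $1\le j\le\frac{N-1}{2}$. (4) The function $\Psi:\mathbb R\to\mathbb R$, $$\Psi(\sigma):=H^B_{[\frac N2]}(k)+H_0(k,k_1^2\sigma),$$ has a simple zero, i.e. there is $c\in\mathbb R$ with $\Psi(c)=0$ and $\Psi'(c)\ne0$. Here $H^B_{[j]}$ and $H_0$ are the terms of the Birkhoff normal form of $H$ at $0$ described in the context,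 with $H^B_{[\frac N2]}:=0$ if $N$ is odd. Then the Hamiltonian system with Hamiltonian $H$ admits an $(n-1)$-parameter family of $O^+$-curves as well as an $(n-1)$-parameter family of $O^-$-curves, asymptotic to the equilibrium $x=0$.
   Context: Hamiltonian system. $\mathbb R^{2n}$ carries the standard symplectic structure in which $x_i$ and $x_{i+n}$ are conjugate variables, $i=1,\dots,n$. The orientation is the one for which action-angle variables $(I,\theta)$, defined by $y_i=\sqrt{2I_i}\cos\theta_i$, $y_{i+n}=\sqrt{2I_i}\sin\theta_i$, satisfy $\dot I=-\partial H/\partial\theta$, $\dot\theta=\partial H/\partial I$. $O$-curves. An $O^+$-curve (resp. $O^-$-curve) is a non-constant integral curve $x(t)$ of the Hamiltonian system that is asymptotic to the equilibrium in the future (resp. in the past): $x(t)\to0$ as $t\to+\infty$ (resp. $t\to-\infty$). Birkhoff normal form. Under hypotheses (1) and (2), a symplectic change of variables $x=y+\Phi(y)$ in a neighborhood of the origin, followed by the passage to action-angle variables $I=(I_1,\dots,I_n)$, $\theta=(\theta_1,\dots,\theta_n)$ given by $y_i=\sqrt{2I_i}\cos\theta_i$, $y_{i+n}=\sqrt{2I_i}\sin\theta_i$, brings $H$ to the form $$H^B(I,\theta)=\sum_{1\le j\le N/2}H^B_{[j]}(I)+H_0(I,\langle\theta,k\rangle)+O\big(|I|^{\frac{N+1}{2}}\big),$$ where: - $H^B_{[j]}(I)$, for integer $j$, is a homogeneous polynomial of degree $j$ in $(I_1,\dots,I_n)$; in particular $H^B_{[1]}(I)=2\langle\omega,I\rangle$.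 - $H_0$ is the lowest order resonant term, of the form $$H_0(I,\varphi)=\big\{h^{(1)}\cos\varphi+h^{(2)}\sin\varphi\big\}\prod_{\alpha=1}^nI_\alpha^{k_\alpha/2},\qquad h^{(1)},h^{(2)}\in\mathbb R.$$ The normalization is carried out to higher order (remainder $O(|I|^{\frac{3N+1}{2}})$, with further terms depending on the angles only through $\langle\theta,k\rangle$), but only the terms displayed here enter the statement. In $H^B_{[j]}(k)$ and $H_0(k,\cdot)$ the action vector $I$ is set equal to $k$.
   Formalization: If some k_i = 0 the claim of n-1 parameters fails (e.g. n=3, k=(2,1,0), decoupled third mode); curves are shown distinct only for parameters differing in a coordinate with k_i > 0 (all n-1 if every k_i > 0). The Birkhoff normal form of the context is taken as given. *)

theory Defs
  imports "HOL-Analysis.Analysis" "HOL-Library.Landau_Symbols"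
begin

(* The phase space R^{2n} is (real^'n) * (real^'n) with n = CARD('n): x_i is fst x $ i and
   x_{i+n} is snd x $ i. *)

text \<open>Smoothness\<close>

primrec Ck_on :: "nat \<Rightarrow> 'a::real_normed_vector set \<Rightarrow> ('a \<Rightarrow> 'b::real_normed_vector) \<Rightarrow> bool" where
  "Ck_on 0 S = (\<lambda>f. continuous_on S f)"
| "Ck_on (Suc m) S = (\<lambda>f. (\<forall>x\<in>S. f differentiable (at x)) \<and>
     (\<forall>v. Ck_on m S (\<lambda>x. frechet_derivative f (at x) v)))"

(* Directional derivatives of all orders exist and are continuous: on an open subset of a
   finite-dimensional space this is the usual C-infinity. *)
definition smooth_on :: "'a::real_normed_vector set \<Rightarrow> ('a \<Rightarrow> 'b::real_normed_vector) \<Rightarrow> bool" where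
  "smooth_on S f \<longleftrightarrow> (\<forall>m. Ck_on m S f)"

text \<open>Integer vectors\<close>

definition rvec :: "nat ^ 'n \<Rightarrow> real ^ 'n" where
  "rvec h = (\<chi> i. real (h $ i))"

definition vabs :: "nat ^ 'n \<Rightarrow> nat" where
  "vabs h = (\<Sum>i\<in>UNIV. h $ i)"

text \<open>Hamiltonian systems\<close>

definition H2 :: "real ^ 'n \<Rightarrow> (real ^ 'n) \<times> (real ^ 'n) \<Rightarrow> real" where
  "H2 \<omega> x = (\<Sum>i\<in>UNIV. \<omega> $ i * ((fst x $ i)\<^sup>2 + (snd x $ i)\<^sup>2))"

(* The sign is the one making action-angle variables y_i = sqrt (2 I_i) cos theta_i,
   y_{i+n} = sqrt (2 I_i) sin theta_i satisfy I' = - dH/dtheta, theta' = dH/dI: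
   x_i' = - dH/dx_{i+n}, x_{i+n}' = dH/dx_i. *)
definition ham_field :: "((real ^ 'n) \<times> (real ^ 'n) \<Rightarrow> real) \<Rightarrow> (real ^ 'n) \<times> (real ^ 'n) \<Rightarrow> (real ^ 'n) \<times> (real ^ 'n)" where
  "ham_field H x =
     (\<chi> i. - frechet_derivative H (at x) (0, axis i 1),
      \<chi> i. frechet_derivative H (at x) (axis i 1, 0))"

definition integral_curve_on ::
  "((real ^ 'n) \<times> (real ^ 'n)) set \<Rightarrow> ((real ^ 'n) \<times> (real ^ 'n) \<Rightarrow> real) \<Rightarrow> real set \<Rightarrow>
   (real \<Rightarrow> (real ^ 'n) \<times> (real ^ 'n)) \<Rightarrow> bool" where
  "integral_curve_on \<Omega> H T x \<longleftrightarrow>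
     (\<forall>t\<in>T. x t \<in> \<Omega> \<and> (x has_vector_derivative ham_field H (x t)) (at t within T))"

(* The system is autonomous, so a curve asymptotic to 0 in the future (past) may be taken to be
   defined for t >= 0 (t <= 0). *)
definition O_plus_curve where
  "O_plus_curve \<Omega> H x \<longleftrightarrow>
     integral_curve_on \<Omega> H {0..} x \<and> \<not> x constant_on {0..} \<and> (x \<longlongrightarrow> 0) at_top"

definition O_minus_curve where
  "O_minus_curve \<Omega> H x \<longleftrightarrow>
     integral_curve_on \<Omega> H {..0} x \<and> \<not> x constant_on {..0} \<and> (x \<longlongrightarrow> 0) at_bot"

(* An (n-1)-parameter family, n = CARD('n), of curves with property C on the time interval T:
   the parameter set U is a nonempty open subset of a coordinate hyperplane u_a = 0 of R^n, the
   curves depend continuously on time and parameter jointly, and parameters that differ in a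
   coordinate i in K give disjoint orbits.  If K = UNIV, different parameters always give
   different orbits, so that the orbits fill an n-dimensional set.

   The parameters are the phases theta_i of the modes i (one phase, that of mode a, being
   determined by the others).  With K = {i. k_i > 0} the set K is UNIV when all k_i are positive.
   A mode with k_i = 0 has no phase at I = k, and no family can separate curves by it: for
   H = G(x_1, x_2, x_4, x_5) + sqrt 2 * (x_3^2 + x_6^2), where G is a 1:(-2) resonant Hamiltonian
   and k = (2,1,0), the action I_3 is a first integral, so every asymptotic curve has I_3 = 0 and
   belongs to the system in four dimensions with Hamiltonian G. *)
definition parameter_family ::
  "((real \<Rightarrow> (real ^ 'n) \<times> (real ^ 'n)) \<Rightarrow> bool) \<Rightarrow> real set \<Rightarrow> 'n set \<Rightarrow> bool" where
  "parameter_family C T K \<longleftrightarrow>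
     (\<exists>(a::'n) (U::(real ^ 'n) set) (\<gamma>::real ^ 'n \<Rightarrow> real \<Rightarrow> (real ^ 'n) \<times> (real ^ 'n)).
        a \<in> K \<and> U \<noteq> {} \<and> openin (top_of_set {u. u $ a = 0}) U \<and>
        continuous_on (U \<times> T) (\<lambda>(u, t). \<gamma> u t) \<and>
        (\<forall>u\<in>U. C (\<gamma> u)) \<and>
        (\<forall>u\<in>U. \<forall>v\<in>U. (\<exists>i\<in>K. u $ i \<noteq> v $ i) \<longrightarrow> \<gamma> u ` T \<inter> \<gamma> v ` T = {}))"

text \<open>Birkhoff normal form\<close>

definition actions :: "(real ^ 'n) \<times> (real ^ 'n) \<Rightarrow> real ^ 'n" where
  "actions y = (\<chi> i. ((fst y $ i)\<^sup>2 + (snd y $ i)\<^sup>2) / 2)"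

definition action_angle :: "real ^ 'n \<Rightarrow> real ^ 'n \<Rightarrow> (real ^ 'n) \<times> (real ^ 'n)" where
  "action_angle I \<theta> =
     (\<chi> i. sqrt (2 * I $ i) * cos (\<theta> $ i), \<chi> i. sqrt (2 * I $ i) * sin (\<theta> $ i))"

definition symp_form :: "(real ^ 'n) \<times> (real ^ 'n) \<Rightarrow> (real ^ 'n) \<times> (real ^ 'n) \<Rightarrow> real" where
  "symp_form u v = fst u \<bullet> snd v - snd u \<bullet> fst v"

definition symplectic_on ::
  "((real ^ 'n) \<times> (real ^ 'n)) set \<Rightarrow> ((real ^ 'n) \<times> (real ^ 'n) \<Rightarrow> (real ^ 'n) \<times> (real ^ 'n)) \<Rightarrow> bool" where
  "symplectic_on V f \<longleftrightarrow>
     (\<forall>y\<in>V. f differentiable (at y) \<and>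
        (\<forall>u v. symp_form (frechet_derivative f (at y) u) (frechet_derivative f (at y) v) = symp_form u v))"

definition homogeneous_poly :: "nat \<Rightarrow> (real ^ 'n \<Rightarrow> real) \<Rightarrow> bool" where
  "homogeneous_poly j p \<longleftrightarrow>
     (\<exists>c :: nat ^ 'n \<Rightarrow> real. \<forall>I. p I = (\<Sum>h | vabs h = j. c h * (\<Prod>i\<in>UNIV. (I $ i) ^ (h $ i))))"

(* I^(k/2) is written sqrt I ^ k and not with powr, because 0 powr 0 = 0: a factor with k_i = 0
   has to be 1, also where I_i = 0. *)
definition H_res :: "nat ^ 'n \<Rightarrow> real \<Rightarrow> real \<Rightarrow> real ^ 'n \<Rightarrow> real \<Rightarrow> real" where
  "H_res k h1 h2 I \<phi> = (h1 * cos \<phi> + h2 * sin \<phi>) * (\<Prod>i\<in>UNIV. sqrt (I $ i) ^ (k $ i))"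

(* The functions HB j (1 <= j <= N/2) and H_res k h1 h2 are the terms of a Birkhoff normal form
   of H at 0: a near-identity symplectic change of variables x = f y takes H to
     sum of HB j I  +  H_res k h1 h2 I <theta,k>  +  F  +  R,
   where F consists of the normalized terms of order at least (N+1)/2 in I (a polynomial in y
   that depends on the angles only through <theta,k>) and R = O(|I|^((3N+1)/2)).  F and R
   together are O(|I|^((N+1)/2)). *)
definition birkhoff_normal_form ::
  "((real ^ 'n) \<times> (real ^ 'n)) set \<Rightarrow> ((real ^ 'n) \<times> (real ^ 'n) \<Rightarrow> real) \<Rightarrow> nat \<Rightarrow> nat ^ 'n \<Rightarrow>
   (nat \<Rightarrow> real ^ 'n \<Rightarrow> real) \<Rightarrow> real \<Rightarrow> real \<Rightarrow> bool" where
  "birkhoff_normal_form \<Omega> H N k HB h1 h2 \<longleftrightarrow>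
     (\<forall>j\<in>{1..N div 2}. homogeneous_poly j (HB j)) \<and>
     (\<exists>V f F G R.
        open V \<and> 0 \<in> V \<and> smooth_on V f \<and> inj_on f V \<and> f ` V \<subseteq> \<Omega> \<and> symplectic_on V f \<and>
        (\<lambda>y. norm (f y - y)) \<in> O[at 0](\<lambda>y. (norm y)\<^sup>2) \<and>
        real_polynomial_function F \<and>
        F \<in> O[at 0](\<lambda>y. norm (actions y) powr ((real N + 1) / 2)) \<and>
        (\<forall>I \<theta>. (\<forall>i. 0 \<le> I $ i) \<longrightarrow> F (action_angle I \<theta>) = G I (\<theta> \<bullet> rvec k)) \<and>
        R \<in> O[at 0](\<lambda>y. norm (actions y) powr ((3 * real N + 1) / 2)) \<and>
        (\<forall>I \<theta>. (\<forall>i. 0 \<le> I $ i) \<and> action_angle I \<theta> \<in> V \<longrightarrow>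
           H (f (action_angle I \<theta>)) =
             (\<Sum>j = 1..N div 2. HB j I) + H_res k h1 h2 I (\<theta> \<bullet> rvec k)
             + F (action_angle I \<theta>) + R (action_angle I \<theta>)))"

(* The index i1 is an arbitrary element of the unordered index type, in the role of the index 1. *)
definition Psi :: "nat \<Rightarrow> nat ^ 'n \<Rightarrow> 'n \<Rightarrow> (nat \<Rightarrow> real ^ 'n \<Rightarrow> real) \<Rightarrow> real \<Rightarrow> real \<Rightarrow> real \<Rightarrow> real" where
  "Psi N k i1 HB h1 h2 \<sigma> =
     (if even N then HB (N div 2) (rvec k) else 0)
     + H_res k h1 h2 (rvec k) ((real (k $ i1))\<^sup>2 * \<sigma>)"

end

theory Submission
  imports Defs
begin

text \<open>Near the channel I = r^2 k the truncated normal form, being invariant under the rotations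
orthogonal to k, drives only r and the angle conjugate to the resonance. A simple zero of the resonant
amplitude comes in a pair with derivatives of opposite signs; at the zero for which the angle is
expelled while r decreases, take the logarithm of 1/r as time and rescale the deviations: the
deviation of the actions by r^N, that of the angles transversal to the resonance by r^(1-N).
The equations become v' = N v - G, q' = -(N-1) q + G, where G is bounded and has a small Lipschitz
constant, since the remainder of the normal form has order 3N+1 in r. This hyperbolic system has a
unique bounded solution with q = 0 at time 0 (Perron's fixed point), depending continuously on the
n-1 phases u that are prescribed at time 0. Passing back to the original time gives the curves
asymptotic to 0 as t tends to infinity; they are disjoint by uniqueness, since the initial points,
all at the same r, have different phases. The curves asymptotic to 0 in the past come from -H
by reversing time.\<close>

section \<open>Smooth functions\<close>

text \<open>The resonant angle is not rescaled. In leading order the energy, r^N times the level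
  function of this angle, is conserved, so the level grows like exp(N t) in logarithmic time, and
  the deviation from a simple zero grows at exactly the rate N. Action deviations scaled by r^N have
  the same rate, hence one constant N for all expanding unknowns, and the part left in the angle
  equation has derivative 0 at the zero. The transversal phases drift like r^(2-N); one power more,
  r^(1-N), makes their rescaled forcing small. The price: a variation of q moves the phases by
  r^(1-N), so that every dependence on the phases costs N-1 powers in Lipschitz constants. This
  explains the high order of the remainder and why sizes and Lipschitz constants are tracked
  together. The invariant terms do not pay this price: they are evaluated after the rotation has
  been undone. Polar coordinates fail for modes with k_i = 0, whose amplitudes are smaller than r
  and may vanish; these stay complex, and their frequency is obtained as a Lipschitz
  quotient.\<close>

lemma Ck_on_cong:
  assumes "open S" "\<And>x. x \<in> S \<Longrightarrow> f x = g x" "Ck_on m S f"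
  shows "Ck_on m S g"
  using assms(2,3)
proof (induction m arbitrary: f g)
  case 0
  then show ?case by (auto intro: continuous_on_eq)
next
  case (Suc m)
  have D: "(g has_derivative frechet_derivative f (at x)) (at x)" if "x \<in> S" for x
  proof -
    have "(f has_derivative frechet_derivative f (at x)) (at x)"
      using Suc.prems(2) that frechet_derivative_works by auto
    then show ?thesis
      using assms(1) that Suc.prems(1) by (rule has_derivative_transform_within_open)
  qed
  then have "frechet_derivative f (at x) v = frechet_derivative g (at x) v" if "x \<in> S" for x v
    using that frechet_derivative_at[OF D[OF that]] by simp
  then have "Ck_on m S (\<lambda>x. frechet_derivative g (at x) v)" for v
    using Suc.prems(2) by (rule_tac Suc.IH[of "\<lambda>x. frechet_derivative f (at x) v"]) auto
  then show ?case using D by (auto simp: differentiable_def)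
qed

lemma Ck_on_SucI:
  assumes "open S" "\<And>x. x \<in> S \<Longrightarrow> (f has_derivative f' x) (at x)" "\<And>v. Ck_on m S (\<lambda>x. f' x v)"
  shows "Ck_on (Suc m) S f"
proof -
  have "Ck_on m S (\<lambda>x. frechet_derivative f (at x) v)" for v
  proof (rule Ck_on_cong[OF assms(1) _ assms(3)])
    show "f' x v = frechet_derivative f (at x) v" if "x \<in> S" for x
      using frechet_derivative_at[OF assms(2)[OF that]] by simp
  qed
  then show ?thesis using assms(2) by (auto simp: differentiable_def)
qed

lemma Ck_on_has_derivative:
  "Ck_on (Suc m) S f \<Longrightarrow> x \<in> S \<Longrightarrow> (f has_derivative frechet_derivative f (at x)) (at x)"
  using frechet_derivative_works by auto

lemma Ck_on_SucD: "Ck_on (Suc m) S f \<Longrightarrow> Ck_on m S f"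
proof (induction m arbitrary: f)
  case 0
  then show ?case
    by (auto intro!: continuous_at_imp_continuous_on simp: differentiable_imp_continuous_within)
next
  case (Suc m)
  then have "Ck_on (Suc m) S (\<lambda>x. frechet_derivative f (at x) v)" for v
    by (subst (asm) Ck_on.simps(2)) blast
  then have "Ck_on m S (\<lambda>x. frechet_derivative f (at x) v)" for v
    by (rule Suc.IH)
  moreover have "\<forall>x\<in>S. f differentiable (at x)"
    using Suc.prems by (subst (asm) Ck_on.simps(2)) blast
  ultimately show ?case by simp
qed

lemma Ck_on_const: "Ck_on m S (\<lambda>x. c)"
  by (induction m arbitrary: c) auto

lemma Ck_on_bounded_linear:
  assumes "bounded_linear f" shows "Ck_on m S f"
proof (cases m)
  case 0
  then show ?thesis using assms by (simp add: linear_continuous_on)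
next
  case (Suc l)
  have "frechet_derivative f (at x) = f" for x
    using frechet_derivative_at[OF bounded_linear_imp_has_derivative[OF assms]] by simp
  then show ?thesis
    using assms bounded_linear_imp_has_derivative[OF assms] Suc
    by (auto simp: Ck_on_const differentiable_def)
qed

lemma Ck_on_add:
  assumes "open S"
  shows "Ck_on m S f \<Longrightarrow> Ck_on m S g \<Longrightarrow> Ck_on m S (\<lambda>x. f x + g x)"
proof (induction m arbitrary: f g)
  case 0
  then show ?case by (auto intro: continuous_on_add)
next
  case (Suc m)
  show ?case
  proof (rule Ck_on_SucI[OF assms])
    show "((\<lambda>x. f x + g x) has_derivative
       (\<lambda>v. frechet_derivative f (at x) v + frechet_derivative g (at x) v)) (at x)" if "x \<in> S" for x
      using Suc.prems that by (intro has_derivative_add Ck_on_has_derivative)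
    show "Ck_on m S (\<lambda>x. frechet_derivative f (at x) v + frechet_derivative g (at x) v)" for v
      using Suc.prems by (intro Suc.IH) auto
  qed
qed

lemma Ck_on_mult:
  fixes f g :: "'a::real_normed_vector \<Rightarrow> real"
  assumes "open S"
  shows "Ck_on m S f \<Longrightarrow> Ck_on m S g \<Longrightarrow> Ck_on m S (\<lambda>x. f x * g x)"
proof (induction m arbitrary: f g)
  case 0
  then show ?case by (auto intro: continuous_on_mult)
next
  case (Suc m)
  show ?case
  proof (rule Ck_on_SucI[OF assms])
    show "((\<lambda>x. f x * g x) has_derivative
       (\<lambda>v. f x * frechet_derivative g (at x) v + frechet_derivative f (at x) v * g x)) (at x)" if "x \<in> S" for x
      using Suc.prems that by (intro has_derivative_mult Ck_on_has_derivative)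
    show "Ck_on m S (\<lambda>x. f x * frechet_derivative g (at x) v + frechet_derivative f (at x) v * g x)" for v
      using Suc.prems Ck_on_SucD[OF Suc.prems(1)] Ck_on_SucD[OF Suc.prems(2)]
      by (intro Ck_on_add[OF assms] Suc.IH) simp_all
  qed
qed

lemma Ck_on_sum:
  assumes "open S" "\<And>i. i \<in> I \<Longrightarrow> Ck_on m S (f i)"
  shows "Ck_on m S (\<lambda>x. \<Sum>i\<in>I. f i x)"
  using assms(2)
  by (induction I rule: infinite_finite_induct)
     (auto simp: Ck_on_const intro!: Ck_on_add[OF assms(1)])

lemma Ck_on_linear_compose:
  assumes "bounded_linear L" "open S"
  shows "Ck_on m S f \<Longrightarrow> Ck_on m S (\<lambda>x. L (f x))"
proof (induction m arbitrary: f)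
  case 0
  then show ?case using assms by (simp add: bounded_linear.continuous_on)
next
  case (Suc m)
  show ?case
  proof (rule Ck_on_SucI[OF assms(2)])
    show "((\<lambda>x. L (f x)) has_derivative (\<lambda>v. L (frechet_derivative f (at x) v))) (at x)" if "x \<in> S" for x
      using Suc.prems that
      by (intro bounded_linear.has_derivative[OF assms(1)] Ck_on_has_derivative)
    show "Ck_on m S (\<lambda>x. L (frechet_derivative f (at x) v))" for v
      using Suc.prems by (intro Suc.IH) auto
  qed
qed

text \<open>The chain rule differentiates \<open>g\<close> in the direction
  \<open>frechet_derivative f (at x) v\<close>, which moves with \<open>x\<close>, while
  \<open>Ck_on\<close> controls derivatives in fixed directions. Expanding the direction in the
  basis gives a finite sum of products, to which the sum and product rules and the induction
  hypothesis apply.\<close>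

lemma Ck_on_compose:
  fixes f :: "'a::real_normed_vector \<Rightarrow> 'b::euclidean_space" and g :: "'b \<Rightarrow> real"
  assumes "open S" "f ` S \<subseteq> T"
  shows "Ck_on m T g \<Longrightarrow> Ck_on m S f \<Longrightarrow> Ck_on m S (\<lambda>x. g (f x))"
proof (induction m arbitrary: g)
  case 0
  then show ?case using assms by (auto intro: continuous_on_compose2)
next
  case (Suc m)
  show ?case
  proof (rule Ck_on_SucI[OF assms(1)])
    fix x assume x: "x \<in> S"
    let ?g' = "frechet_derivative g (at (f x))" and ?f' = "frechet_derivative f (at x)"
    have g': "(g has_derivative ?g') (at (f x))"
      using Suc.prems(1) x assms(2) by (auto intro!: Ck_on_has_derivative)
    have chain: "((\<lambda>x. g (f x)) has_derivative (\<lambda>v. ?g' (?f' v))) (at x)"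
      using x Suc.prems(2) by (intro has_derivative_compose[where g = g and f = f, OF _ g'] Ck_on_has_derivative) auto
    have rep: "?g' w = (\<Sum>b\<in>Basis. (w \<bullet> b) * ?g' b)" for w
    proof -
      have lin: "linear ?g'" using g' has_derivative_linear by blast
      have "?g' w = ?g' (\<Sum>b\<in>Basis. (w \<bullet> b) *\<^sub>R b)" by (simp add: euclidean_representation)
      then show ?thesis by (simp add: linear_sum[OF lin] linear_scale[OF lin])
    qed
    show "((\<lambda>x. g (f x)) has_derivative (\<lambda>v. \<Sum>b\<in>Basis. (?f' v \<bullet> b) * ?g' b)) (at x)"
      by (rule has_derivative_eq_rhs[OF chain]) (rule ext, rule rep)
  next
    have 1: "Ck_on m S (\<lambda>x. frechet_derivative f (at x) v \<bullet> b)" for v b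
      using Suc.prems(2) by (auto intro!: Ck_on_linear_compose[OF bounded_linear_inner_left assms(1)])
    have 2: "Ck_on m S (\<lambda>x. frechet_derivative g (at (f x)) b)" for b
    proof (rule Suc.IH)
      show "Ck_on m T (\<lambda>x. frechet_derivative g (at x) b)" using Suc.prems(1) by simp
      show "Ck_on m S f" by (rule Ck_on_SucD[OF Suc.prems(2)])
    qed
    show "Ck_on m S (\<lambda>x. \<Sum>b\<in>Basis. (frechet_derivative f (at x) v \<bullet> b) * frechet_derivative g (at (f x)) b)" for v
      by (intro Ck_on_sum Ck_on_mult assms(1) 1 2)
  qed
qed

lemma smooth_on_polynomial:
  assumes "real_polynomial_function p" "open S" shows "smooth_on S p"
  using assms(1) unfolding smooth_on_def
  by induction (auto intro: Ck_on_bounded_linear Ck_on_const Ck_on_add[OF assms(2)] Ck_on_mult[OF assms(2)])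

lemma smooth_on_derivative: "smooth_on S f \<Longrightarrow> smooth_on S (\<lambda>x. frechet_derivative f (at x) v)"
proof -
  assume "smooth_on S f"
  then have "Ck_on (Suc m) S f" for m by (simp only: smooth_on_def)
  then show ?thesis by (simp add: smooth_on_def)
qed

lemma smooth_on_has_derivative:
  "smooth_on S f \<Longrightarrow> x \<in> S \<Longrightarrow> (f has_derivative frechet_derivative f (at x)) (at x)"
  by (rule Ck_on_has_derivative[of 0]) (simp_all only: smooth_on_def)

lemma smooth_on_continuous: "smooth_on S f \<Longrightarrow> continuous_on S f"
proof -
  assume "smooth_on S f"
  then have "Ck_on 0 S f" by (simp only: smooth_on_def)
  then show ?thesis by simp
qed

lemma smooth_on_diff:
  fixes f g :: "'a::real_normed_vector \<Rightarrow> real"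
  assumes "open S" "smooth_on S f" "smooth_on S g" shows "smooth_on S (\<lambda>x. f x - g x)"
  unfolding smooth_on_def
proof
  fix m
  have "Ck_on m S (\<lambda>x. f x + (- 1) * g x)"
    using assms by (intro Ck_on_add Ck_on_mult Ck_on_const) (simp_all add: smooth_on_def)
  then show "Ck_on m S (\<lambda>x. f x - g x)" by simp
qed

lemma smooth_on_uminus:
  fixes f :: "'a::real_normed_vector \<Rightarrow> real"
  assumes "open S" "smooth_on S f" shows "smooth_on S (\<lambda>x. - f x)"
  using smooth_on_diff[OF assms(1) _ assms(2), of "\<lambda>x. 0"] by (simp add: smooth_on_def Ck_on_const)

lemma smooth_on_compose:
  fixes f :: "'a::real_normed_vector \<Rightarrow> 'b::euclidean_space" and g :: "'b \<Rightarrow> real"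
  assumes "open S" "f ` S \<subseteq> T" "smooth_on T g" "smooth_on S f"
  shows "smooth_on S (\<lambda>x. g (f x))"
  unfolding smooth_on_def
proof
  show "Ck_on m S (\<lambda>x. g (f x))" for m
    using assms(3,4) by (intro Ck_on_compose[OF assms(1,2)]) (simp_all add: smooth_on_def)
qed

section \<open>Functions vanishing to high order\<close>

text \<open>An inequality of Landau-Kolmogorov type: the difference quotient with step
  \<open>h\<close> is at most \<open>2 * A / h\<close>, and it differs from \<open>u' s\<close> by
  at most \<open>h * B\<close>, because \<open>B\<close> is a Lipschitz constant of
  \<open>u'\<close>.\<close>

lemma derivative_interpolation:
  fixes u :: "real \<Rightarrow> real"
  assumes "\<And>s. s \<in> {0..1} \<Longrightarrow> (u has_real_derivative u' s) (at s within {0..1})"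
    and "\<And>s. s \<in> {0..1} \<Longrightarrow> (u' has_real_derivative u'' s) (at s within {0..1})"
    and A: "\<And>s. s \<in> {0..1} \<Longrightarrow> \<bar>u s\<bar> \<le> A" and B: "\<And>s. s \<in> {0..1} \<Longrightarrow> \<bar>u'' s\<bar> \<le> B"
    and h: "0 < h" "h \<le> 1/2" and s: "s \<in> {0..1}"
  shows "\<bar>u' s\<bar> \<le> 2 * A / h + h * B"
proof -
  \<comment> \<open>The step goes towards the interior: from either half of the interval,
    \<open>h \<le> 1/2\<close> keeps \<open>t\<close> in \<open>{0..1}\<close>.\<close>
  define t where "t = (if s \<le> 1/2 then s + h else s - h)"
  define J where "J = {min s t..max s t}"
  have J: "J \<subseteq> {0..1}" "convex J" "s \<in> J" "t \<in> J" using h s by (auto simp: J_def t_def)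
  have ts: "\<bar>t - s\<bar> = h" using h by (auto simp: t_def)
  have J': "\<bar>x - s\<bar> \<le> h" if "x \<in> J" for x using that h by (auto simp: J_def t_def split: if_splits)
  have B0: "0 \<le> B" using B[of 0] by auto
  have d1: "\<bar>u' x - u' s\<bar> \<le> B * h" if "x \<in> J" for x
  proof -
    have "norm (u' x - u' s) \<le> B * norm (x - s)"
      by (rule field_differentiable_bound[where S = "{0..1}"])
         (use assms(2) B J s that in \<open>auto simp: real_norm_def\<close>)
    then show ?thesis using mult_left_mono[OF J'[OF that] B0] by simp
  qed
  have "norm ((u t - u' s * t) - (u s - u' s * s)) \<le> (B * h) * norm (t - s)"
  proof (rule field_differentiable_bound[where S = J])
    show "((\<lambda>x. u x - u' s * x) has_real_derivative u' x - u' s) (at x within J)" if "x \<in> J" for x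
      using that J(1) by (auto intro!: derivative_eq_intros DERIV_subset[OF assms(1)])
    show "norm (u' x - u' s) \<le> B * h" if "x \<in> J" for x using d1[OF that] by simp
  qed (use J in auto)
  then have "\<bar>(u t - u s) - u' s * (t - s)\<bar> \<le> B * h * h" using ts by (simp add: algebra_simps)
  moreover have "\<bar>u t - u s\<bar> \<le> 2 * A" using A[of t] A[of s] J by (auto simp: subset_iff)
  ultimately have "\<bar>u' s * (t - s)\<bar> \<le> 2 * A + B * h * h" by linarith
  then have "\<bar>u' s\<bar> * h \<le> 2 * A + B * h * h" using ts by (simp add: abs_mult)
  then show ?thesis using h by (simp add: field_simps)
qed

text \<open>Interpolation with a small step bounds the supremum M of the first derivative by a multiple of A
  plus half of M + B, so that M can be absorbed.\<close>
lemma first_derivative_bound: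
  "\<exists>K\<ge>0. \<forall>(U :: nat \<Rightarrow> real \<Rightarrow> real) A B.
     (\<forall>j\<le>m. \<forall>s\<in>{0..1}. (U j has_real_derivative U (Suc j) s) (at s within {0..1})) \<longrightarrow>
     (\<forall>s\<in>{0..1}. \<bar>U 0 s\<bar> \<le> A) \<longrightarrow> (\<forall>s\<in>{0..1}. \<bar>U (Suc m) s\<bar> \<le> B) \<longrightarrow>
     (\<forall>s\<in>{0..1}. \<bar>U 1 s\<bar> \<le> K * (A + B))"
proof (induction m)
  case 0
  show ?case
  proof (intro exI[of _ 1] conjI allI impI ballI)
    fix U :: "nat \<Rightarrow> real \<Rightarrow> real" and A B s :: real
    assume "\<forall>s\<in>{0..1}. \<bar>U 0 s\<bar> \<le> A" "\<forall>s\<in>{0..1}. \<bar>U (Suc 0) s\<bar> \<le> B" "s \<in> {0..1}"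
    then have "\<bar>U 0 s\<bar> \<le> A" "\<bar>U 1 s\<bar> \<le> B" by auto
    then show "\<bar>U 1 s\<bar> \<le> 1 * (A + B)" using order_trans[OF abs_ge_zero, of "U 0 s" A] by simp
  qed simp
next
  case (Suc m)
  then obtain K where K: "K \<ge> 0" and IH: "\<And>U A B s.
     (\<forall>j\<le>m. \<forall>s\<in>{0..1}. (U j has_real_derivative U (Suc j) s) (at s within {0..1})) \<Longrightarrow>
     (\<forall>s\<in>{0..1}. \<bar>U 0 s\<bar> \<le> A) \<Longrightarrow> (\<forall>s\<in>{0..1}. \<bar>U (Suc m) s\<bar> \<le> B) \<Longrightarrow> s \<in> {0..1} \<Longrightarrow>
     \<bar>U 1 s\<bar> \<le> K * (A + B)"
    by blast
  show ?case
  proof (intro exI[of _ "8 * (K + 1) + 1"] conjI allI impI)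
    fix U :: "nat \<Rightarrow> real \<Rightarrow> real" and A B :: real
    assume D: "\<forall>j\<le>Suc m. \<forall>s\<in>{0..1}. (U j has_real_derivative U (Suc j) s) (at s within {0..1})"
      and A: "\<forall>s\<in>{0..1}. \<bar>U 0 s\<bar> \<le> A" and B: "\<forall>s\<in>{0..1}. \<bar>U (Suc (Suc m)) s\<bar> \<le> B"
    have "continuous_on {0..1} (U 1)"
      using D by (intro DERIV_continuous_on[where D = "U 2"]) (auto simp: numeral_2_eq_2)
    then have "continuous_on {0..1} (\<lambda>s. \<bar>U 1 s\<bar>)" by (intro continuous_intros)
    then obtain s0 where s0: "s0 \<in> {0..1}" "\<forall>s\<in>{0..1}. \<bar>U 1 s\<bar> \<le> \<bar>U 1 s0\<bar>"
      using continuous_attains_sup[of "{0..1::real}" "\<lambda>s. \<bar>U 1 s\<bar>"] by auto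
    define M where "M = \<bar>U 1 s0\<bar>"
    \<comment> \<open>The shifted sequence starts with \<open>U 1\<close>, whose bound is its own
      maximum \<open>M\<close>.\<close>
    have U2: "\<bar>U 2 s\<bar> \<le> K * (M + B)" if "s \<in> {0..1}" for s
      using IH[of "\<lambda>j. U (Suc j)" M B s] D B s0 that by (auto simp: M_def numeral_2_eq_2)
    have AB: "A \<ge> 0" "B \<ge> 0" "M \<ge> 0" using A B by (fastforce simp: M_def)+
    \<comment> \<open>Taking \<open>K + 1\<close> instead of \<open>K\<close> gives both
      \<open>h \<le> 1/2\<close> and \<open>h * K \<le> 1/2\<close>; the latter leaves at most half
      of \<open>M\<close> on the right.\<close>
    define h where "h = 1 / (2 * (K + 1))"
    have h: "0 < h" "h \<le> 1/2" using K by (auto simp: h_def field_simps)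
    have absorb: "M \<le> 2 * x + B" if "M \<le> x + y" "y \<le> (M + B) / 2" for x y
      using that by simp
    have "M \<le> 2 * A / h + h * (K * (M + B))"
      unfolding M_def
      by (rule derivative_interpolation[of "U 0" "U 1" "U 2"])
         (use D A U2 h s0 in \<open>auto simp: numeral_2_eq_2 M_def\<close>)
    moreover have "h * (K * (M + B)) \<le> (M + B) / 2"
      using K AB by (simp add: h_def field_simps mult_left_mono)
    ultimately have "M \<le> 2 * (2 * A / h) + B" by (rule absorb)
    also have "\<dots> = 8 * (K + 1) * A + B" by (simp add: h_def)
    also have "\<dots> \<le> (8 * (K + 1) + 1) * (A + B)" using K AB by (simp add: algebra_simps)
    finally show "\<forall>s\<in>{0..1}. \<bar>U 1 s\<bar> \<le> (8 * (K + 1) + 1) * (A + B)"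
      using s0 by (auto simp: M_def)
  qed (use K in auto)
qed

text \<open>Powers of the radius of a ball, not of the norm of the point: derivatives are estimated
  from nearby points of possibly larger norm, and all of them share the scale
  \<open>r\<close>.\<close>

definition vanishes :: "nat \<Rightarrow> ('a::real_normed_vector \<Rightarrow> real) \<Rightarrow> bool" where
  "vanishes m g \<longleftrightarrow> (\<exists>C \<rho>. 0 \<le> C \<and> 0 < \<rho> \<and> (\<forall>r. 0 < r \<and> r \<le> \<rho> \<longrightarrow> (\<forall>y\<in>cball 0 r. \<bar>g y\<bar> \<le> C * r ^ m)))"

text \<open>No Taylor expansion is used. On the segment from y to y + r v the function is of order
  r^(m+1) by hypothesis, and so is its derivative of order m + 1 in the segment parameter, since
  each differentiation brings a factor r. Interpolation gives the same order to the first
  derivative, which is r times the directional derivative of \<open>g\<close>. In this way a bare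
  size estimate of the remainder passes to its gradient.\<close>

lemma vanishes_derivative:
  fixes g :: "'a::euclidean_space \<Rightarrow> real"
  assumes W: "open W" "0 \<in> W" and g: "smooth_on W g" and van: "vanishes (Suc m) g"
  shows "vanishes m (\<lambda>y. frechet_derivative g (at y) v)"
proof -
  from van obtain C \<rho> where C: "0 \<le> C" "0 < \<rho>"
    "\<And>r y. 0 < r \<Longrightarrow> r \<le> \<rho> \<Longrightarrow> y \<in> cball 0 r \<Longrightarrow> \<bar>g y\<bar> \<le> C * r ^ Suc m"
    unfolding vanishes_def by metis
  from W obtain \<rho>1 where \<rho>1: "0 < \<rho>1" "cball 0 \<rho>1 \<subseteq> W" by (meson open_contains_cball)
  define \<rho>2 where "\<rho>2 = min \<rho> \<rho>1"
  \<comment> \<open>Chosen so that the segment issuing from the ball of radius \<open>r\<close>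
    stays in the ball of radius \<open>r * b\<close>.\<close>
  define b where "b = 1 + norm v"
  have b: "b > 0" by (simp add: b_def add_pos_nonneg)
  have \<rho>2: "\<rho>2 > 0" "cball 0 \<rho>2 \<subseteq> W" using \<rho>1 C by (auto simp: \<rho>2_def)
  define D where "D j = ((\<lambda>h x. frechet_derivative h (at x) v) ^^ j) g" for j
  have D0: "D 0 = g" and DS: "D (Suc j) = (\<lambda>x. frechet_derivative (D j) (at x) v)" for j
    by (simp_all add: D_def)
  have smD: "smooth_on W (D j)" for j
    by (induction j) (auto simp: D0 DS g intro: smooth_on_derivative)
  have "continuous_on (cball 0 \<rho>2) (D (Suc m))"
    using smooth_on_continuous[OF smD] \<rho>2(2) by (rule continuous_on_subset)
  then have "bounded (D (Suc m) ` cball 0 \<rho>2)"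
    by (intro compact_imp_bounded compact_continuous_image) auto
  then obtain B where B: "\<And>y. y \<in> cball 0 \<rho>2 \<Longrightarrow> \<bar>D (Suc m) y\<bar> \<le> B"
    unfolding bounded_iff by force
  have B0: "B \<ge> 0" using B[of 0] \<rho>2 by auto
  obtain K where K: "K \<ge> 0" and intp: "\<And>U A B s.
     (\<forall>j\<le>m. \<forall>s\<in>{0..1}. (U j has_real_derivative U (Suc j) s) (at s within {0..1})) \<Longrightarrow>
     (\<forall>s\<in>{0..1}. \<bar>U 0 s\<bar> \<le> A) \<Longrightarrow> (\<forall>s\<in>{0..1}. \<bar>U (Suc m) s\<bar> \<le> B) \<Longrightarrow> s \<in> {0..1} \<Longrightarrow>
     \<bar>U 1 s\<bar> \<le> K * (A + B)"
    using first_derivative_bound[of m] by blast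
  have main: "\<bar>frechet_derivative g (at y) v\<bar> \<le> K * (C * b ^ Suc m + B) * r ^ m"
    if r: "0 < r" "r \<le> \<rho>2 / b" and y: "y \<in> cball 0 r" for r y
  proof -
    define p where "p s = y + (s * r) *\<^sub>R v" for s
    have p: "norm (p s) \<le> r * b" if "s \<in> {0..1}" for s
    proof -
      have "norm (p s) \<le> norm y + s * r * norm v"
        using that r by (simp add: p_def norm_triangle_le)
      also have "\<dots> \<le> r + r * norm v"
        using y r that by (intro add_mono mult_right_mono) (auto simp: mult_left_le_one_le)
      finally show ?thesis by (simp add: b_def algebra_simps)
    qed
    have rb: "r * b \<le> \<rho>2" "0 < r * b" using r b by (auto simp: field_simps)
    have pin: "p s \<in> cball 0 \<rho>2" if "s \<in> {0..1}" for s using p[OF that] rb by simp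
    have "\<bar>r ^ 1 * D 1 (p 0)\<bar> \<le> K * (C * (r * b) ^ Suc m + r ^ Suc m * B)"
    proof (rule intp[where U = "\<lambda>j s. r ^ j * D j (p s)"])
      show "\<forall>s\<in>{0..1}. \<bar>r ^ 0 * D 0 (p s)\<bar> \<le> C * (r * b) ^ Suc m"
        using C(3)[of "r * b"] p rb by (auto simp: D0 \<rho>2_def)
      show "\<forall>s\<in>{0..1}. \<bar>r ^ Suc m * D (Suc m) (p s)\<bar> \<le> r ^ Suc m * B"
        using B pin r by (auto simp: abs_mult intro!: mult_left_mono)
      show "\<forall>j\<le>m. \<forall>s\<in>{0..1}. ((\<lambda>s. r ^ j * D j (p s)) has_real_derivative r ^ Suc j * D (Suc j) (p s))
              (at s within {0..1})"
      proof (intro allI impI ballI)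
        fix j s assume s: "s \<in> {0..1::real}"
        have 1: "(D j has_derivative frechet_derivative (D j) (at (p s))) (at (p s))"
          using pin[OF s] \<rho>2 by (intro smooth_on_has_derivative[OF smD]) auto
        have 2: "(p has_derivative (\<lambda>d. (d * r) *\<^sub>R v)) (at s within {0..1})"
          unfolding p_def by (auto intro!: derivative_eq_intros)
        have lin: "linear (frechet_derivative (D j) (at (p s)))"
          using 1 has_derivative_linear by blast
        have "((\<lambda>s. D j (p s)) has_derivative (\<lambda>d. frechet_derivative (D j) (at (p s)) ((d * r) *\<^sub>R v)))
              (at s within {0..1})"
          using has_derivative_compose[where g = "D j", OF 2 1] .
        then have "((\<lambda>s. D j (p s)) has_real_derivative r * D (Suc j) (p s)) (at s within {0..1})"
          unfolding has_field_derivative_def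
          by (rule has_derivative_eq_rhs) (auto simp: DS linear_scale[OF lin] algebra_simps)
        then show "((\<lambda>s. r ^ j * D j (p s)) has_real_derivative r ^ Suc j * D (Suc j) (p s)) (at s within {0..1})"
          by (auto intro!: derivative_eq_intros)
      qed
    qed auto
    then have "r * \<bar>D 1 y\<bar> \<le> r * (K * (C * b ^ Suc m + B) * r ^ m)"
      using r by (simp add: abs_mult p_def algebra_simps power_mult_distrib)
    then show ?thesis using r by (simp add: DS D0)
  qed
  show ?thesis unfolding vanishes_def
    by (rule exI[of _ "K * (C * b ^ Suc m + B)"], rule exI[of _ "\<rho>2 / b"])
       (use main K C B0 b \<rho>2 in auto)
qed

lemma partials_lipschitz:
  fixes g :: "'a::euclidean_space \<Rightarrow> real"
  assumes S: "convex S" and g: "\<And>x. x \<in> S \<Longrightarrow> (g has_derivative g' x) (at x)"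
    and B: "\<And>x b. x \<in> S \<Longrightarrow> b \<in> Basis \<Longrightarrow> \<bar>g' x b\<bar> \<le> B b" and xy: "x \<in> S" "y \<in> S"
  shows "\<bar>g x - g y\<bar> \<le> (\<Sum>b\<in>Basis. B b) * norm (x - y)"
proof -
  have "norm (g x - g y) \<le> (\<Sum>b\<in>Basis. B b) * norm (x - y)"
  proof (rule differentiable_bound[OF S])
    fix x assume x: "x \<in> S"
    show "(g has_derivative g' x) (at x within S)" using g[OF x] by (rule has_derivative_at_withinI)
    have lin: "linear (g' x)" using g[OF x] by (rule has_derivative_linear)
    show "onorm (g' x) \<le> (\<Sum>b\<in>Basis. B b)"
    proof (rule onorm_le)
      fix w
      have "g' x w = g' x (\<Sum>b\<in>Basis. (w \<bullet> b) *\<^sub>R b)" by (simp add: euclidean_representation)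
      also have "\<dots> = (\<Sum>b\<in>Basis. (w \<bullet> b) * g' x b)" by (simp add: linear_sum[OF lin] linear_scale[OF lin])
      finally have e: "g' x w = (\<Sum>b\<in>Basis. (w \<bullet> b) * g' x b)" .
      have "norm (g' x w) \<le> (\<Sum>b\<in>Basis. \<bar>(w \<bullet> b) * g' x b\<bar>)" by (subst e) simp
      also have "\<dots> \<le> (\<Sum>b\<in>Basis. norm w * B b)"
        unfolding abs_mult by (intro sum_mono mult_mono Basis_le_norm B x) auto
      finally show "norm (g' x w) \<le> (\<Sum>b\<in>Basis. B b) * norm w" by (simp add: sum_distrib_left mult.commute)
    qed
  qed (use xy in auto)
  then show ?thesis by simp
qed

lemma vanishes_lipschitz:
  fixes g :: "'a::euclidean_space \<Rightarrow> real"
  assumes W: "open W" "0 \<in> W" and g: "smooth_on W g" and van: "vanishes (Suc m) g"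
  shows "\<exists>C \<rho>. 0 \<le> C \<and> 0 < \<rho> \<and> (\<forall>r. 0 < r \<and> r \<le> \<rho> \<longrightarrow>
           (\<forall>y\<in>cball 0 r. \<forall>y'\<in>cball 0 r. \<bar>g y - g y'\<bar> \<le> C * r ^ m * norm (y - y')))"
proof -
  have "\<forall>b. \<exists>C \<rho>. 0 \<le> C \<and> 0 < \<rho> \<and> (\<forall>r. 0 < r \<and> r \<le> \<rho> \<longrightarrow>
          (\<forall>y\<in>cball 0 r. \<bar>frechet_derivative g (at y) b\<bar> \<le> C * r ^ m))"
    using vanishes_derivative[OF W g van] unfolding vanishes_def by blast
  then obtain C \<rho> where C: "\<And>b. 0 \<le> C b" "\<And>b. 0 < \<rho> b" "\<And>b r y. 0 < r \<Longrightarrow> r \<le> \<rho> b \<Longrightarrow> y \<in> cball 0 r \<Longrightarrow>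
      \<bar>frechet_derivative g (at y) b\<bar> \<le> C b * r ^ m"
    by metis
  from W obtain \<rho>1 where \<rho>1: "0 < \<rho>1" "cball 0 \<rho>1 \<subseteq> W" by (meson open_contains_cball)
  define \<rho>2 where "\<rho>2 = Min (insert \<rho>1 (\<rho> ` Basis))"
  have \<rho>2: "\<rho>2 > 0" "\<rho>2 \<le> \<rho>1" "\<And>b. b \<in> Basis \<Longrightarrow> \<rho>2 \<le> \<rho> b"
    using \<rho>1 C(2) by (auto simp: \<rho>2_def intro!: min.coboundedI2)
  show ?thesis
  proof (rule exI[of _ "\<Sum>b\<in>Basis. C b"], rule exI[of _ \<rho>2], intro conjI allI impI ballI)
    fix r y y' assume r: "0 < r \<and> r \<le> \<rho>2" and y: "y \<in> cball (0::'a) r" "y' \<in> cball (0::'a) r"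
    have "\<bar>g y - g y'\<bar> \<le> (\<Sum>b\<in>Basis. C b * r ^ m) * norm (y - y')"
    proof (rule partials_lipschitz[OF convex_cball _ _ y])
      fix x :: 'a assume x: "x \<in> cball 0 r"
      then show "(g has_derivative frechet_derivative g (at x)) (at x)"
        using r \<rho>1 \<rho>2 by (intro smooth_on_has_derivative[OF g]) auto
      show "\<bar>frechet_derivative g (at x) b\<bar> \<le> C b * r ^ m" if "b \<in> Basis" for b
        using r x \<rho>2(3)[OF that] by (intro C(3)) auto
    qed
    then show "\<bar>g y - g y'\<bar> \<le> (\<Sum>b\<in>Basis. C b) * r ^ m * norm (y - y')" by (simp add: sum_distrib_right)
  qed (use C \<rho>2 in \<open>auto intro: sum_nonneg\<close>)
qed

section \<open>Bounded solutions of hyperbolic systems\<close>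

lemma norm_fst_snd_le: "norm (fst z) \<le> norm z" "norm (snd z) \<le> norm z"
  using norm_fst_le[of "fst z" "snd z"] norm_snd_le[of "snd z" "fst z"] by simp_all

lemma continuous_on_section:
  assumes "continuous_on (UNIV \<times> T) (\<lambda>(u, t). g u t)"
  shows "continuous_on T (g u)"
proof -
  have "continuous_on T (\<lambda>t. (u, t))" by (intro continuous_intros)
  from continuous_on_compose2[OF assms this] show ?thesis by auto
qed

text \<open>Rescaling \<open>{0..t}\<close> to \<open>{0..1}\<close> moves the variable end point
  into the integrand; what remains is the continuity of a parameter integral over a fixed
  interval.\<close>

lemma continuous_on_integral_variable:
  fixes g :: "'p::metric_space \<Rightarrow> real \<Rightarrow> 'b::euclidean_space"
  assumes "continuous_on (UNIV \<times> {0..}) (\<lambda>(u, t). g u t)"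
  shows "continuous_on (UNIV \<times> {0..}) (\<lambda>(u, t). integral {0..t} (g u))"
proof -
  have contg: "continuous_on T (g u)" if "T \<subseteq> {0..}" for T u
    using continuous_on_section[OF assms] that by (rule continuous_on_subset)
  have scale: "integral {0..t} (g u) = t *\<^sub>R integral {0..1} (\<lambda>s. g u (t * s))" if "t \<ge> 0" for u t
  proof (cases "t = 0")
    case False
    then have t: "t > 0" using that by simp
    have "(g u has_integral integral {0..t} (g u)) {0..t}"
      by (intro integrable_integral integrable_continuous_real contg) auto
    from has_integral_stretch_real[OF this, of t]
    have "((\<lambda>s. g u (t * s)) has_integral (1 / \<bar>t\<bar>) *\<^sub>R integral {0..t} (g u)) ((\<lambda>x. x / t) ` {0..t})"
      using t by simp
    moreover have "(\<lambda>x. x / t) ` {0..t} = {0..1}"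
      using t by (auto simp: image_iff field_simps intro!: bexI[of _ "_ * t"])
    ultimately show ?thesis using t by (auto dest!: integral_unique)
  qed simp
  have "continuous_on (UNIV \<times> {0..}) (\<lambda>x. integral (cbox 0 1) (\<lambda>s. g (fst x) (snd x * s)))"
  proof (rule integral_continuous_on_param)
    have "continuous_on ((UNIV \<times> {0..}) \<times> cbox 0 1) (\<lambda>z. (\<lambda>(u, t). g u t) (fst (fst z), snd (fst z) * snd z))"
      by (rule continuous_on_compose2[OF assms]) (auto intro!: continuous_intros)
    then show "continuous_on ((UNIV \<times> {0..}) \<times> cbox 0 1) (\<lambda>(x, s). g (fst x) (snd x * s))"
      by (simp add: case_prod_unfold)
  qed
  then have "continuous_on (UNIV \<times> {0..}) (\<lambda>x. snd x *\<^sub>R integral {0..1} (\<lambda>s. g (fst x) (snd x * s)))"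
    by (intro continuous_intros) (simp add: cbox_interval)
  then show ?thesis
    by (rule continuous_on_eq) (auto simp: scale)
qed

text \<open>Variation of constants for v' = A v - g. Integrating from infinity selects the one
  solution that stays bounded; its value at time 0 cannot be prescribed. The forward counterpart
  solves q' = g - A q and starts at 0.\<close>

definition backward_solution :: "real \<Rightarrow> (real \<Rightarrow> 'b::euclidean_space) \<Rightarrow> real \<Rightarrow> 'b" where
  "backward_solution A g t = exp (A * t) *\<^sub>R integral {t..} (\<lambda>s. exp (- A * s) *\<^sub>R g s)"

definition forward_solution :: "real \<Rightarrow> (real \<Rightarrow> 'b::euclidean_space) \<Rightarrow> real \<Rightarrow> 'b" where
  "forward_solution A g t = exp (- A * t) *\<^sub>R integral {0..t} (\<lambda>s. exp (A * s) *\<^sub>R g s)"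

lemma backward_weight_integrable:
  fixes g :: "real \<Rightarrow> 'b::euclidean_space"
  assumes cont: "continuous_on {0..} g" and A: "A \<ge> 1" and bdd: "\<And>s. s \<ge> 0 \<Longrightarrow> norm (g s) \<le> C"
    and t: "t \<ge> 0"
  shows "(\<lambda>s. exp (- A * s) *\<^sub>R g s) integrable_on {t..}"
    and "norm (integral {t..} (\<lambda>s. exp (- A * s) *\<^sub>R g s)) \<le> C * exp (- A * t)"
proof -
  let ?w = "\<lambda>s. exp (- A * s) *\<^sub>R g s"
  have C0: "0 \<le> C" using norm_ge_zero order_trans bdd[of 0] by blast
  have expint: "((\<lambda>s. C * exp (- A * s)) has_integral C * (exp (- A * t) / A)) {t..}"
    using has_integral_exp_minus_to_infinity[of A t] A by (intro has_integral_mult_right) auto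
  have wb: "norm (?w s) \<le> C * exp (- A * s)" if "s \<ge> 0" for s
    using bdd[OF that] by (simp add: mult.commute)
  have "?w absolutely_integrable_on {t..}"
  proof (rule measurable_bounded_by_integrable_imp_absolutely_integrable)
    show "?w \<in> borel_measurable (lebesgue_on {t..})"
      using t by (intro continuous_imp_measurable_on_sets_lebesgue continuous_intros continuous_on_subset[OF cont]) auto
    show "(\<lambda>s. C * exp (- A * s)) integrable_on {t..}" using expint by blast
  qed (use wb t in auto)
  then show int: "?w integrable_on {t..}" by (rule set_lebesgue_integral_eq_integral)
  have "norm (integral {t..} ?w) \<le> integral {t..} (\<lambda>s. C * exp (- A * s))"
    using t expint wb by (intro integral_norm_bound_integral int) auto
  also have "\<dots> = C * (exp (- A * t) / A)" using expint by (rule integral_unique)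
  also have "\<dots> \<le> C * exp (- A * t)" using A C0 by (intro mult_left_mono) (auto simp: field_simps)
  finally show "norm (integral {t..} ?w) \<le> C * exp (- A * t)" .
qed

text \<open>In the supremum norm the solution operator has norm at most 1 / A, and
  \<open>A \<ge> 1\<close>. The bound \<open>C\<close> makes the two improper integrals
  converge.\<close>

lemma backward_solution_diff_bound:
  assumes "continuous_on {0..} g" "continuous_on {0..} g'" "A \<ge> 1" "t \<ge> 0"
    and "\<And>s. s \<ge> 0 \<Longrightarrow> norm (g s) \<le> C" "\<And>s. s \<ge> 0 \<Longrightarrow> norm (g' s) \<le> C"
    and "\<And>s. s \<ge> 0 \<Longrightarrow> norm (g s - g' s) \<le> D"
  shows "norm (backward_solution A g t - backward_solution A g' t) \<le> D"
proof -
  note i = backward_weight_integrable(1)[OF assms(1,3,5,4)] backward_weight_integrable(1)[OF assms(2,3,6,4)]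
  have "backward_solution A g t - backward_solution A g' t =
      exp (A * t) *\<^sub>R integral {t..} (\<lambda>s. exp (- A * s) *\<^sub>R (g s - g' s))"
    using integral_diff[OF i] by (simp add: backward_solution_def scaleR_diff_right)
  then have "norm (backward_solution A g t - backward_solution A g' t) \<le> exp (A * t) * (D * exp (- A * t))"
    using backward_weight_integrable(2)[of "\<lambda>s. g s - g' s" A D t] assms by (auto intro!: continuous_intros)
  also have "\<dots> = D" by (simp flip: exp_add)
  finally show ?thesis .
qed

lemma forward_solution_diff_bound:
  assumes "continuous_on {0..} g" "continuous_on {0..} g'" "A \<ge> 1" "t \<ge> 0"
    and D: "\<And>s. s \<ge> 0 \<Longrightarrow> norm (g s - g' s) \<le> D"
  shows "norm (forward_solution A g t - forward_solution A g' t) \<le> D"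
proof -
  have D0: "0 \<le> D" using norm_ge_zero order_trans D[of 0] by blast
  have i: "(\<lambda>s. exp (A * s) *\<^sub>R g s) integrable_on {0..t}" if "continuous_on {0..} g" for g :: "real \<Rightarrow> 'a"
    by (intro integrable_continuous_real continuous_intros continuous_on_subset[OF that]) auto
  have e: "((\<lambda>s. D * exp (A * s)) has_integral D * (exp (A * t) / A - exp (A * 0) / A)) {0..t}"
    using assms(3,4) by (intro has_integral_mult_right fundamental_theorem_of_calculus)
      (auto intro!: derivative_eq_intros simp: has_real_derivative_iff_has_vector_derivative[symmetric])
  have "forward_solution A g t - forward_solution A g' t =
      exp (- A * t) *\<^sub>R integral {0..t} (\<lambda>s. exp (A * s) *\<^sub>R (g s - g' s))"
    using integral_diff[OF i[OF assms(1)] i[OF assms(2)]] by (simp add: forward_solution_def scaleR_diff_right)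
  also have "norm \<dots> \<le> exp (- A * t) * integral {0..t} (\<lambda>s. D * exp (A * s))"
  proof -
    have "norm (integral {0..t} (\<lambda>s. exp (A * s) *\<^sub>R (g s - g' s))) \<le> integral {0..t} (\<lambda>s. D * exp (A * s))"
    proof (rule integral_norm_bound_integral)
      show "(\<lambda>s. exp (A * s) *\<^sub>R (g s - g' s)) integrable_on {0..t}"
        by (intro i continuous_intros assms(1,2))
      show "(\<lambda>s. D * exp (A * s)) integrable_on {0..t}" using e by blast
      show "norm (exp (A * s) *\<^sub>R (g s - g' s)) \<le> D * exp (A * s)" if "s \<in> {0..t}" for s
        using D[of s] that by (simp add: mult.commute)
    qed
    then show ?thesis by (simp add: mult_left_mono)
  qed
  also have "\<dots> = exp (- A * t) * (D * (exp (A * t) / A - exp (A * 0) / A))"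
    unfolding integral_unique[OF e] ..
  also have "\<dots> = D * (1 - exp (- A * t)) / A" by (simp add: algebra_simps diff_divide_distrib flip: exp_add)
  also have "\<dots> \<le> D * 1 / 1" using D0 assms(3) by (intro frac_le mult_left_mono) auto
  finally show ?thesis by simp
qed

text \<open>The tail integral is the full integral \<open>J u\<close> minus a proper one.
  \<open>J\<close> is continuous as the uniform limit of integrals over \<open>{0..n}\<close>: the
  bound \<open>C\<close> is common to all parameters, so the tails are uniformly small.\<close>

lemma backward_solution:
  fixes g :: "'p::metric_space \<Rightarrow> real \<Rightarrow> 'b::euclidean_space"
  assumes cont: "continuous_on (UNIV \<times> {0..}) (\<lambda>(u, t). g u t)"
    and A: "A \<ge> 1"
    and bdd: "\<And>u t. t \<ge> 0 \<Longrightarrow> norm (g u t) \<le> C"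
  shows "continuous_on (UNIV \<times> {0..}) (\<lambda>(u, t). backward_solution A (g u) t)"
    and "t \<ge> 0 \<Longrightarrow> (backward_solution A (g u) has_vector_derivative A *\<^sub>R backward_solution A (g u) t - g u t)
           (at t within {0..})"
proof -
  define w where "w = (\<lambda>u s. exp (- A * s) *\<^sub>R g u s)"
  define J where "J = (\<lambda>u. integral {0..} (w u))"
  have contw: "continuous_on (UNIV \<times> {0..}) (\<lambda>(u, s). w u s)"
    using cont unfolding w_def case_prod_unfold by (intro continuous_intros)
  have wu: "continuous_on {0..} (w u)" for u
    by (rule continuous_on_section[OF contw])
  have wint: "w u integrable_on {t..}" "norm (integral {t..} (w u)) \<le> C * exp (- A * t)" if "t \<ge> 0" for u t
    using backward_weight_integrable[OF continuous_on_section[OF cont] A, where C = C and t = t, of u] bdd that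
    unfolding w_def by auto
  have tail: "integral {t..} (w u) = J u - integral {0..t} (w u)" if "t \<ge> 0" for u t
  proof -
    have "(w u has_integral integral {0..t} (w u) + integral {t..} (w u)) ({0..t} \<union> {t..})"
    proof (rule has_integral_Un)
      show "(w u has_integral integral {0..t} (w u)) {0..t}"
        by (intro integrable_integral integrable_continuous_real continuous_on_subset[OF wu]) auto
      show "(w u has_integral integral {t..} (w u)) {t..}"
        using wint(1)[OF that] by (rule integrable_integral)
      have "{0..t} \<inter> {t..} = {t}" using that by auto
      then show "negligible ({0..t} \<inter> {t..})" by simp
    qed
    moreover have "{0..t} \<union> {t..} = {0..}" using that by auto
    ultimately show ?thesis unfolding J_def by (simp add: integral_unique)
  qed
  have v: "backward_solution A (g u) t = exp (A * t) *\<^sub>R (J u - integral {0..t} (w u))" if "t \<ge> 0" for u t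
    using tail[OF that] by (simp add: backward_solution_def w_def)
  have tailb: "norm (J u - integral {0..t} (w u)) \<le> C * exp (- A * t)" if "t \<ge> 0" for u t
    using wint(2)[OF that, of u] tail[OF that] by simp
  have contI: "continuous_on (UNIV \<times> {0..}) (\<lambda>(u, t). integral {0..t} (w u))"
    by (rule continuous_on_integral_variable[OF contw])
  have "continuous_on UNIV J"
  proof (rule uniform_limit_theorem)
    show "\<forall>\<^sub>F n :: nat in sequentially. continuous_on UNIV (\<lambda>u. integral {0..real n} (w u))"
    proof (intro always_eventually allI)
      fix n :: nat
      have "continuous_on UNIV (\<lambda>u :: 'p. (u, real n))" by (intro continuous_intros)
      from continuous_on_compose2[OF contI this]
      show "continuous_on UNIV (\<lambda>u. integral {0..real n} (w u))" by (auto simp: image_subset_iff)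
    qed
    show "uniform_limit UNIV (\<lambda>n u. integral {0..real n} (w u)) J sequentially"
    proof (rule uniform_limitI)
      fix e :: real assume e: "e > 0"
      have "(\<lambda>n. C * exp (- A * real n)) \<longlonglongrightarrow> 0"
        using A by real_asymp
      then have "\<forall>\<^sub>F n in sequentially. C * exp (- A * real n) < e"
        using e by (rule order_tendstoD)
      then show "\<forall>\<^sub>F n in sequentially. \<forall>u\<in>UNIV. dist (integral {0..real n} (w u)) (J u) < e"
      proof eventually_elim
        case (elim n)
        then show ?case
          using le_less_trans[OF tailb[of "real n"]] by (simp add: dist_norm norm_minus_commute)
      qed
    qed
  qed auto
  then have contJ: "continuous_on (UNIV \<times> {0..}) (\<lambda>x. J (fst x))"
    by (rule continuous_on_compose2) (auto intro!: continuous_intros)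
  have "continuous_on (UNIV \<times> {0..}) (\<lambda>(u, t). exp (A * t) *\<^sub>R (J u - integral {0..t} (w u)))"
    using contI unfolding case_prod_unfold by (intro continuous_intros contJ)
  then show "continuous_on (UNIV \<times> {0..}) (\<lambda>(u, t). backward_solution A (g u) t)"
    by (rule continuous_on_eq) (auto simp: v)
  show "(backward_solution A (g u) has_vector_derivative A *\<^sub>R backward_solution A (g u) t - g u t) (at t within {0..})"
    if t: "t \<ge> 0"
  proof (rule has_vector_derivative_transform[where f = "\<lambda>t. exp (A * t) *\<^sub>R (J u - integral {0..t} (w u))"])
    have "((\<lambda>t. integral {0..t} (w u)) has_vector_derivative w u t) (at t within {0..t+1})"
      using t by (intro integral_has_vector_derivative continuous_on_subset[OF wu]) auto
    moreover have "at t within {0..t+1} = at t within {0..}"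
      by (rule at_within_nhd[of _ "{..<t+1}"]) auto
    ultimately have I: "((\<lambda>t. integral {0..t} (w u)) has_vector_derivative w u t) (at t within {0..})" by simp
    have e: "exp (A * t) *\<^sub>R w u t = g u t" by (simp add: w_def flip: exp_add)
    show "((\<lambda>t. exp (A * t) *\<^sub>R (J u - integral {0..t} (w u))) has_vector_derivative
        A *\<^sub>R backward_solution A (g u) t - g u t) (at t within {0..})"
      unfolding v[OF t] e[symmetric]
      by (rule derivative_eq_intros I refl)+ (simp add: algebra_simps)
  qed (use v t in auto)
qed

lemma forward_solution:
  fixes g :: "'p::metric_space \<Rightarrow> real \<Rightarrow> 'b::euclidean_space"
  assumes cont: "continuous_on (UNIV \<times> {0..}) (\<lambda>(u, t). g u t)"
  shows "continuous_on (UNIV \<times> {0..}) (\<lambda>(u, t). forward_solution A (g u) t)"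
    and "t \<ge> 0 \<Longrightarrow> (forward_solution A (g u) has_vector_derivative g u t - A *\<^sub>R forward_solution A (g u) t)
           (at t within {0..})"
proof -
  define w where "w = (\<lambda>u s. exp (A * s) *\<^sub>R g u s)"
  have contw: "continuous_on (UNIV \<times> {0..}) (\<lambda>(u, s). w u s)"
    using cont unfolding w_def case_prod_unfold by (intro continuous_intros)
  have wu: "continuous_on {0..} (w u)" for u
    by (rule continuous_on_section[OF contw])
  have v: "forward_solution A (g u) = (\<lambda>t. exp (- A * t) *\<^sub>R integral {0..t} (w u))" for u
    by (rule ext) (simp add: forward_solution_def w_def)
  show "continuous_on (UNIV \<times> {0..}) (\<lambda>(u, t). forward_solution A (g u) t)"
    using continuous_on_integral_variable[OF contw]
    unfolding v case_prod_unfold by (intro continuous_intros)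
  show "(forward_solution A (g u) has_vector_derivative g u t - A *\<^sub>R forward_solution A (g u) t) (at t within {0..})"
    if t: "t \<ge> 0"
  proof -
    have "((\<lambda>t. integral {0..t} (w u)) has_vector_derivative w u t) (at t within {0..t+1})"
      using t by (intro integral_has_vector_derivative continuous_on_subset[OF wu]) auto
    moreover have "at t within {0..t+1} = at t within {0..}"
      by (rule at_within_nhd[of _ "{..<t+1}"]) auto
    ultimately have I: "((\<lambda>t. integral {0..t} (w u)) has_vector_derivative w u t) (at t within {0..})" by simp
    have e: "exp (- A * t) *\<^sub>R w u t = g u t" by (simp add: w_def flip: exp_add)
    show ?thesis
      unfolding v e[symmetric]
      by (rule derivative_eq_intros I refl)+ (simp add: algebra_simps)
  qed
qed

text \<open>Perron's method: the solution is a fixed point in the space of bounded continuous functions of parameter and time, so that joint continuity is automatic.\<close>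
lemma perron_solution:
  fixes G :: "'p::metric_space \<Rightarrow> real \<Rightarrow> 'e::euclidean_space \<times> 'f::euclidean_space \<Rightarrow> 'e \<times> 'f"
  assumes \<epsilon>: "\<epsilon> > 0" and AB: "A \<ge> 1" "B \<ge> 1"
    and cont: "continuous_on (UNIV \<times> {0..} \<times> cball 0 \<epsilon>) (\<lambda>(u, t, z). G u t z)"
    and bound: "\<And>u t z. t \<ge> 0 \<Longrightarrow> norm z \<le> \<epsilon> \<Longrightarrow> norm (G u t z) \<le> \<epsilon> / 4"
    and lip: "\<And>u t z z'. t \<ge> 0 \<Longrightarrow> norm z \<le> \<epsilon> \<Longrightarrow> norm z' \<le> \<epsilon> \<Longrightarrow>
                norm (G u t z - G u t z') \<le> 1 / 4 * norm (z - z')"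
  shows "\<exists>\<zeta> :: 'p \<Rightarrow> real \<Rightarrow> 'e \<times> 'f. continuous_on (UNIV \<times> {0..}) (\<lambda>(u, t). \<zeta> u t) \<and>
    (\<forall>u. snd (\<zeta> u 0) = 0) \<and>
    (\<forall>u. \<forall>t\<ge>0. norm (\<zeta> u t) \<le> \<epsilon> \<and>
       ((\<lambda>t. fst (\<zeta> u t)) has_vector_derivative A *\<^sub>R fst (\<zeta> u t) - fst (G u t (\<zeta> u t))) (at t within {0..}) \<and>
       ((\<lambda>t. snd (\<zeta> u t)) has_vector_derivative snd (G u t (\<zeta> u t)) - B *\<^sub>R snd (\<zeta> u t)) (at t within {0..}))"
proof -
  define S where "S = {F :: ('p \<times> real) \<Rightarrow>\<^sub>C ('e \<times> 'f). \<forall>x. norm (F x) \<le> \<epsilon>}"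
  define g where "g F u t = G u t (apply_bcontfun F (u, t))" for F u t
  \<comment> \<open>Bounded continuous functions are total on parameter and time, so negative times
    are filled in by freezing the value at time 0; the equations are read off for nonnegative
    times.\<close>
  define T0 where "T0 F = (\<lambda>(u, t). (backward_solution A (\<lambda>t. fst (g F u t)) (max 0 t),
                                    forward_solution B (\<lambda>t. snd (g F u t)) (max 0 t)))" for F
  define T where "T F = Bcontfun (T0 F)" for F
  have gc: "continuous_on (UNIV \<times> {0..}) (\<lambda>(u, t). g F u t)" if "F \<in> S" for F
  proof -
    have "continuous_on (UNIV \<times> {0..}) (\<lambda>x. (\<lambda>(u, t, z). G u t z) (fst x, snd x, apply_bcontfun F x))"
      by (rule continuous_on_compose2[OF cont])
         (use that in \<open>auto simp: S_def intro!: continuous_intros continuous_on_apply_bcontfun\<close>)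
    then show ?thesis by (simp add: g_def case_prod_unfold)
  qed
  have gfc: "continuous_on (UNIV \<times> {0..}) (\<lambda>(u, t). fst (g F u t))"
       "continuous_on (UNIV \<times> {0..}) (\<lambda>(u, t). snd (g F u t))" if "F \<in> S" for F
    using gc[OF that] unfolding case_prod_unfold by (auto intro!: continuous_intros)
  have gb: "norm (fst (g F u t)) \<le> \<epsilon> / 4" "norm (snd (g F u t)) \<le> \<epsilon> / 4" if "F \<in> S" "t \<ge> 0" for F u t
    using bound[OF that(2), of "F (u, t)" u] that(1) norm_fst_snd_le[of "g F u t"]
    by (auto simp: S_def g_def)
  have nz: "norm (a, b) \<le> c + d" if "norm a \<le> c" "norm b \<le> d" for a :: 'e and b :: 'f and c d
    using norm_Pair_le[of a b] that by linarith
  have z0: "backward_solution A (\<lambda>t. 0 :: 'e) t = 0" "forward_solution B (\<lambda>t. 0 :: 'f) t = 0" for t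
    by (simp_all add: backward_solution_def forward_solution_def)
  have T0b: "norm (T0 F x) \<le> \<epsilon>" if "F \<in> S" for F x
  proof -
    obtain u t where x: "x = (u, t)" by fastforce
    have "norm (backward_solution A (\<lambda>t. fst (g F u t)) (max 0 t)) \<le> \<epsilon> / 4"
      using backward_solution_diff_bound[of "\<lambda>t. fst (g F u t)" "\<lambda>t. 0" A "max 0 t" "\<epsilon> / 4" "\<epsilon> / 4"]
        continuous_on_section[OF gfc(1)[OF that]] AB gb[OF that] \<epsilon> by (auto simp: z0)
    moreover have "norm (forward_solution B (\<lambda>t. snd (g F u t)) (max 0 t)) \<le> \<epsilon> / 4"
      using forward_solution_diff_bound[of "\<lambda>t. snd (g F u t)" "\<lambda>t. 0" B "max 0 t" "\<epsilon> / 4"]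
        continuous_on_section[OF gfc(2)[OF that]] AB gb[OF that] \<epsilon> by (auto simp: z0)
    ultimately show ?thesis using nz[of _ "\<epsilon> / 4" _ "\<epsilon> / 4"] \<epsilon> by (fastforce simp: x T0_def)
  qed
  have T0c: "continuous_on UNIV (T0 F)" if "F \<in> S" for F
  proof -
    have m: "continuous_on UNIV (\<lambda>x :: 'p \<times> real. (fst x, max 0 (snd x)))"
      by (intro continuous_intros)
    have "continuous_on UNIV (\<lambda>x. ((\<lambda>(u, t). backward_solution A (\<lambda>t. fst (g F u t)) t) (fst x, max 0 (snd x)),
                                  (\<lambda>(u, t). forward_solution B (\<lambda>t. snd (g F u t)) t) (fst x, max 0 (snd x))))"
      by (intro continuous_on_Pair continuous_on_compose2[where t = "UNIV \<times> {0..}", OF _ m]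
            backward_solution(1)[OF gfc(1)[OF that] AB(1) gb(1)[OF that]] forward_solution(1)[OF gfc(2)[OF that]]) auto
    then show ?thesis by (simp add: T0_def case_prod_unfold)
  qed
  have TF: "apply_bcontfun (T F) = T0 F" if "F \<in> S" for F
    unfolding T_def using T0b[OF that] T0c[OF that]
    by (intro Bcontfun_inverse) (auto simp: bcontfun_def bounded_iff)
  have TS: "T F \<in> S" if "F \<in> S" for F using T0b[OF that] by (simp add: S_def TF[OF that])
  \<comment> \<open>Each of the two components contributes a quarter of the distance, and the norm
    of a pair is at most the sum of the norms.\<close>
  have contr: "dist (T F) (T F') \<le> 1 / 2 * dist F F'" if F: "F \<in> S" "F' \<in> S" for F F'
  proof (rule dist_bound)
    fix x :: "'p \<times> real"
    obtain u t where x: "x = (u, t)" by fastforce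
    have d: "norm (g F u s - g F' u s) \<le> 1 / 4 * dist F F'" if "s \<ge> 0" for s
    proof -
      have "norm (g F u s - g F' u s) \<le> 1 / 4 * norm (F (u, s) - F' (u, s))"
        using F that unfolding g_def by (intro lip) (auto simp: S_def)
      also have "\<dots> \<le> 1 / 4 * dist F F'" using dist_bounded[of F "(u, s)" F'] by (simp add: dist_norm)
      finally show ?thesis .
    qed
    have d': "norm (fst (g F u s) - fst (g F' u s)) \<le> 1 / 4 * dist F F'"
        "norm (snd (g F u s) - snd (g F' u s)) \<le> 1 / 4 * dist F F'" if "s \<ge> 0" for s
      using d[OF that] norm_fst_snd_le[of "g F u s - g F' u s"] by auto
    have "norm (T0 F x - T0 F' x) \<le> 1 / 4 * dist F F' + 1 / 4 * dist F F'"
      unfolding x T0_def prod.case diff_Pair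
      by (intro nz backward_solution_diff_bound[where C = "\<epsilon> / 4"] forward_solution_diff_bound)
         (use F gb AB d' continuous_on_section[OF gfc(1)] continuous_on_section[OF gfc(2)] in auto)
    then show "dist (T F x) (T F' x) \<le> 1 / 2 * dist F F'"
      by (simp add: TF F dist_norm)
  qed
  have "closed S"
  proof -
    have "S = (\<Inter>x. {F. norm (apply_bcontfun F x) \<le> \<epsilon>})" by (auto simp: S_def)
    moreover have "closed {F :: ('p \<times> real) \<Rightarrow>\<^sub>C ('e \<times> 'f). norm (apply_bcontfun F x) \<le> \<epsilon>}" for x
    proof (rule closed_Collect_le)
      have "continuous_on UNIV (\<lambda>F :: ('p \<times> real) \<Rightarrow>\<^sub>C ('e \<times> 'f). apply_bcontfun F x)"
      proof (rule continuous_onI)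
        fix F :: "('p \<times> real) \<Rightarrow>\<^sub>C ('e \<times> 'f)" and e :: real assume "e > 0"
        moreover have "dist (apply_bcontfun F' x) (apply_bcontfun F x) \<le> e" if "dist F' F < e" for F'
          using dist_bounded[of F' x F] that by linarith
        ultimately show "\<exists>d>0. \<forall>F'\<in>UNIV. dist F' F < d \<longrightarrow> dist (apply_bcontfun F' x) (apply_bcontfun F x) \<le> e"
          by blast
      qed
      then show "continuous_on UNIV (\<lambda>F :: ('p \<times> real) \<Rightarrow>\<^sub>C ('e \<times> 'f). norm (apply_bcontfun F x))"
        by (intro continuous_intros)
    qed auto
    ultimately show ?thesis by auto
  qed
  then have "complete S" by (simp add: complete_eq_closed)
  moreover have "S \<noteq> {}"
  proof -
    have "(0 :: ('p \<times> real) \<Rightarrow>\<^sub>C ('e \<times> 'f)) \<in> S" using \<epsilon> by (simp add: S_def)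
    then show ?thesis by blast
  qed
  ultimately obtain F where F: "F \<in> S" "T F = F"
    using Banach_fix[of S "1/2" T] TS contr by auto
  define \<zeta> where "\<zeta> u t = apply_bcontfun F (u, t)" for u t
  have \<zeta>: "\<zeta> u t = (backward_solution A (\<lambda>t. fst (g F u t)) t, forward_solution B (\<lambda>t. snd (g F u t)) t)"
    if "t \<ge> 0" for u t
    using TF[OF F(1)] that by (simp add: \<zeta>_def T0_def F(2) max_def)
  have f: "fst (\<zeta> u t) = backward_solution A (\<lambda>t. fst (g F u t)) t"
      "snd (\<zeta> u t) = forward_solution B (\<lambda>t. snd (g F u t)) t" if "t \<ge> 0" for u t
    using \<zeta>[OF that] by simp_all
  show ?thesis
  proof (intro exI[of _ \<zeta>] conjI allI impI)
    show "continuous_on (UNIV \<times> {0..}) (\<lambda>(u, t). \<zeta> u t)"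
      by (simp add: \<zeta>_def case_prod_unfold continuous_on_apply_bcontfun)
    show "snd (\<zeta> u 0) = 0" for u using f(2)[of 0] by (simp add: forward_solution_def)
    fix u and t :: real assume t: "t \<ge> 0"
    show "norm (\<zeta> u t) \<le> \<epsilon>" using F by (simp add: \<zeta>_def S_def)
    have g: "G u t (\<zeta> u t) = g F u t" by (simp add: g_def \<zeta>_def)
    show "((\<lambda>t. fst (\<zeta> u t)) has_vector_derivative A *\<^sub>R fst (\<zeta> u t) - fst (G u t (\<zeta> u t))) (at t within {0..})"
      unfolding f(1)[OF t] g
      by (rule has_vector_derivative_transform[OF _ _ backward_solution(2)[OF gfc(1)[OF F(1)] AB(1) gb(1)[OF F(1)] t]])
         (use f t in auto)
    show "((\<lambda>t. snd (\<zeta> u t)) has_vector_derivative snd (G u t (\<zeta> u t)) - B *\<^sub>R snd (\<zeta> u t)) (at t within {0..})"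
      unfolding f(2)[OF t] g
      by (rule has_vector_derivative_transform[OF _ _ forward_solution(2)[OF gfc(2)[OF F(1)] t]])
         (use f t in auto)
  qed
qed

section \<open>Change of time and uniqueness\<close>

text \<open>The equation X' = 1 / m(X) is solved by inverting the integral \<open>T u\<close> of
  \<open>m u\<close>. The lower bound \<open>c\<close> makes \<open>T u\<close> expand distances by
  at least the factor \<open>c\<close>: it maps onto the half line and has a Lipschitz inverse,
  which also yields joint continuity. \<open>X u\<close> tends to infinity because
  \<open>T u\<close> is finite at every point.\<close>

lemma time_change:
  fixes m :: "'p::metric_space \<Rightarrow> real \<Rightarrow> real"
  assumes cont: "continuous_on (UNIV \<times> {0..}) (\<lambda>(u, \<tau>). m u \<tau>)"
    and c: "c > 0" and mc: "\<And>u \<tau>. \<tau> \<ge> 0 \<Longrightarrow> c \<le> m u \<tau>"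
  shows "\<exists>X :: 'p \<Rightarrow> real \<Rightarrow> real. continuous_on (UNIV \<times> {0..}) (\<lambda>(u, t). X u t) \<and>
    (\<forall>u. X u 0 = 0 \<and> filterlim (X u) at_top at_top \<and>
      (\<forall>t\<ge>0. X u t \<ge> 0 \<and> (X u has_real_derivative 1 / m u (X u t)) (at t within {0..})))"
proof -
  define T where "T u \<tau> = integral {0..\<tau>} (m u)" for u \<tau>
  have mu: "continuous_on {0..} (m u)" for u by (rule continuous_on_section[OF cont])
  have contT: "continuous_on (UNIV \<times> {0..}) (\<lambda>(u, \<tau>). T u \<tau>)"
    unfolding T_def by (rule continuous_on_integral_variable[OF cont])
  have Tu: "continuous_on {0..} (T u)" for u by (rule continuous_on_section[OF contT])
  have dT: "(T u has_real_derivative m u \<tau>) (at \<tau> within {0..})" if "\<tau> \<ge> 0" for u \<tau>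
  proof -
    have "((\<lambda>t. integral {0..t} (m u)) has_vector_derivative m u \<tau>) (at \<tau> within {0..\<tau>+1})"
      using that by (intro integral_has_vector_derivative continuous_on_subset[OF mu]) auto
    moreover have "at \<tau> within {0..\<tau>+1} = at \<tau> within {0..}"
      by (rule at_within_nhd[of _ "{..<\<tau>+1}"]) auto
    ultimately show ?thesis
      by (simp add: T_def[abs_def] has_real_derivative_iff_has_vector_derivative)
  qed
  have T0: "T u 0 = 0" for u by (simp add: T_def)
  have incr: "c * (y - x) \<le> T u y - T u x" if "0 \<le> x" "x \<le> y" for u x y
  proof -
    have "T u x - c * x \<le> T u y - c * y"
    proof (rule DERIV_nonneg_imp_increasing_open[OF that(2)])
      fix z assume z: "x < z" "z < y"
      then have "at z within {0..} = at z" using that by (intro at_within_open_subset[of _ "{0<..}"]) auto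
      then have "(T u has_real_derivative m u z) (at z)" using dT[of z u] z that by simp
      then have "((\<lambda>x. T u x - c * x) has_real_derivative m u z - c) (at z)"
        by (auto intro!: derivative_eq_intros)
      then show "\<exists>d. ((\<lambda>x. T u x - c * x) has_real_derivative d) (at z) \<and> 0 \<le> d"
        using mc[of z u] z that by (intro exI[of _ "m u z - c"]) simp
    next
      show "continuous_on {x..y} (\<lambda>x. T u x - c * x)"
        using that by (intro continuous_intros continuous_on_subset[OF Tu]) auto
    qed
    then show ?thesis by (simp add: algebra_simps)
  qed
  have abs_incr: "c * \<bar>y - x\<bar> \<le> \<bar>T u y - T u x\<bar>" if "0 \<le> x" "0 \<le> y" for u x y
  proof (cases "x \<le> y")
    case True
    then show ?thesis using incr[of x y u] that by (simp add: abs_le_iff)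
  next
    case False
    then show ?thesis using incr[of y x u] that by (simp add: abs_le_iff)
  qed
  have "\<exists>\<tau>. \<tau> \<ge> 0 \<and> T u \<tau> = t" if "t \<ge> 0" for u t
  proof -
    have "t \<le> T u (t / c)" using incr[of 0 "t / c" u] c that by (simp add: T0)
    moreover have "0 \<le> t / c" using c that by simp
    moreover have "continuous_on {0..t / c} (T u)"
      by (rule continuous_on_subset[OF Tu]) auto
    ultimately have "\<exists>\<tau>\<ge>0. \<tau> \<le> t / c \<and> T u \<tau> = t"
      using that by (intro IVT') (simp_all add: T0)
    then show ?thesis by blast
  qed
  note ex = this
  define X where "X u t = (SOME \<tau>. \<tau> \<ge> 0 \<and> T u \<tau> = t)" for u t
  have X: "X u t \<ge> 0" "T u (X u t) = t" if "t \<ge> 0" for u t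
    using someI_ex[OF ex[OF that, of u]] by (simp_all add: X_def)
  have inj: "x = y" if "0 \<le> x" "0 \<le> y" "T u x = T u y" for u x y
    using abs_incr[of x y u] that c by (simp add: mult_le_0_iff)
  have contX: "continuous_on (UNIV \<times> {0..}) (\<lambda>(u, t). X u t)"
    unfolding continuous_on_def
  proof
    fix z :: "'p \<times> real" assume "z \<in> UNIV \<times> {0..}"
    then obtain u t where z: "z = (u, t)" and t: "t \<in> {0..}" by auto
    let ?F = "at (u, t) within UNIV \<times> {0..}"
    have "continuous_on (UNIV \<times> {0..}) (\<lambda>x :: 'p \<times> real. (fst x, X u t))"
      by (intro continuous_intros)
    from continuous_on_compose2[OF contT this]
    have "continuous_on (UNIV \<times> {0..}) (\<lambda>x :: 'p \<times> real. T (fst x) (X u t))"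
      using X(1)[of t u] t by (auto simp: image_subset_iff)
    then have "((\<lambda>x. T (fst x) (X u t)) \<longlongrightarrow> T u (X u t)) ?F"
      using t by (force simp: continuous_on_def)
    moreover have "(snd \<longlongrightarrow> t) ?F" by (auto intro!: tendsto_eq_intros)
    ultimately have "((\<lambda>x. \<bar>T (fst x) (X u t) - snd x\<bar> / c) \<longlongrightarrow> \<bar>T u (X u t) - t\<bar> / c) ?F"
      using c by (intro tendsto_intros) auto
    then have lim: "((\<lambda>x. \<bar>T (fst x) (X u t) - snd x\<bar> / c) \<longlongrightarrow> 0) ?F"
      using X(2)[of t u] t by simp
    have "\<forall>\<^sub>F x in ?F. norm (X (fst x) (snd x) - X u t) \<le> \<bar>T (fst x) (X u t) - snd x\<bar> / c"
      unfolding eventually_at_filter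
    proof (intro always_eventually allI impI)
      fix x assume "x \<in> (UNIV :: 'p set) \<times> {0::real..}"
      then have x: "snd x \<ge> 0" by auto
      \<comment> \<open>Both points are compared under the same map \<open>T (fst x)\<close>: at the
        first its value is \<open>snd x\<close>, at the second it tends to \<open>t\<close> by the
        continuity of \<open>T\<close>.\<close>
      show "norm (X (fst x) (snd x) - X u t) \<le> \<bar>T (fst x) (X u t) - snd x\<bar> / c"
        using abs_incr[of "X (fst x) (snd x)" "X u t" "fst x"] X[OF x, of "fst x"] X(1)[of t u] t c
        by (simp add: field_simps abs_minus_commute)
    qed
    then have "((\<lambda>x. X (fst x) (snd x) - X u t) \<longlongrightarrow> 0) ?F"
      using lim by (rule Lim_null_comparison)
    then show "((\<lambda>(u, t). X u t) \<longlongrightarrow> (case z of (u, t) \<Rightarrow> X u t)) (at z within UNIV \<times> {0..})"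
      by (simp add: LIM_zero_iff case_prod_unfold z)
  qed
  show ?thesis
  proof (intro exI[of _ X] conjI allI impI contX)
    fix u
    show "X u 0 = 0" using inj[of "X u 0" 0 u] X[of 0 u] by (simp add: T0)
    show "filterlim (X u) at_top at_top"
      unfolding filterlim_at_top
    proof
      fix Z
      have "X u t \<ge> Z" if "t \<ge> max 0 (T u (max 0 Z))" for t
      proof (rule ccontr)
        assume "\<not> Z \<le> X u t"
        then have "c * (max 0 Z - X u t) \<le> T u (max 0 Z) - t" "X u t < max 0 Z"
          using incr[of "X u t" "max 0 Z" u] X[of t u] that by auto
        moreover have "0 < c * (max 0 Z - X u t)" using \<open>X u t < max 0 Z\<close> c by simp
        ultimately show False using that by simp
      qed
      then show "\<forall>\<^sub>F t in at_top. Z \<le> X u t"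
        unfolding eventually_at_top_linorder by blast
    qed
    fix t :: real assume t: "t \<ge> 0"
    show "X u t \<ge> 0" using X t by simp
    show "(X u has_real_derivative 1 / m u (X u t)) (at t within {0..})"
      unfolding has_field_derivative_iff
    proof (rule Lim_transform_within)
      \<comment> \<open>The difference quotient of the inverse is the reciprocal of the one of
        \<open>T u\<close>, taken at \<open>X u s\<close>; this differs from \<open>X u t\<close>
        for \<open>s \<noteq> t\<close>, since \<open>T u\<close> maps the two to different
        times.\<close>
      have "((\<lambda>y. (T u y - T u (X u t)) / (y - X u t)) \<longlongrightarrow> m u (X u t)) (at (X u t) within {0..})"
        using dT[of "X u t" u] X(1)[OF t] by (simp add: has_field_derivative_iff)
      moreover have "filterlim (X u) (at (X u t) within {0..}) (at t within {0..})"
      proof (subst filterlim_at, intro conjI)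
        show "(X u \<longlongrightarrow> X u t) (at t within {0..})"
          using continuous_on_section[OF contX, of u] t by (simp add: continuous_on_def)
        have "X u s \<in> {0..} \<and> X u s \<noteq> X u t" if "s \<in> {0..}" "s \<noteq> t" for s
          using X(1)[of s u] X(2)[of s u] X(2)[of t u] that t by auto
        then show "\<forall>\<^sub>F s in at t within {0..}. X u s \<in> {0..} \<and> X u s \<noteq> X u t"
          unfolding eventually_at_filter by (auto intro: always_eventually)
      qed
      ultimately have "((\<lambda>s. (T u (X u s) - T u (X u t)) / (X u s - X u t)) \<longlongrightarrow> m u (X u t)) (at t within {0..})"
        by (rule filterlim_compose)
      then show "((\<lambda>s. 1 / ((T u (X u s) - T u (X u t)) / (X u s - X u t))) \<longlongrightarrow> 1 / m u (X u t)) (at t within {0..})"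
        using mc[of "X u t" u] X(1)[OF t] c by (intro tendsto_intros) auto
      show "1 / ((T u (X u s) - T u (X u t)) / (X u s - X u t)) = (X u s - X u t) / (s - t)"
        if "s \<in> {0..}" for s using that X t by simp
    qed (rule zero_less_one)
  qed
qed

text \<open>Gronwall in reverse: \<open>exp (2 * L * t)\<close> times the squared distance is
  nondecreasing, hence 0 at time 0 if it is 0 at time \<open>b\<close>. It serves to follow two
  orbits that meet back to their initial points.\<close>

lemma ode_unique_backward:
  fixes y z :: "real \<Rightarrow> 'a::euclidean_space"
  assumes y: "\<And>t. t \<in> {0..b} \<Longrightarrow> (y has_vector_derivative X (y t)) (at t within {0..b})"
    and z: "\<And>t. t \<in> {0..b} \<Longrightarrow> (z has_vector_derivative X (z t)) (at t within {0..b})"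
    and S: "\<And>t. t \<in> {0..b} \<Longrightarrow> y t \<in> S" "\<And>t. t \<in> {0..b} \<Longrightarrow> z t \<in> S"
    and lip: "\<And>p q. p \<in> S \<Longrightarrow> q \<in> S \<Longrightarrow> norm (X p - X q) \<le> L * norm (p - q)"
    and eq: "y b = z b" and b: "0 \<le> b"
  shows "y 0 = z 0"
proof -
  define D where "D t = exp (2 * L * t) * ((y t - z t) \<bullet> (y t - z t))" for t
  have contyz: "continuous_on {0..b} y" "continuous_on {0..b} z"
    unfolding continuous_on_eq_continuous_within
    using has_vector_derivative_continuous[OF y] has_vector_derivative_continuous[OF z] by blast+
  have "D 0 \<le> D b"
  proof (rule DERIV_nonneg_imp_increasing_open[OF b])
    fix t assume t: "0 < t" "t < b"
    then have at: "at t within {0..b} = at t" by (simp add: at_within_Icc_at)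
    let ?w = "y t - z t" and ?X = "X (y t) - X (z t)"
    have "((\<lambda>t. y t - z t) has_vector_derivative ?X) (at t)"
      using y[of t] z[of t] t by (intro has_vector_derivative_diff) (auto simp: at)
    then have w: "((\<lambda>t. y t - z t) has_derivative (\<lambda>h. h *\<^sub>R ?X)) (at t)"
      by (simp add: has_vector_derivative_def)
    have w2: "((\<lambda>t. (y t - z t) \<bullet> (y t - z t)) has_real_derivative 2 * (?w \<bullet> ?X)) (at t)"
      unfolding has_field_derivative_def
      by (rule has_derivative_eq_rhs[OF has_derivative_inner[OF w w]])
         (auto simp: inner_commute algebra_simps)
    have e: "((\<lambda>t. exp (2 * L * t)) has_real_derivative exp (2 * L * t) * (2 * L)) (at t)"
      by (auto intro!: derivative_eq_intros)
    have "(D has_real_derivative exp (2 * L * t) * (2 * (?w \<bullet> ?X) + 2 * L * (?w \<bullet> ?w))) (at t)"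
      unfolding D_def by (rule DERIV_cong[OF DERIV_mult[OF e w2]]) (simp add: distrib_left)
    moreover have "0 \<le> 2 * (?w \<bullet> ?X) + 2 * L * (?w \<bullet> ?w)"
    proof -
      have "\<bar>?w \<bullet> ?X\<bar> \<le> norm ?w * norm ?X" by (rule Cauchy_Schwarz_ineq2)
      also have "\<dots> \<le> norm ?w * (L * norm ?w)" using lip S t by (intro mult_left_mono) auto
      also have "\<dots> = L * (?w \<bullet> ?w)" by (simp add: dot_square_norm power2_eq_square)
      finally show ?thesis by linarith
    qed
    ultimately show "\<exists>d. (D has_real_derivative d) (at t) \<and> 0 \<le> d"
      by (meson exp_ge_zero mult_nonneg_nonneg)
  next
    show "continuous_on {0..b} D" unfolding D_def by (intro continuous_intros contyz)
  qed
  then have "(y 0 - z 0) \<bullet> (y 0 - z 0) \<le> 0" using eq by (simp add: D_def)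
  then show ?thesis by (metis inner_gt_zero_iff linorder_not_less right_minus_eq)
qed

section \<open>Complex coordinates and rotations\<close>

definition to_phase :: "complex ^ 'n \<Rightarrow> (real ^ 'n) \<times> (real ^ 'n)" where
  "to_phase c = (\<chi> i. Re (c $ i), \<chi> i. Im (c $ i))"

definition of_phase :: "(real ^ 'n) \<times> (real ^ 'n) \<Rightarrow> complex ^ 'n" where
  "of_phase y = (\<chi> i. Complex (fst y $ i) (snd y $ i))"

text \<open>Twice the Wirtinger derivative with respect to the conjugate coordinate.\<close>
definition cgrad :: "((real ^ 'n) \<times> (real ^ 'n) \<Rightarrow> real) \<Rightarrow> (real ^ 'n) \<times> (real ^ 'n) \<Rightarrow> complex ^ 'n" where
  "cgrad g y = (\<chi> i. Complex (frechet_derivative g (at y) (axis i 1, 0)) (frechet_derivative g (at y) (0, axis i 1)))"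

lemma to_of_phase [simp]: "to_phase (of_phase y) = y" "of_phase (to_phase c) = c"
  by (simp_all add: to_phase_def of_phase_def vec_eq_iff prod_eq_iff)

lemma norm_to_phase [simp]: "norm (to_phase c) = norm c"
  by (simp add: to_phase_def norm_prod_def norm_vec_def L2_set_def sum_nonneg cmod_def sum.distrib)

lemma norm_of_phase [simp]: "norm (of_phase y) = norm y"
  by (metis norm_to_phase to_of_phase(1))

lemma bounded_linear_to_phase: "bounded_linear to_phase"
  by (rule bounded_linear_intro[of _ 1]) (simp_all add: to_phase_def prod_eq_iff vec_eq_iff flip: norm_to_phase)

lemma bounded_linear_of_phase: "bounded_linear of_phase"
  by (rule bounded_linear_intro[of _ 1]) (simp_all add: of_phase_def vec_eq_iff complex_eq_iff flip: norm_of_phase)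

text \<open>With the chosen orientation the equations read z' = i g, where g is
  \<open>cgrad\<close>. Hence the quotient g / z carries the motion in polar form: its real part is
  the angular velocity and minus its imaginary part the logarithmic derivative of the
  radius.\<close>

lemma ham_field_cgrad: "ham_field H y = to_phase (\<chi> i. \<i> * cgrad H y $ i)"
  by (simp add: ham_field_def to_phase_def cgrad_def vec_eq_iff)

lemma derivative_cgrad:
  assumes "(g has_derivative g') (at y)"
  shows "g' v = (\<Sum>i\<in>UNIV. Re (cnj (cgrad g y $ i) * of_phase v $ i))"
proof -
  have g': "g' = frechet_derivative g (at y)" using assms by (rule frechet_derivative_at)
  have lin: "linear g'" using assms by (rule has_derivative_linear)
  have "v = (\<Sum>i\<in>UNIV. fst v $ i *\<^sub>R (axis i 1, 0)) + (\<Sum>i\<in>UNIV. snd v $ i *\<^sub>R (0, axis i 1))"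
    by (simp add: prod_eq_iff fst_sum snd_sum vec_eq_iff axis_def if_distrib cong: if_cong)
  then have "g' v = g' ((\<Sum>i\<in>UNIV. fst v $ i *\<^sub>R (axis i 1, 0)) + (\<Sum>i\<in>UNIV. snd v $ i *\<^sub>R (0, axis i 1)))"
    by simp
  also have "\<dots> = (\<Sum>i\<in>UNIV. fst v $ i * g' (axis i 1, 0)) + (\<Sum>i\<in>UNIV. snd v $ i * g' (0, axis i 1))"
    by (simp only: linear_add[OF lin] linear_sum[OF lin] linear_scale[OF lin] real_scaleR_def)
  also have "\<dots> = (\<Sum>i\<in>UNIV. Re (cnj (cgrad g y $ i) * of_phase v $ i))"
    by (simp add: g' cgrad_def of_phase_def sum.distrib mult.commute)
  finally show ?thesis .
qed

text \<open>The gradient loses one power of the radius, its Lipschitz constant two. A bound on the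
  gradient alone would not make the fixed point map a contraction.\<close>

lemma cgrad_estimates:
  fixes g :: "(real ^ 'n) \<times> (real ^ 'n) \<Rightarrow> real"
  assumes W: "open W" "0 \<in> W" and g: "smooth_on W g" and van: "vanishes (Suc (Suc m)) g"
  shows "\<exists>C \<rho>. 0 \<le> C \<and> 0 < \<rho> \<and> (\<forall>r. 0 < r \<and> r \<le> \<rho> \<longrightarrow> (\<forall>y\<in>cball 0 r. \<forall>y'\<in>cball 0 r.
      norm (cgrad g y) \<le> C * r ^ Suc m \<and> norm (cgrad g y - cgrad g y') \<le> C * r ^ m * norm (y - y')))"
proof -
  define D where "D v y = frechet_derivative g (at y) v" for v y
  have "\<exists>C \<rho>. 0 \<le> C \<and> 0 < \<rho> \<and> (\<forall>r. 0 < r \<and> r \<le> \<rho> \<longrightarrow> (\<forall>y\<in>cball 0 r. \<forall>y'\<in>cball 0 r.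
      \<bar>D v y\<bar> \<le> C * r ^ Suc m \<and> \<bar>D v y - D v y'\<bar> \<le> C * r ^ m * norm (y - y')))" for v
  proof -
    have van': "vanishes (Suc m) (D v)" and sm: "smooth_on W (D v)"
      unfolding D_def using vanishes_derivative[OF W g van] smooth_on_derivative[OF g] by auto
    from van' obtain C1 \<rho>1 where 1: "0 \<le> C1" "0 < \<rho>1"
      "\<And>r y. 0 < r \<Longrightarrow> r \<le> \<rho>1 \<Longrightarrow> y \<in> cball 0 r \<Longrightarrow> \<bar>D v y\<bar> \<le> C1 * r ^ Suc m"
      unfolding vanishes_def by metis
    from vanishes_lipschitz[OF W sm van'] obtain C2 \<rho>2 where 2: "0 \<le> C2" "0 < \<rho>2"
      "\<And>r y y'. 0 < r \<Longrightarrow> r \<le> \<rho>2 \<Longrightarrow> y \<in> cball 0 r \<Longrightarrow> y' \<in> cball 0 r \<Longrightarrow>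
         \<bar>D v y - D v y'\<bar> \<le> C2 * r ^ m * norm (y - y')"
      by metis
    show ?thesis
    proof (rule exI[of _ "C1 + C2"], rule exI[of _ "min \<rho>1 \<rho>2"], intro conjI allI impI ballI)
      fix r and y y' :: "(real ^ 'n) \<times> (real ^ 'n)" assume r: "0 < r \<and> r \<le> min \<rho>1 \<rho>2" and y: "y \<in> cball 0 r" "y' \<in> cball 0 r"
      have "\<bar>D v y\<bar> \<le> C1 * r ^ Suc m" using 1 r y by auto
      also have "\<dots> \<le> (C1 + C2) * r ^ Suc m" using 2 r by (intro mult_right_mono) auto
      finally show "\<bar>D v y\<bar> \<le> (C1 + C2) * r ^ Suc m" .
      have "\<bar>D v y - D v y'\<bar> \<le> C2 * r ^ m * norm (y - y')" using 2 r y by auto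
      also have "\<dots> \<le> (C1 + C2) * r ^ m * norm (y - y')" using 1 r by (intro mult_right_mono) auto
      finally show "\<bar>D v y - D v y'\<bar> \<le> (C1 + C2) * r ^ m * norm (y - y')" .
    qed (use 1 2 in auto)
  qed
  then obtain C \<rho> where C: "\<And>v. 0 \<le> C v" "\<And>v. 0 < \<rho> v"
    "\<And>v r y y'. 0 < r \<Longrightarrow> r \<le> \<rho> v \<Longrightarrow> y \<in> cball 0 r \<Longrightarrow> y' \<in> cball 0 r \<Longrightarrow>
      \<bar>D v y\<bar> \<le> C v * r ^ Suc m \<and> \<bar>D v y - D v y'\<bar> \<le> C v * r ^ m * norm (y - y')"
    by metis
  define E where "E = (\<Sum>i\<in>UNIV. C (axis i 1, 0) + C (0, axis i 1 :: real ^ 'n))"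
  define \<rho>0 where "\<rho>0 = Min (range (\<lambda>i. min (\<rho> (axis i 1, 0)) (\<rho> (0, axis i 1 :: real ^ 'n))))"
  have \<rho>0: "\<rho>0 > 0" "\<And>i. \<rho>0 \<le> \<rho> (axis i 1, 0)" "\<And>i. \<rho>0 \<le> \<rho> (0, axis i 1)"
  proof -
    show "\<rho>0 > 0" using C(2) by (auto simp: \<rho>0_def)
    have "\<rho>0 \<le> min (\<rho> (axis i 1, 0)) (\<rho> (0, axis i 1))" for i unfolding \<rho>0_def by (intro Min_le) auto
    then show "\<rho>0 \<le> \<rho> (axis i 1, 0)" "\<rho>0 \<le> \<rho> (0, axis i 1)" for i by (auto simp: min.bounded_iff)
  qed
  have cD: "cgrad g y $ i = Complex (D (axis i 1, 0) y) (D (0, axis i 1) y)" for y i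
    by (simp add: cgrad_def D_def)
  show ?thesis
  proof (rule exI[of _ E], rule exI[of _ \<rho>0], intro conjI allI impI ballI)
    fix r and y y' :: "(real ^ 'n) \<times> (real ^ 'n)" assume r: "0 < r \<and> r \<le> \<rho>0" and y: "y \<in> cball 0 r" "y' \<in> cball 0 r"
    have b: "\<bar>D (axis i 1, 0) y\<bar> \<le> C (axis i 1, 0) * r ^ Suc m"
      "\<bar>D (0, axis i 1) y\<bar> \<le> C (0, axis i 1) * r ^ Suc m"
      "\<bar>D (axis i 1, 0) y - D (axis i 1, 0) y'\<bar> \<le> C (axis i 1, 0) * r ^ m * norm (y - y')"
      "\<bar>D (0, axis i 1) y - D (0, axis i 1) y'\<bar> \<le> C (0, axis i 1) * r ^ m * norm (y - y')" for i
      using C(3) r y \<rho>0 order_trans by blast+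
    have "norm (cgrad g y) \<le> (\<Sum>i\<in>UNIV. norm (cgrad g y $ i))" unfolding norm_vec_def by (rule L2_set_le_sum) simp
    also have "\<dots> \<le> (\<Sum>i\<in>UNIV. (C (axis i 1, 0) + C (0, axis i 1)) * r ^ Suc m)"
    proof (rule sum_mono)
      fix i
      show "norm (cgrad g y $ i) \<le> (C (axis i 1, 0) + C (0, axis i 1)) * r ^ Suc m"
        using cmod_le[of "cgrad g y $ i"] b(1,2)[of i] by (simp add: cD distrib_right)
    qed
    finally show "norm (cgrad g y) \<le> E * r ^ Suc m" by (simp add: E_def sum_distrib_right)
    have "norm (cgrad g y - cgrad g y') \<le> (\<Sum>i\<in>UNIV. norm ((cgrad g y - cgrad g y') $ i))"
      unfolding norm_vec_def by (rule L2_set_le_sum) simp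
    also have "\<dots> \<le> (\<Sum>i\<in>UNIV. (C (axis i 1, 0) + C (0, axis i 1)) * (r ^ m * norm (y - y')))"
    proof (rule sum_mono)
      fix i
      show "norm ((cgrad g y - cgrad g y') $ i) \<le> (C (axis i 1, 0) + C (0, axis i 1)) * (r ^ m * norm (y - y'))"
        using cmod_le[of "(cgrad g y - cgrad g y') $ i"] b(3,4)[of i] by (simp add: cD distrib_right)
    qed
    finally show "norm (cgrad g y - cgrad g y') \<le> E * r ^ m * norm (y - y')"
      by (simp add: E_def sum_distrib_right mult.assoc)
  qed (use C \<rho>0 in \<open>auto simp: E_def intro!: sum_nonneg add_nonneg_nonneg\<close>)
qed

section \<open>Hamiltonian fields under symplectic maps\<close>

lemma symp_form_ham_field:
  assumes "(H has_derivative H') (at x)"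
  shows "symp_form (ham_field H x) v = - H' v"
proof -
  have "H' v = (\<Sum>i\<in>UNIV. Re (cnj (cgrad H x $ i) * of_phase v $ i))"
    by (rule derivative_cgrad[OF assms])
  then show ?thesis
    by (simp add: symp_form_def ham_field_def cgrad_def of_phase_def inner_vec_def sum.distrib sum_negf algebra_simps)
qed

lemma symp_form_nondegenerate:
  assumes "\<And>v. symp_form u v = symp_form w v" shows "u = w"
proof -
  have "fst u $ i = fst w $ i" "snd u $ i = snd w $ i" for i
    using assms[of "(0, axis i 1)"] assms[of "(axis i 1, 0)"] by (simp_all add: symp_form_def inner_axis)
  then show ?thesis by (simp add: prod_eq_iff vec_eq_iff)
qed

text \<open>The Hamiltonian field is determined by its pairing with all vectors under the symplectic
  form. It is enough to test on vectors \<open>?M v\<close>: a linear map that preserves a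
  nondegenerate form is injective, and in finite dimension onto.\<close>

lemma symplectic_ham_field:
  assumes f: "symplectic_on V f" "y \<in> V" and H: "H differentiable (at (f y))"
  shows "frechet_derivative f (at y) (ham_field (\<lambda>y. H (f y)) y) = ham_field H (f y)"
proof -
  let ?M = "frechet_derivative f (at y)" and ?H' = "frechet_derivative H (at (f y))"
  have M: "(f has_derivative ?M) (at y)" and symp: "\<And>u v. symp_form (?M u) (?M v) = symp_form u v"
    using f frechet_derivative_works[of f "at y"] unfolding symplectic_on_def by blast+
  have H': "(H has_derivative ?H') (at (f y))" using H frechet_derivative_works by blast
  have lin: "linear ?M" using M by (rule has_derivative_linear)
  have "inj ?M"
  proof (rule linear_injective_0[OF lin, THEN iffD2], intro allI impI)
    fix u assume "?M u = 0"
    then have "symp_form u v = symp_form 0 v" for v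
      using symp[of u v] symp[of 0 v] by (simp add: linear_0[OF lin])
    then show "u = 0" by (rule symp_form_nondegenerate)
  qed
  then have "surj ?M" by (rule linear_inj_imp_surj[OF lin])
  have "((\<lambda>y. H (f y)) has_derivative (\<lambda>v. ?H' (?M v))) (at y)"
    by (rule has_derivative_compose[where g = H, OF M H'])
  then have 1: "symp_form (ham_field (\<lambda>y. H (f y)) y) v = - ?H' (?M v)" for v
    by (rule symp_form_ham_field)
  show ?thesis
  proof (rule symp_form_nondegenerate)
    fix w
    obtain v where w: "w = ?M v" using \<open>surj ?M\<close> by (metis surjD)
    show "symp_form (?M (ham_field (\<lambda>y. H (f y)) y)) w = symp_form (ham_field H (f y)) w"
      unfolding w symp 1 using symp_form_ham_field[OF H'] by simp
  qed
qed

section \<open>Action-angle variables in complex form\<close>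

lemma of_phase_action_angle: "of_phase (action_angle I \<theta>) $ i = of_real (sqrt (2 * I $ i)) * cis (\<theta> $ i)"
  by (simp add: of_phase_def action_angle_def complex_eq_iff)

lemma actions_cmod: "actions y $ i = (cmod (of_phase y $ i))\<^sup>2 / 2"
  by (simp add: actions_def of_phase_def cmod_def)

lemma actions_nonneg: "0 \<le> actions y $ i"
  by (simp add: actions_cmod)

text \<open>Where a coordinate vanishes every angle would do, and \<open>Arg\<close> supplies one.
  This turns identities given in action-angle variables into identities between functions on phase
  space.\<close>

lemma action_angle_surj:
  obtains \<theta> where "y = action_angle (actions y) \<theta>"
proof
  have "of_phase y $ i = of_phase (action_angle (actions y) (\<chi> i. Arg (of_phase y $ i))) $ i" for i
    using rcis_cmod_Arg[of "of_phase y $ i"] by (simp add: of_phase_action_angle actions_cmod rcis_def)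
  then have "of_phase y = of_phase (action_angle (actions y) (\<chi> i. Arg (of_phase y $ i)))"
    unfolding vec_eq_iff by blast
  then show "y = action_angle (actions y) (\<chi> i. Arg (of_phase y $ i))" by (metis to_of_phase(1))
qed

lemma norm_axis_eq: "norm (axis i x) = norm x"
proof -
  have "(\<Sum>j\<in>UNIV. (norm (axis i x $ j))\<^sup>2) = (\<Sum>j\<in>UNIV. if j = i then (norm x)\<^sup>2 else 0)"
    by (rule sum.cong) (simp_all add: axis_def)
  then show ?thesis by (simp add: norm_vec_def L2_set_def)
qed

lemma bounded_linear_axis: "bounded_linear (axis i)"
  by (rule bounded_linear_intro[of _ 1]) (simp_all add: norm_axis_eq, simp_all add: axis_def vec_eq_iff)

lemma vec_sum_axis: "(\<Sum>i\<in>UNIV. axis i (v $ i)) = v"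
  by (simp add: vec_eq_iff axis_def if_distrib cong: if_cong)

lemma has_derivative_vec_lambda:
  fixes f :: "'a::real_normed_vector \<Rightarrow> 'n::finite \<Rightarrow> 'b::real_normed_vector"
  assumes "\<And>i. ((\<lambda>x. f x i) has_derivative (\<lambda>h. f' h i)) (at x within S)"
  shows "((\<lambda>x. \<chi> i. f x i) has_derivative (\<lambda>h. \<chi> i. f' h i)) (at x within S)"
proof -
  have "((\<lambda>x. \<Sum>i\<in>UNIV. axis i (f x i)) has_derivative (\<lambda>h. \<Sum>i\<in>UNIV. axis i (f' h i))) (at x within S)"
    by (intro has_derivative_sum bounded_linear.has_derivative[OF bounded_linear_axis] assms)
  then show ?thesis
    using vec_sum_axis[of "\<chi> i. f _ i"] vec_sum_axis[of "\<chi> i. f' _ i"] by simp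
qed

section \<open>Rotations orthogonal to the resonance vector\<close>

definition torus_rotate :: "real ^ 'n \<Rightarrow> (real ^ 'n) \<times> (real ^ 'n) \<Rightarrow> (real ^ 'n) \<times> (real ^ 'n)" where
  "torus_rotate \<alpha> y = to_phase (\<chi> i. cis (\<alpha> $ i) * of_phase y $ i)"

definition torus_invariant :: "nat ^ 'n \<Rightarrow> ((real ^ 'n) \<times> (real ^ 'n) \<Rightarrow> real) \<Rightarrow> bool" where
  "torus_invariant k g \<longleftrightarrow> (\<forall>\<alpha> y. \<alpha> \<bullet> rvec k = 0 \<longrightarrow> g (torus_rotate \<alpha> y) = g y)"

text \<open>Since a coordinate has modulus sqrt (2 I), the division by sqrt 2 gives the monomial the
  modulus required by the resonant term; its argument is <theta,k>. The resonant term thereby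
  becomes a polynomial on phase space.\<close>

definition resonant_monomial :: "nat ^ 'n \<Rightarrow> complex ^ 'n \<Rightarrow> complex" where
  "resonant_monomial k c = (\<Prod>i\<in>UNIV. (c $ i / of_real (sqrt 2)) ^ (k $ i))"

lemma of_phase_torus_rotate [simp]: "of_phase (torus_rotate \<alpha> y) $ i = cis (\<alpha> $ i) * of_phase y $ i"
  by (simp add: torus_rotate_def)

lemma torus_rotate_action_angle: "torus_rotate \<alpha> (action_angle I \<theta>) = action_angle I (\<theta> + \<alpha>)"
proof -
  have "of_phase (torus_rotate \<alpha> (action_angle I \<theta>)) = of_phase (action_angle I (\<theta> + \<alpha>))"
    by (simp add: vec_eq_iff of_phase_action_angle cis_mult add.commute)
  then show ?thesis by (metis to_of_phase(1))
qed

lemma norm_torus_rotate [simp]: "norm (torus_rotate \<alpha> y) = norm y"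
proof -
  have "norm (torus_rotate \<alpha> y) = norm (of_phase y)"
    unfolding torus_rotate_def norm_to_phase by (simp add: norm_vec_def norm_mult)
  then show ?thesis by simp
qed

lemma actions_torus_rotate [simp]: "actions (torus_rotate \<alpha> y) = actions y"
  by (simp add: vec_eq_iff actions_cmod norm_mult)

lemma bounded_linear_torus_rotate: "bounded_linear (torus_rotate \<alpha>)"
proof (rule bounded_linear_intro[of _ 1])
  show "torus_rotate \<alpha> (x + y) = torus_rotate \<alpha> x + torus_rotate \<alpha> y" for x y
  proof -
    have "of_phase (torus_rotate \<alpha> (x + y)) = of_phase (torus_rotate \<alpha> x + torus_rotate \<alpha> y)"
      by (simp add: vec_eq_iff linear_add[OF bounded_linear.linear[OF bounded_linear_of_phase]] distrib_left)
    then show ?thesis by (metis to_of_phase(1))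
  qed
  show "torus_rotate \<alpha> (r *\<^sub>R x) = r *\<^sub>R torus_rotate \<alpha> x" for r x
  proof -
    have "of_phase (torus_rotate \<alpha> (r *\<^sub>R x)) = of_phase (r *\<^sub>R torus_rotate \<alpha> x)"
      by (simp add: vec_eq_iff linear_scale[OF bounded_linear.linear[OF bounded_linear_of_phase]])
    then show ?thesis by (metis to_of_phase(1))
  qed
qed simp

lemma cgrad_unique:
  assumes "(g has_derivative g') (at y)"
    and "\<And>v. g' v = (\<Sum>i\<in>UNIV. Re (cnj (c $ i) * of_phase v $ i))"
  shows "cgrad g y = c"
proof -
  have g': "g' = frechet_derivative g (at y)" using assms(1) by (rule frechet_derivative_at)
  have "(\<Sum>j\<in>UNIV. Re (cnj (c $ j) * of_phase (axis i 1, 0) $ j)) = (\<Sum>j\<in>UNIV. if j = i then Re (c $ j) else 0)" for i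
    by (rule sum.cong) (simp_all add: of_phase_def axis_def)
  then have "Re (c $ i) = frechet_derivative g (at y) (axis i 1, 0)" for i
    using assms(2)[of "(axis i 1, 0)"] by (simp add: g'[symmetric])
  moreover have "(\<Sum>j\<in>UNIV. Re (cnj (c $ j) * of_phase (0, axis i 1) $ j)) = (\<Sum>j\<in>UNIV. if j = i then Im (c $ j) else 0)" for i
    by (rule sum.cong) (simp_all add: of_phase_def axis_def)
  then have "Im (c $ i) = frechet_derivative g (at y) (0, axis i 1)" for i
    using assms(2)[of "(0, axis i 1)"] by (simp add: g'[symmetric])
  ultimately show ?thesis by (simp add: vec_eq_iff cgrad_def complex_eq_iff)
qed

lemma cgrad_add:
  assumes "f differentiable (at y)" "g differentiable (at y)"
  shows "cgrad (\<lambda>y. f y + g y) y = cgrad f y + cgrad g y"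
proof -
  have f: "(f has_derivative frechet_derivative f (at y)) (at y)"
    and g: "(g has_derivative frechet_derivative g (at y)) (at y)"
    using assms frechet_derivative_works by blast+
  show ?thesis
    by (rule cgrad_unique[OF has_derivative_add[OF f g]])
       (simp add: derivative_cgrad[OF f] derivative_cgrad[OF g] distrib_right sum.distrib)
qed

text \<open>Rotations are isometries, so the gradient of an invariant function is equivariant. This
  removes the transversal phases from the truncated equations.\<close>

lemma cgrad_torus_rotate:
  assumes inv: "torus_invariant k g" and diff: "\<And>y. g differentiable (at y)" and \<alpha>: "\<alpha> \<bullet> rvec k = 0"
  shows "cgrad g (torus_rotate \<alpha> y) $ i = cis (\<alpha> $ i) * cgrad g y $ i"
proof -
  let ?D = "frechet_derivative g (at (torus_rotate \<alpha> y))"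
  have D: "(g has_derivative ?D) (at (torus_rotate \<alpha> y))" using diff frechet_derivative_works by blast
  have "((\<lambda>y. g (torus_rotate \<alpha> y)) has_derivative (\<lambda>v. ?D (torus_rotate \<alpha> v))) (at y)"
    by (rule has_derivative_compose[where g = g, OF bounded_linear_imp_has_derivative[OF bounded_linear_torus_rotate] D])
  moreover have "(\<lambda>y. g (torus_rotate \<alpha> y)) = g"
    by (rule ext) (use inv \<alpha> in \<open>unfold torus_invariant_def, blast\<close>)
  ultimately have "(g has_derivative (\<lambda>v. ?D (torus_rotate \<alpha> v))) (at y)" by simp
  then have "cgrad g y = (\<chi> i. cis (- \<alpha> $ i) * cgrad g (torus_rotate \<alpha> y) $ i)"
    by (rule cgrad_unique) (simp add: derivative_cgrad[OF D] cis_cnj mult_ac)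
  then have "cis (\<alpha> $ i) * cgrad g y $ i = cis (\<alpha> $ i) * cis (- \<alpha> $ i) * cgrad g (torus_rotate \<alpha> y) $ i"
    by (simp add: mult.assoc)
  then show ?thesis by (simp add: cis_mult)
qed

text \<open>Noether's theorem: differentiating the invariance under rotation by multiples of
  \<open>s\<close> shows that the sum of s_i I_i is a first integral. Minus the imaginary part in
  the sum is the velocity of I_i.\<close>

lemma cgrad_tangential_sum:
  assumes inv: "torus_invariant k g" and diff: "\<And>y. g differentiable (at y)" and s: "s \<bullet> rvec k = 0"
  shows "(\<Sum>i\<in>UNIV. s $ i * Im (cnj (of_phase y $ i) * cgrad g y $ i)) = 0"
proof -
  have D: "(g has_derivative frechet_derivative g (at y)) (at y)" using diff frechet_derivative_works by blast
  have r0: "torus_rotate (0 *\<^sub>R s) y = y" by (simp add: torus_rotate_def)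
  have "((\<lambda>t. (\<chi> i. cis (t * s $ i) * of_phase y $ i)) has_derivative
        (\<lambda>h. (\<chi> i. h *\<^sub>R (\<i> * of_real (s $ i) * of_phase y $ i)))) (at 0)"
  proof (rule has_derivative_vec_lambda)
    fix i
    have "((\<lambda>t. cis (t * s $ i) * of_phase y $ i) has_vector_derivative \<i> * of_real (s $ i) * of_phase y $ i) (at 0)"
      unfolding cis_conv_exp
      by (auto intro!: derivative_eq_intros has_vector_derivative_real_field simp: field_simps)
    then show "((\<lambda>t. cis (t * s $ i) * of_phase y $ i) has_derivative (\<lambda>h. h *\<^sub>R (\<i> * of_real (s $ i) * of_phase y $ i))) (at 0)"
      by (simp add: has_vector_derivative_def)
  qed
  from bounded_linear.has_derivative[OF bounded_linear_to_phase this]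
  have "((\<lambda>t. torus_rotate (t *\<^sub>R s) y) has_derivative
        (\<lambda>h. to_phase (\<chi> i. h *\<^sub>R (\<i> * of_real (s $ i) * of_phase y $ i)))) (at 0)"
    by (simp add: torus_rotate_def)
  then have "((\<lambda>t. g (torus_rotate (t *\<^sub>R s) y)) has_derivative
     (\<lambda>h. frechet_derivative g (at y) (to_phase (\<chi> i. h *\<^sub>R (\<i> * of_real (s $ i) * of_phase y $ i))))) (at 0)"
    by (rule has_derivative_compose[where g = g]) (use D r0 in simp)
  moreover have "(\<lambda>t. g (torus_rotate (t *\<^sub>R s) y)) = (\<lambda>t. g y)"
  proof
    fix t
    have "(t *\<^sub>R s) \<bullet> rvec k = 0" using s by simp
    then show "g (torus_rotate (t *\<^sub>R s) y) = g y" using inv unfolding torus_invariant_def by blast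
  qed
  ultimately have "((\<lambda>t :: real. g y) has_derivative
     (\<lambda>h. frechet_derivative g (at y) (to_phase (\<chi> i. h *\<^sub>R (\<i> * of_real (s $ i) * of_phase y $ i))))) (at 0)"
    by simp
  then have "(\<lambda>h. frechet_derivative g (at y) (to_phase (\<chi> i. h *\<^sub>R (\<i> * of_real (s $ i) * of_phase y $ i)))) = (\<lambda>h. 0)"
    using has_derivative_unique has_derivative_const by blast
  then have "frechet_derivative g (at y) (to_phase (\<chi> i. 1 *\<^sub>R (\<i> * of_real (s $ i) * of_phase y $ i))) = 0"
    by metis
  then have "(\<Sum>i\<in>UNIV. Re (cnj (cgrad g y $ i) * (\<i> * of_real (s $ i) * of_phase y $ i))) = 0"
    by (subst (asm) derivative_cgrad[OF D]) simp
  then show ?thesis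
    by (simp add: algebra_simps)
qed

text \<open>For s = k_j e_i - k_i e_j the first integral is k_j I_i - k_i I_j: under the truncated
  flow the actions move parallel to k, which keeps the channel invariant.\<close>

lemma cgrad_tangential:
  assumes inv: "torus_invariant k g" and diff: "\<And>y. g differentiable (at y)"
  shows "real (k $ j) * Im (cnj (of_phase y $ i) * cgrad g y $ i) = real (k $ i) * Im (cnj (of_phase y $ j) * cgrad g y $ j)"
proof -
  define s :: "real ^ 'a" where "s = real (k $ j) *\<^sub>R axis i 1 - real (k $ i) *\<^sub>R axis j 1"
  have "s \<bullet> rvec k = 0" by (simp add: s_def inner_diff_left inner_axis' rvec_def)
  from cgrad_tangential_sum[OF inv diff this, of y]
  have "s \<bullet> (\<chi> i. Im (cnj (of_phase y $ i) * cgrad g y $ i)) = 0" by (simp add: inner_vec_def)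
  then show ?thesis by (simp add: s_def inner_diff_left inner_axis')
qed

section \<open>Gradients of the terms of the normal form\<close>

lemma cgrad_actions:
  assumes diff: "p differentiable (at (actions y))"
  shows "cgrad (\<lambda>y. p (actions y)) y $ i = of_real (frechet_derivative p (at (actions y)) (axis i 1)) * of_phase y $ i"
proof -
  let ?D = "frechet_derivative p (at (actions y))"
  have D: "(p has_derivative ?D) (at (actions y))" using diff frechet_derivative_works by blast
  have lin: "linear ?D" using D by (rule has_derivative_linear)
  have "(actions has_derivative (\<lambda>v. \<chi> i. Re (cnj (of_phase y $ i) * of_phase v $ i))) (at y)"
    unfolding actions_def[abs_def]
  proof (rule has_derivative_vec_lambda)
    show "((\<lambda>y. ((fst y $ i)\<^sup>2 + (snd y $ i)\<^sup>2) / 2) has_derivative (\<lambda>v. Re (cnj (of_phase y $ i) * of_phase v $ i))) (at y)" for i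
    proof -
      have "((\<lambda>y. fst y $ i) has_derivative (\<lambda>v. fst v $ i)) (at y)" "((\<lambda>y. snd y $ i) has_derivative (\<lambda>v. snd v $ i)) (at y)"
        by (intro bounded_linear_imp_has_derivative bounded_linear_compose[OF bounded_linear_vec_nth]
              bounded_linear_fst bounded_linear_snd)+
      then show ?thesis
        by (auto intro!: derivative_eq_intros simp: of_phase_def power2_eq_square field_simps)
    qed
  qed
  from has_derivative_compose[where g = p, OF this D]
  have "((\<lambda>y. p (actions y)) has_derivative (\<lambda>v. ?D (\<chi> i. Re (cnj (of_phase y $ i) * of_phase v $ i)))) (at y)" .
  then have "cgrad (\<lambda>y. p (actions y)) y = (\<chi> i. of_real (?D (axis i 1)) * of_phase y $ i)"
  proof (rule cgrad_unique)
    fix v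
    have rep: "?D x = (\<Sum>i\<in>UNIV. x $ i * ?D (axis i 1))" for x :: "real ^ 'a"
    proof -
      have "?D x = ?D (\<Sum>i\<in>UNIV. x $ i *\<^sub>R axis i 1)" by (simp add: basis_expansion flip: scalar_mult_eq_scaleR)
      then show ?thesis by (simp only: linear_sum[OF lin] linear_scale[OF lin] real_scaleR_def)
    qed
    show "?D (\<chi> i. Re (cnj (of_phase y $ i) * of_phase v $ i)) =
       (\<Sum>i\<in>UNIV. Re (cnj ((\<chi> i. of_real (?D (axis i 1)) * of_phase y $ i) $ i) * of_phase v $ i))"
      by (subst rep) (simp add: algebra_simps)
  qed
  then show ?thesis by simp
qed

text \<open>Up to conjugation the gradient is the complex derivative of a holomorphic monomial, and
  z_i times that derivative is k_i times the monomial. With the factor z_i on the left the identity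
  also holds where z_i = 0.\<close>

lemma cgrad_resonant:
  assumes diff: "(\<lambda>y. Re (\<eta> * resonant_monomial k (of_phase y))) differentiable (at y)"
  shows "cnj (of_phase y $ i) * cgrad (\<lambda>y. Re (\<eta> * resonant_monomial k (of_phase y))) y $ i =
     cnj (of_nat (k $ i) * \<eta> * resonant_monomial k (of_phase y))"
proof -
  define g where "g = (\<lambda>y. Re (\<eta> * resonant_monomial k (of_phase y)))"
  let ?D = "frechet_derivative g (at y)" and ?Z = "resonant_monomial k (of_phase y)"
  have D: "(g has_derivative ?D) (at y)" using diff frechet_derivative_works unfolding g_def by blast
  have key: "Re (cnj (cgrad g y $ i) * (w * of_phase y $ i)) = Re (w * (of_nat (k $ i) * \<eta> * ?Z))" for w
  proof -
    \<comment> \<open>The i-th coordinate alone moves, in the direction w z_i with an arbitrary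
      complex w. The monomial is then multiplied by a power of 1 + t w, which can be differentiated
      without dividing by z_i; varying w recovers the complex identity.\<close>
    define b where "b t = (\<chi> j. if j = i then (1 + of_real t * w) * of_phase y $ i else of_phase y $ j)" for t :: real
    have b0: "b 0 = of_phase y" by (simp add: b_def vec_eq_iff)
    have Zb: "resonant_monomial k (b t) = (1 + of_real t * w) ^ (k $ i) * ?Z" for t
    proof -
      have "resonant_monomial k (b t) =
          (\<Prod>j\<in>UNIV. (if j = i then (1 + of_real t * w) ^ (k $ i) else 1) * (of_phase y $ j / of_real (sqrt 2)) ^ (k $ j))"
        unfolding resonant_monomial_def by (rule prod.cong) (auto simp: b_def power_mult_distrib power_divide)
      then show ?thesis by (simp add: prod.distrib resonant_monomial_def)
    qed
    have "(b has_derivative (\<lambda>h. \<chi> j. if j = i then h *\<^sub>R (w * of_phase y $ i) else 0)) (at 0)"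
      unfolding b_def[abs_def]
    proof (rule has_derivative_vec_lambda)
      show "((\<lambda>t. if j = i then (1 + of_real t * w) * of_phase y $ i else of_phase y $ j) has_derivative
          (\<lambda>h. if j = i then h *\<^sub>R (w * of_phase y $ i) else 0)) (at 0)" for j
        by (cases "j = i") (auto intro!: derivative_eq_intros simp: scaleR_conv_of_real)
    qed
    from bounded_linear.has_derivative[OF bounded_linear_to_phase this]
    have "((\<lambda>t. g (to_phase (b t))) has_derivative
        (\<lambda>h. ?D (to_phase (\<chi> j. if j = i then h *\<^sub>R (w * of_phase y $ i) else 0)))) (at 0)"
      by (rule has_derivative_compose[where g = g]) (use D in \<open>simp add: b0\<close>)
    moreover have "((\<lambda>t :: real. g (to_phase (b t))) has_derivative
        (\<lambda>h. Re (h *\<^sub>R (\<eta> * (of_nat (k $ i) * w * ?Z))))) (at 0)"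
      unfolding g_def to_of_phase Zb
      by (auto intro!: derivative_eq_intros simp: scaleR_conv_of_real algebra_simps)
    ultimately have "(\<lambda>h. ?D (to_phase (\<chi> j. if j = i then h *\<^sub>R (w * of_phase y $ i) else 0))) =
        (\<lambda>h. Re (h *\<^sub>R (\<eta> * (of_nat (k $ i) * w * ?Z))))"
      by (rule has_derivative_unique)
    from fun_cong[OF this, of 1]
    have "?D (to_phase (\<chi> j. if j = i then w * of_phase y $ i else 0)) = Re (\<eta> * (of_nat (k $ i) * w * ?Z))"
      unfolding scaleR_one .
    then have "(\<Sum>j\<in>UNIV. Re (cnj (cgrad g y $ j) * (if j = i then w * of_phase y $ i else 0))) =
        Re (w * (of_nat (k $ i) * \<eta> * ?Z))"
      unfolding derivative_cgrad[OF D] to_of_phase vec_lambda_beta by (simp add: mult_ac)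
    moreover have "(\<Sum>j\<in>UNIV. Re (cnj (cgrad g y $ j) * (if j = i then w * of_phase y $ i else 0))) =
        (\<Sum>j\<in>UNIV. if j = i then Re (cnj (cgrad g y $ i) * (w * of_phase y $ i)) else 0)"
      by (rule sum.cong) auto
    ultimately show ?thesis by simp
  qed
  have eqI: "c1 = c2" if "\<And>w. Re (w * c1) = Re (w * c2)" for c1 c2 :: complex
    using that[of 1] that[of \<i>] by (simp add: complex_eq_iff)
  have "cnj (cgrad g y $ i) * of_phase y $ i = of_nat (k $ i) * \<eta> * ?Z"
  proof (rule eqI)
    show "Re (w * (cnj (cgrad g y $ i) * of_phase y $ i)) = Re (w * (of_nat (k $ i) * \<eta> * ?Z))" for w
      using key[of w] by (simp only: mult.left_commute[of w "cnj (cgrad g y $ i)"])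
  qed
  from arg_cong[OF this, of cnj] show ?thesis
    unfolding g_def by (simp only: complex_cnj_mult complex_cnj_cnj mult.commute[of _ "cnj (of_phase y $ i)"])
qed

section \<open>Orders in the radius\<close>

text \<open>Size and Lipschitz constant in \<open>z\<close> share the order r^m, uniformly in the
  parameter \<open>u\<close>. The order is an integer because the phases enter with the negative
  power r^(1-N). The bound \<open>\<rho> \<le> 1\<close> makes higher orders imply lower ones, and
  joint continuity is carried along for the fixed point argument.\<close>

definition small_order ::
  "real \<Rightarrow> int \<Rightarrow> ('p::metric_space \<Rightarrow> real \<Rightarrow> 'z::real_normed_vector \<Rightarrow> 'b::real_normed_vector) \<Rightarrow> bool" where
  "small_order d m e \<longleftrightarrow> (\<exists>C \<rho>. 0 \<le> C \<and> 0 < \<rho> \<and> \<rho> \<le> 1 \<and>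
     continuous_on (UNIV \<times> {0<..\<rho>} \<times> cball 0 d) (\<lambda>(u, r, z). e u r z) \<and>
     (\<forall>u r z z'. 0 < r \<longrightarrow> r \<le> \<rho> \<longrightarrow> norm z \<le> d \<longrightarrow> norm z' \<le> d \<longrightarrow>
        norm (e u r z) \<le> C * r powi m \<and> norm (e u r z - e u r z') \<le> C * r powi m * norm (z - z')))"

lemma small_orderI:
  assumes "0 \<le> C" "0 < \<rho>" "\<rho> \<le> 1"
    and "continuous_on (UNIV \<times> {0<..\<rho>} \<times> cball 0 d) (\<lambda>(u, r, z). e u r z)"
    and "\<And>u r z. 0 < r \<Longrightarrow> r \<le> \<rho> \<Longrightarrow> norm z \<le> d \<Longrightarrow> norm (e u r z) \<le> C * r powi m"
    and "\<And>u r z z'. 0 < r \<Longrightarrow> r \<le> \<rho> \<Longrightarrow> norm z \<le> d \<Longrightarrow> norm z' \<le> d \<Longrightarrow>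
          norm (e u r z - e u r z') \<le> C * r powi m * norm (z - z')"
  shows "small_order d m e"
  unfolding small_order_def using assms by blast

lemma small_orderE:
  assumes "small_order d m e" "0 < \<rho>0"
  obtains C \<rho> where "0 \<le> C" "0 < \<rho>" "\<rho> \<le> 1" "\<rho> \<le> \<rho>0"
    "continuous_on (UNIV \<times> {0<..\<rho>} \<times> cball 0 d) (\<lambda>(u, r, z). e u r z)"
    "\<And>u r z. 0 < r \<Longrightarrow> r \<le> \<rho> \<Longrightarrow> norm z \<le> d \<Longrightarrow> norm (e u r z) \<le> C * r powi m"
    "\<And>u r z z'. 0 < r \<Longrightarrow> r \<le> \<rho> \<Longrightarrow> norm z \<le> d \<Longrightarrow> norm z' \<le> d \<Longrightarrow>
          norm (e u r z - e u r z') \<le> C * r powi m * norm (z - z')"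
proof -
  from assms(1) obtain C \<rho> where C: "0 \<le> C" "0 < \<rho>" "\<rho> \<le> 1"
     "continuous_on (UNIV \<times> {0<..\<rho>} \<times> cball 0 d) (\<lambda>(u, r, z). e u r z)"
     "\<forall>u r z z'. 0 < r \<longrightarrow> r \<le> \<rho> \<longrightarrow> norm z \<le> d \<longrightarrow> norm z' \<le> d \<longrightarrow>
        norm (e u r z) \<le> C * r powi m \<and> norm (e u r z - e u r z') \<le> C * r powi m * norm (z - z')"
    unfolding small_order_def by blast
  show thesis
  proof (rule that[of C "min \<rho> \<rho>0"])
    show "continuous_on (UNIV \<times> {0<..min \<rho> \<rho>0} \<times> cball 0 d) (\<lambda>(u, r, z). e u r z)"
      by (rule continuous_on_subset[OF C(4)]) auto
    show "norm (e u r z) \<le> C * r powi m" if "0 < r" "r \<le> min \<rho> \<rho>0" "norm z \<le> d" for u r z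
      using C(5) that by auto
    show "norm (e u r z - e u r z') \<le> C * r powi m * norm (z - z')"
      if "0 < r" "r \<le> min \<rho> \<rho>0" "norm z \<le> d" "norm z' \<le> d" for u r z z'
      using C(5) that by auto
  qed (use C assms in auto)
qed

lemma small_order_weaken:
  assumes "small_order d m e" "m' \<le> m" shows "small_order d m' e"
proof -
  from small_orderE[OF assms(1) zero_less_one] obtain C \<rho> where C: "0 \<le> C" "0 < \<rho>" "\<rho> \<le> 1"
    "continuous_on (UNIV \<times> {0<..\<rho>} \<times> cball 0 d) (\<lambda>(u, r, z). e u r z)"
    "\<And>u r z. 0 < r \<Longrightarrow> r \<le> \<rho> \<Longrightarrow> norm z \<le> d \<Longrightarrow> norm (e u r z) \<le> C * r powi m"
    "\<And>u r z z'. 0 < r \<Longrightarrow> r \<le> \<rho> \<Longrightarrow> norm z \<le> d \<Longrightarrow> norm z' \<le> d \<Longrightarrow>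
          norm (e u r z - e u r z') \<le> C * r powi m * norm (z - z')"
    by metis
  have p: "C * r powi m \<le> C * r powi m'" if "0 < r" "r \<le> \<rho>" for r
    using that C assms(2) by (intro mult_left_mono power_int_decreasing) auto
  show ?thesis
  proof (rule small_orderI[OF C(1-4)])
    show "norm (e u r z) \<le> C * r powi m'" if "0 < r" "r \<le> \<rho>" "norm z \<le> d" for u r z
      using C(5)[OF that] p[OF that(1,2)] by (rule order_trans)
    show "norm (e u r z - e u r z') \<le> C * r powi m' * norm (z - z')"
      if "0 < r" "r \<le> \<rho>" "norm z \<le> d" "norm z' \<le> d" for u r z z'
      using C(6)[OF that] by (rule order_trans) (intro mult_right_mono p that norm_ge_zero)
  qed
qed

lemma small_order_const: "small_order d 0 (\<lambda>u r z. c)"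
  by (rule small_orderI[of "norm c" 1]) (auto intro!: continuous_intros mult_nonneg_nonneg)

lemma small_order_powi: "small_order d m (\<lambda>u r z. r powi m)"
proof (rule small_orderI[of 1 1])
  show "continuous_on (UNIV \<times> {0<..1} \<times> cball 0 d) (\<lambda>(u, r :: real, z). r powi m)"
    unfolding case_prod_unfold by (intro continuous_intros) auto
qed auto

lemma small_order_power: "small_order d (int m) (\<lambda>u r z. r ^ m)"
  using small_order_powi[of d "int m"] by simp

lemma small_order_linear:
  assumes "bounded_linear f" shows "small_order d 0 (\<lambda>u r z. f z)"
proof -
  interpret f: bounded_linear f by fact
  obtain K where K: "0 \<le> K" "\<And>x. norm (f x) \<le> norm x * K" using f.nonneg_bounded by blast
  have K': "0 \<le> K * (1 + \<bar>d\<bar>)" using K by simp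
  show ?thesis
  proof (rule small_orderI[OF K' zero_less_one order_refl])
    show "continuous_on (UNIV \<times> {0<..1} \<times> cball 0 d) (\<lambda>(u, r, z). f z)"
      unfolding case_prod_unfold by (intro f.continuous_on continuous_intros)
    show "norm (f z) \<le> K * (1 + \<bar>d\<bar>) * r powi 0" if "norm z \<le> d" for r z
      using order_trans[OF K(2)[of z] mult_right_mono[of "norm z" "1 + \<bar>d\<bar>" K]] that K(1)
      by (simp add: mult.commute)
    show "norm (f z - f z') \<le> K * (1 + \<bar>d\<bar>) * r powi 0 * norm (z - z')" for r z z'
    proof -
      have "norm (f z - f z') \<le> norm (z - z') * K" using K(2)[of "z - z'"] by (simp add: f.diff)
      also have "\<dots> \<le> norm (z - z') * (K * (1 + \<bar>d\<bar>))"
        using K(1) by (intro mult_left_mono) (auto simp: algebra_simps)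
      finally show ?thesis by (simp add: mult.commute)
    qed
  qed
qed

text \<open>A difference of products splits into two terms of equal order, hence the factor 2 in the
  constant.\<close>

lemma small_order_bilinear:
  fixes e :: "'p::metric_space \<Rightarrow> real \<Rightarrow> 'z::real_normed_vector \<Rightarrow> 'b::real_normed_vector"
    and e' :: "'p \<Rightarrow> real \<Rightarrow> 'z \<Rightarrow> 'c::real_normed_vector"
  assumes b: "bounded_bilinear b" and e: "small_order d m e" and e': "small_order d m' e'"
  shows "small_order d (m + m') (\<lambda>u r z. b (e u r z) (e' u r z))"
proof -
  interpret b: bounded_bilinear b by fact
  obtain K where K: "0 \<le> K" "\<And>x y. norm (b x y) \<le> norm x * norm y * K" using b.nonneg_bounded by blast
  from small_orderE[OF e zero_less_one] obtain C \<rho> where C: "0 \<le> C" "0 < \<rho>" "\<rho> \<le> 1"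
    "continuous_on (UNIV \<times> {0<..\<rho>} \<times> cball 0 d) (\<lambda>(u, r, z). e u r z)"
    "\<And>u r z. 0 < r \<Longrightarrow> r \<le> \<rho> \<Longrightarrow> norm z \<le> d \<Longrightarrow> norm (e u r z) \<le> C * r powi m"
    "\<And>u r z z'. 0 < r \<Longrightarrow> r \<le> \<rho> \<Longrightarrow> norm z \<le> d \<Longrightarrow> norm z' \<le> d \<Longrightarrow>
          norm (e u r z - e u r z') \<le> C * r powi m * norm (z - z')"
    by metis
  from small_orderE[OF e' C(2)] obtain C' \<rho>' where C': "0 \<le> C'" "0 < \<rho>'" "\<rho>' \<le> 1" "\<rho>' \<le> \<rho>"
    "continuous_on (UNIV \<times> {0<..\<rho>'} \<times> cball 0 d) (\<lambda>(u, r, z). e' u r z)"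
    "\<And>u r z. 0 < r \<Longrightarrow> r \<le> \<rho>' \<Longrightarrow> norm z \<le> d \<Longrightarrow> norm (e' u r z) \<le> C' * r powi m'"
    "\<And>u r z z'. 0 < r \<Longrightarrow> r \<le> \<rho>' \<Longrightarrow> norm z \<le> d \<Longrightarrow> norm z' \<le> d \<Longrightarrow>
          norm (e' u r z - e' u r z') \<le> C' * r powi m' * norm (z - z')"
    by metis
  have add: "r powi (m + m') = r powi m * r powi m'" if "r > 0" for r :: real
    using that by (simp add: power_int_add)
  show ?thesis
  proof (rule small_orderI[of "2 * (C * C' * K)" \<rho>'])
    have "continuous_on (UNIV \<times> {0<..\<rho>'} \<times> cball 0 d) (\<lambda>(u, r, z). e u r z)"
      by (rule continuous_on_subset[OF C(4)]) (use C'(4) in auto)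
    then show "continuous_on (UNIV \<times> {0<..\<rho>'} \<times> cball 0 d) (\<lambda>(u, r, z). b (e u r z) (e' u r z))"
      using C'(5) unfolding case_prod_unfold by (rule b.continuous_on)
    fix u :: 'p and r and z z' :: 'z assume r: "0 < r" "r \<le> \<rho>'" and z: "norm z \<le> d"
    have r': "r \<le> \<rho>" using r C' by simp
    have "norm (b (e u r z) (e' u r z)) \<le> norm (e u r z) * norm (e' u r z) * K" by (rule K)
    also have "\<dots> \<le> (C * r powi m) * (C' * r powi m') * K"
      using C(1,5) C'(1,6) r r' z K by (intro mult_mono) auto
    also have "\<dots> = 1 * (C * C' * K * r powi (m + m'))" using add[OF r(1)] by simp
    also have "\<dots> \<le> 2 * (C * C' * K * r powi (m + m'))"
      using r C(1) C'(1) K(1) by (intro mult_right_mono) auto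
    finally show "norm (b (e u r z) (e' u r z)) \<le> 2 * (C * C' * K) * r powi (m + m')" by simp
    assume z': "norm z' \<le> d"
    have "b (e u r z) (e' u r z) - b (e u r z') (e' u r z') =
        b (e u r z - e u r z') (e' u r z) + b (e u r z') (e' u r z - e' u r z')"
      by (simp add: b.diff_left b.diff_right)
    also have "norm \<dots> \<le> norm (e u r z - e u r z') * norm (e' u r z) * K + norm (e u r z') * norm (e' u r z - e' u r z') * K"
      by (intro norm_triangle_mono K)
    also have "\<dots> \<le> (C * r powi m * norm (z - z')) * (C' * r powi m') * K + (C * r powi m) * (C' * r powi m' * norm (z - z')) * K"
      using C(1,5,6) C'(1,6,7) r r' z z' K by (intro add_mono mult_mono) auto
    also have "\<dots> = 2 * (C * C' * K) * r powi (m + m') * norm (z - z')" using add[OF r(1)] by simp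
    finally show "norm (b (e u r z) (e' u r z) - b (e u r z') (e' u r z')) \<le> 2 * (C * C' * K) * r powi (m + m') * norm (z - z')" .
  qed (use C C' K in auto)
qed

lemma small_order_add:
  fixes e e' :: "'p::metric_space \<Rightarrow> real \<Rightarrow> 'z::real_normed_vector \<Rightarrow> 'b::real_normed_vector"
  assumes e: "small_order d m e" and e': "small_order d m e'"
  shows "small_order d m (\<lambda>u r z. e u r z + e' u r z)"
proof -
  from small_orderE[OF e zero_less_one] obtain C \<rho> where C: "0 \<le> C" "0 < \<rho>" "\<rho> \<le> 1"
    "continuous_on (UNIV \<times> {0<..\<rho>} \<times> cball 0 d) (\<lambda>(u, r, z). e u r z)"
    "\<And>u r z. 0 < r \<Longrightarrow> r \<le> \<rho> \<Longrightarrow> norm z \<le> d \<Longrightarrow> norm (e u r z) \<le> C * r powi m"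
    "\<And>u r z z'. 0 < r \<Longrightarrow> r \<le> \<rho> \<Longrightarrow> norm z \<le> d \<Longrightarrow> norm z' \<le> d \<Longrightarrow>
          norm (e u r z - e u r z') \<le> C * r powi m * norm (z - z')"
    by metis
  from small_orderE[OF e' C(2)] obtain C' \<rho>' where C': "0 \<le> C'" "0 < \<rho>'" "\<rho>' \<le> 1" "\<rho>' \<le> \<rho>"
    "continuous_on (UNIV \<times> {0<..\<rho>'} \<times> cball 0 d) (\<lambda>(u, r, z). e' u r z)"
    "\<And>u r z. 0 < r \<Longrightarrow> r \<le> \<rho>' \<Longrightarrow> norm z \<le> d \<Longrightarrow> norm (e' u r z) \<le> C' * r powi m"
    "\<And>u r z z'. 0 < r \<Longrightarrow> r \<le> \<rho>' \<Longrightarrow> norm z \<le> d \<Longrightarrow> norm z' \<le> d \<Longrightarrow>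
          norm (e' u r z - e' u r z') \<le> C' * r powi m * norm (z - z')"
    by metis
  show ?thesis
  proof (rule small_orderI[of "C + C'" \<rho>'])
    have "continuous_on (UNIV \<times> {0<..\<rho>'} \<times> cball 0 d) (\<lambda>(u, r, z). e u r z)"
      by (rule continuous_on_subset[OF C(4)]) (use C'(4) in auto)
    then show "continuous_on (UNIV \<times> {0<..\<rho>'} \<times> cball 0 d) (\<lambda>(u, r, z). e u r z + e' u r z)"
      using C'(5) unfolding case_prod_unfold by (rule continuous_on_add)
    fix u :: 'p and r and z z' :: 'z assume r: "0 < r" "r \<le> \<rho>'" and z: "norm z \<le> d"
    have r': "r \<le> \<rho>" using r C' by simp
    show "norm (e u r z + e' u r z) \<le> (C + C') * r powi m"
      unfolding distrib_right by (intro norm_triangle_mono C(5) C'(6) r r' z)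
    assume z': "norm z' \<le> d"
    show "norm (e u r z + e' u r z - (e u r z' + e' u r z')) \<le> (C + C') * r powi m * norm (z - z')"
      unfolding distrib_right add_diff_add by (intro norm_triangle_mono C(6) C'(7) r r' z z')
  qed (use C C' in auto)
qed

lemma small_order_linear_compose:
  assumes "bounded_linear f" "small_order d m e"
  shows "small_order d m (\<lambda>u r z. f (e u r z))"
proof -
  have "bounded_bilinear (\<lambda>(x :: real) y. x *\<^sub>R f y)"
    by (rule bounded_bilinear.comp[OF bounded_bilinear_scaleR bounded_linear_ident assms(1)])
  from small_order_bilinear[OF this small_order_const[of d 1] assms(2)] show ?thesis by simp
qed

lemma small_order_uminus: "small_order d m e \<Longrightarrow> small_order d m (\<lambda>u r z. - e u r z)"
  by (rule small_order_linear_compose[OF bounded_linear_minus[OF bounded_linear_ident]])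

lemma small_order_diff:
  "small_order d m e \<Longrightarrow> small_order d m e' \<Longrightarrow> small_order d m (\<lambda>u r z. e u r z - e' u r z)"
  using small_order_add[OF _ small_order_uminus, of d m e e'] by simp

lemma small_order_mult:
  fixes e e' :: "'p::metric_space \<Rightarrow> real \<Rightarrow> 'z::real_normed_vector \<Rightarrow> 'b::real_normed_algebra"
  shows "small_order d m e \<Longrightarrow> small_order d m' e' \<Longrightarrow> small_order d (m + m') (\<lambda>u r z. e u r z * e' u r z)"
  by (rule small_order_bilinear[OF bounded_bilinear_mult])

lemma small_order_zero: "small_order d m (\<lambda>u r z. 0)"
  by (rule small_orderI[of 0 1]) (auto intro!: continuous_intros)

lemma small_order_sum:
  "(\<And>i. i \<in> I \<Longrightarrow> small_order d m (e i)) \<Longrightarrow> small_order d m (\<lambda>u r z. \<Sum>i\<in>I. e i u r z)"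
  by (induction I rule: infinite_finite_induct) (auto intro: small_order_zero small_order_add)

lemma small_order_vec:
  fixes e :: "'p::metric_space \<Rightarrow> real \<Rightarrow> 'z::real_normed_vector \<Rightarrow> 'b::real_normed_vector ^ 'n"
  assumes "\<And>i. small_order d m (\<lambda>u r z. e u r z $ i)"
  shows "small_order d m e"
proof -
  have "small_order d m (\<lambda>u r z. \<Sum>i\<in>UNIV. axis i (e u r z $ i))"
    by (intro small_order_sum small_order_linear_compose[OF bounded_linear_axis] assms)
  then show ?thesis by (simp add: vec_sum_axis)
qed

text \<open>The arguments of interest, such as actions near \<open>k\<close> or ratios near 1, are
  not small themselves; their deviation from a fixed value \<open>c\<close> is. A Lipschitz bound on
  a set \<open>S\<close> containing all the values transfers the order to the deviation of
  \<open>f\<close>.\<close>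

lemma small_order_lipschitz:
  fixes e :: "'p::metric_space \<Rightarrow> real \<Rightarrow> 'z::real_normed_vector \<Rightarrow> 'b::real_normed_vector"
  assumes e: "small_order d m (\<lambda>u r z. e u r z - c)"
    and lip: "\<And>x y. x \<in> S \<Longrightarrow> y \<in> S \<Longrightarrow> norm (f x - f y) \<le> L * norm (x - y)"
    and S: "c \<in> S" "0 < \<rho>0" "\<And>u r z. 0 < r \<Longrightarrow> r \<le> \<rho>0 \<Longrightarrow> norm z \<le> d \<Longrightarrow> e u r z \<in> S"
  shows "small_order d m (\<lambda>u r z. f (e u r z) - f c)"
proof -
  from small_orderE[OF e S(2)] obtain C \<rho> where C: "0 \<le> C" "0 < \<rho>" "\<rho> \<le> 1" "\<rho> \<le> \<rho>0"
    "continuous_on (UNIV \<times> {0<..\<rho>} \<times> cball 0 d) (\<lambda>(u, r, z). e u r z - c)"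
    "\<And>u r z. 0 < r \<Longrightarrow> r \<le> \<rho> \<Longrightarrow> norm z \<le> d \<Longrightarrow> norm (e u r z - c) \<le> C * r powi m"
    "\<And>u r z z'. 0 < r \<Longrightarrow> r \<le> \<rho> \<Longrightarrow> norm z \<le> d \<Longrightarrow> norm z' \<le> d \<Longrightarrow>
          norm (e u r z - c - (e u r z' - c)) \<le> C * r powi m * norm (z - z')"
    by metis
  have lip': "norm (f x - f y) \<le> \<bar>L\<bar> * norm (x - y)" if "x \<in> S" "y \<in> S" for x y
    using lip[OF that] by (rule order_trans) (intro mult_right_mono; simp)
  have contf: "continuous_on S f"
    by (rule lipschitz_on_continuous_on[of "\<bar>L\<bar>"]) (auto simp: lipschitz_on_def dist_norm lip')
  have inS: "e u r z \<in> S" if "0 < r" "r \<le> \<rho>" "norm z \<le> d" for u r z using S(3) C(4) that by auto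
  show ?thesis
  proof (rule small_orderI[of "\<bar>L\<bar> * C" \<rho>])
    have "continuous_on (UNIV \<times> {0<..\<rho>} \<times> cball 0 d) (\<lambda>x. (\<lambda>(u, r, z). e u r z - c) x + c)"
      by (intro continuous_intros C(5))
    then have "continuous_on (UNIV \<times> {0<..\<rho>} \<times> cball 0 d) (\<lambda>x. e (fst x) (fst (snd x)) (snd (snd x)))"
      by (simp add: case_prod_unfold)
    then have "continuous_on (UNIV \<times> {0<..\<rho>} \<times> cball 0 d) (\<lambda>x. f (e (fst x) (fst (snd x)) (snd (snd x))))"
      by (rule continuous_on_compose2[OF contf]) (auto intro!: inS)
    then show "continuous_on (UNIV \<times> {0<..\<rho>} \<times> cball 0 d) (\<lambda>(u, r, z). f (e u r z) - f c)"
      unfolding case_prod_unfold by (intro continuous_intros)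
    fix u :: 'p and r and z z' :: 'z assume r: "0 < r" "r \<le> \<rho>" and z: "norm z \<le> d"
    have "norm (f (e u r z) - f c) \<le> \<bar>L\<bar> * norm (e u r z - c)" using inS r z S by (intro lip')
    also have "\<dots> \<le> \<bar>L\<bar> * (C * r powi m)" using C(6) r z by (intro mult_left_mono) auto
    finally show "norm (f (e u r z) - f c) \<le> \<bar>L\<bar> * C * r powi m" by simp
    assume z': "norm z' \<le> d"
    have "norm (f (e u r z) - f (e u r z')) \<le> \<bar>L\<bar> * norm (e u r z - e u r z')" using inS r z z' by (intro lip')
    also have "\<dots> \<le> \<bar>L\<bar> * (C * r powi m * norm (z - z'))" using C(7)[of r z z'] r z z' by (intro mult_left_mono) simp_all
    finally show "norm (f (e u r z) - f c - (f (e u r z') - f c)) \<le> \<bar>L\<bar> * C * r powi m * norm (z - z')"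
      by simp
  qed (use C in auto)
qed

text \<open>Write the difference as (e - 1) (e' - 1) + (e - 1) + (e' - 1); as
  \<open>0 \<le> m\<close>, the quadratic term has order \<open>m\<close> as well.\<close>

lemma small_order_one_mult:
  fixes e e' :: "'p::metric_space \<Rightarrow> real \<Rightarrow> 'z::real_normed_vector \<Rightarrow> real"
  assumes "small_order d m (\<lambda>u r z. e u r z - 1)" "small_order d m (\<lambda>u r z. e' u r z - 1)" "0 \<le> m"
  shows "small_order d m (\<lambda>u r z. e u r z * e' u r z - 1)"
proof -
  have "small_order d (0 + m) (\<lambda>u r z. (e u r z - 1) * (e' u r z - 1))"
    by (intro small_order_mult small_order_weaken[OF assms(1)] assms)
  then have "small_order d m (\<lambda>u r z. (e u r z - 1) * (e' u r z - 1))" by simp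
  from small_order_add[OF this small_order_add[OF assms(1,2)]]
  have "small_order d m (\<lambda>u r z. (e u r z - 1) * (e' u r z - 1) + ((e u r z - 1) + (e' u r z - 1)))" .
  then show ?thesis by (simp add: algebra_simps)
qed

lemma small_order_one_power:
  fixes e :: "'p::metric_space \<Rightarrow> real \<Rightarrow> 'z::real_normed_vector \<Rightarrow> real"
  assumes "small_order d m (\<lambda>u r z. e u r z - 1)" "0 \<le> m"
  shows "small_order d m (\<lambda>u r z. e u r z ^ l - 1)"
  by (induction l) (auto intro: small_order_zero small_order_one_mult assms)

lemma small_order_one_prod:
  fixes e :: "'i \<Rightarrow> 'p::metric_space \<Rightarrow> real \<Rightarrow> 'z::real_normed_vector \<Rightarrow> real"
  assumes "\<And>i. small_order d m (\<lambda>u r z. e i u r z - 1)" "0 \<le> m"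
  shows "small_order d m (\<lambda>u r z. (\<Prod>i\<in>I. e i u r z) - 1)"
  by (induction I rule: infinite_finite_induct) (auto intro: small_order_zero small_order_one_mult assms)

section \<open>Rotation factors with unbounded phases\<close>

lemma cis_lipschitz: "cmod (cis x - cis y) \<le> \<bar>x - y\<bar>"
proof -
  have "norm (cis x - cis y) \<le> 1 * norm (x - y)"
  proof (rule differentiable_bound[where S = UNIV and f' = "\<lambda>x h. h *\<^sub>R (\<i> * cis x)"])
    show "(cis has_derivative (\<lambda>h. h *\<^sub>R (\<i> * cis x))) (at x within UNIV)" for x
    proof -
      have "((\<lambda>x. exp (\<i> * of_real x)) has_vector_derivative \<i> * exp (\<i> * of_real x)) (at x)"
        by (auto intro!: derivative_eq_intros has_vector_derivative_real_field simp: field_simps)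
      moreover have "cis = (\<lambda>x. exp (\<i> * of_real x))" by (rule ext) (simp add: cis_conv_exp)
      ultimately show ?thesis by (simp add: has_vector_derivative_def cis_conv_exp)
    qed
    show "onorm (\<lambda>h. h *\<^sub>R (\<i> * cis x)) \<le> 1" for x
      by (rule onorm_le) (simp add: norm_mult)
  qed auto
  then show ?thesis by simp
qed

lemma continuous_on_cis: "continuous_on S f \<Longrightarrow> continuous_on S (\<lambda>x. cis (f x))"
  unfolding cis_conv_exp by (intro continuous_intros)

text \<open>The phase may diverge as \<open>r\<close> tends to 0; its rotation factor keeps modulus
  1, and what grows is the Lipschitz constant. The hypothesis \<open>m \<le> 0\<close> makes the
  order compatible with modulus 1.\<close>

lemma small_order_cis:
  fixes e :: "'p::metric_space \<Rightarrow> real \<Rightarrow> 'z::real_normed_vector \<Rightarrow> real"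
  assumes e: "small_order d m e" and f: "continuous_on UNIV f" and m: "m \<le> 0"
  shows "small_order d m (\<lambda>u r z. cis (f u + e u r z))"
proof -
  from small_orderE[OF e zero_less_one] obtain C \<rho> where C: "0 \<le> C" "0 < \<rho>" "\<rho> \<le> 1"
    "continuous_on (UNIV \<times> {0<..\<rho>} \<times> cball 0 d) (\<lambda>(u, r, z). e u r z)"
    "\<And>u r z. 0 < r \<Longrightarrow> r \<le> \<rho> \<Longrightarrow> norm z \<le> d \<Longrightarrow> norm (e u r z) \<le> C * r powi m"
    "\<And>u r z z'. 0 < r \<Longrightarrow> r \<le> \<rho> \<Longrightarrow> norm z \<le> d \<Longrightarrow> norm z' \<le> d \<Longrightarrow>
          norm (e u r z - e u r z') \<le> C * r powi m * norm (z - z')"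
    by metis
  show ?thesis
  proof (rule small_orderI[of "C + 1" \<rho>])
    have "continuous_on (UNIV \<times> {0<..\<rho>} \<times> cball 0 d) (\<lambda>x :: 'p \<times> real \<times> 'z. f (fst x))"
      by (rule continuous_on_compose2[OF f]) (auto intro!: continuous_intros)
    then show "continuous_on (UNIV \<times> {0<..\<rho>} \<times> cball 0 d) (\<lambda>(u, r, z). cis (f u + e u r z))"
      using C(4) unfolding case_prod_unfold by (intro continuous_on_cis continuous_intros)
    fix u :: 'p and r and z z' :: 'z assume r: "0 < r" "r \<le> \<rho>" and z: "norm z \<le> d"
    have "r powi 0 \<le> r powi m" using r C m by (intro power_int_decreasing) auto
    then have p: "1 \<le> r powi m" by simp
    have "1 * 1 \<le> (C + 1) * r powi m" using C(1) p by (intro mult_mono) auto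
    then show "norm (cis (f u + e u r z)) \<le> (C + 1) * r powi m" by simp
    assume z': "norm z' \<le> d"
    have "norm (cis (f u + e u r z) - cis (f u + e u r z')) \<le> norm (e u r z - e u r z')"
      using cis_lipschitz[of "f u + e u r z" "f u + e u r z'"] by simp
    also have "\<dots> \<le> C * r powi m * norm (z - z')" by (rule C(6)[OF r z z'])
    also have "\<dots> \<le> (C + 1) * r powi m * norm (z - z')" using p by (intro mult_right_mono) auto
    finally show "norm (cis (f u + e u r z) - cis (f u + e u r z')) \<le> (C + 1) * r powi m * norm (z - z')" .
  qed (use C in auto)
qed

text \<open>The general product rule would charge the negative order \<open>l\<close> of a rotation
  factor to the size of the product too. A factor of modulus at most 1 costs nothing in size:
  \<open>l\<close> is paid in the Lipschitz constant alone, and there it is added to the size order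
  \<open>p\<close> of the other factor, which may exceed its Lipschitz order
  \<open>p'\<close>.\<close>

lemma small_order_mult_bounded:
  fixes e e' :: "'p::metric_space \<Rightarrow> real \<Rightarrow> 'z::real_normed_vector \<Rightarrow> 'b::real_normed_algebra"
  assumes e: "small_order d l e" "\<And>u r z. norm (e u r z) \<le> 1"
    and e': "small_order d p' e'"
    and b: "0 \<le> K" "0 < \<rho>0" "\<And>u r z. 0 < r \<Longrightarrow> r \<le> \<rho>0 \<Longrightarrow> norm z \<le> d \<Longrightarrow> norm (e' u r z) \<le> K * r powi p"
    and q: "q \<le> p" "q \<le> l + p" "q \<le> p'"
  shows "small_order d q (\<lambda>u r z. e u r z * e' u r z)"
proof -
  from small_orderE[OF e(1) b(2)] obtain C \<rho> where C: "0 \<le> C" "0 < \<rho>" "\<rho> \<le> 1" "\<rho> \<le> \<rho>0"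
    "continuous_on (UNIV \<times> {0<..\<rho>} \<times> cball 0 d) (\<lambda>(u, r, z). e u r z)"
    "\<And>u r z z'. 0 < r \<Longrightarrow> r \<le> \<rho> \<Longrightarrow> norm z \<le> d \<Longrightarrow> norm z' \<le> d \<Longrightarrow>
          norm (e u r z - e u r z') \<le> C * r powi l * norm (z - z')"
    by metis
  from small_orderE[OF e' C(2)] obtain C' \<rho>' where C': "0 \<le> C'" "0 < \<rho>'" "\<rho>' \<le> 1" "\<rho>' \<le> \<rho>"
    "continuous_on (UNIV \<times> {0<..\<rho>'} \<times> cball 0 d) (\<lambda>(u, r, z). e' u r z)"
    "\<And>u r z z'. 0 < r \<Longrightarrow> r \<le> \<rho>' \<Longrightarrow> norm z \<le> d \<Longrightarrow> norm z' \<le> d \<Longrightarrow>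
          norm (e' u r z - e' u r z') \<le> C' * r powi p' * norm (z - z')"
    by metis
  show ?thesis
  proof (rule small_orderI[of "K + C * K + C'" \<rho>'])
    have "continuous_on (UNIV \<times> {0<..\<rho>'} \<times> cball 0 d) (\<lambda>(u, r, z). e u r z)"
      by (rule continuous_on_subset[OF C(5)]) (use C'(4) in auto)
    then show "continuous_on (UNIV \<times> {0<..\<rho>'} \<times> cball 0 d) (\<lambda>(u, r, z). e u r z * e' u r z)"
      using C'(5) unfolding case_prod_unfold by (rule continuous_on_mult)
    fix u :: 'p and r and z z' :: 'z assume r: "0 < r" "r \<le> \<rho>'" and z: "norm z \<le> d"
    have r': "r \<le> \<rho>" "r \<le> \<rho>0" "r \<le> 1" using r C C' by auto
    have mono: "r powi m \<le> r powi q" if "q \<le> m" for m using r r' that by (intro power_int_decreasing) auto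
    have "norm (e u r z * e' u r z) \<le> norm (e u r z) * norm (e' u r z)" by (rule norm_mult_ineq)
    also have "\<dots> \<le> 1 * (K * r powi p)" using e(2) b(3)[OF r(1) r'(2) z] by (intro mult_mono) auto
    also have "\<dots> \<le> 1 * (K * r powi q)" using b(1) mono[OF q(1)] by (intro mult_left_mono) auto
    also have "\<dots> \<le> (K + C * K + C') * r powi q"
      using b(1) C(1) C'(1) r by (simp add: algebra_simps)
    finally show "norm (e u r z * e' u r z) \<le> (K + C * K + C') * r powi q" .
    assume z': "norm z' \<le> d"
    have "e u r z * e' u r z - e u r z' * e' u r z' = (e u r z - e u r z') * e' u r z + e u r z' * (e' u r z - e' u r z')"
      by (simp add: algebra_simps)
    also have "norm \<dots> \<le> norm (e u r z - e u r z') * norm (e' u r z) + norm (e u r z') * norm (e' u r z - e' u r z')"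
      by (intro norm_triangle_mono norm_mult_ineq)
    also have "\<dots> \<le> (C * r powi l * norm (z - z')) * (K * r powi p) + 1 * (C' * r powi p' * norm (z - z'))"
      using e(2) b(1) b(3)[OF r(1) r'(2) z] C(1) C(6)[OF r(1) r'(1) z z'] C'(6)[OF r z z'] r
      by (intro add_mono mult_mono) auto
    also have "\<dots> = (C * K * r powi (l + p) + C' * r powi p') * norm (z - z')"
      using r by (simp add: power_int_add algebra_simps)
    also have "\<dots> \<le> (C * K * r powi q + C' * r powi q) * norm (z - z')"
      using C(1) b(1) C'(1) mono q by (intro mult_right_mono add_mono mult_left_mono) auto
    also have "\<dots> \<le> (K + C * K + C') * r powi q * norm (z - z')"
      using b(1) r by (intro mult_right_mono) (auto simp: algebra_simps)
    finally show "norm (e u r z * e' u r z - e u r z' * e' u r z') \<le> (K + C * K + C') * r powi q * norm (z - z')" .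
  qed (use C C' b in auto)
qed

text \<open>The inner function has size r but Lipschitz order \<open>l\<close>, which may be
  negative; the outer one loses a power between size and Lipschitz constant. The two bounds on
  \<open>q\<close> are the orders of size and Lipschitz constant of the composition. The second
  conclusion records the better size p + 1, for later multiplication by a rotation factor.\<close>

lemma small_order_ball_compose:
  fixes y :: "'p::metric_space \<Rightarrow> real \<Rightarrow> 'z::real_normed_vector \<Rightarrow> 'b::real_normed_vector"
    and g :: "'b \<Rightarrow> 'c::real_normed_vector"
  assumes y: "small_order d l y"
    and yb: "0 \<le> K" "0 < \<rho>0" "\<And>u r z. 0 < r \<Longrightarrow> r \<le> \<rho>0 \<Longrightarrow> norm z \<le> d \<Longrightarrow> norm (y u r z) \<le> K * r"
    and g: "0 \<le> L" "0 < \<rho>1" "\<And>r x x'. 0 < r \<Longrightarrow> r \<le> \<rho>1 \<Longrightarrow> x \<in> cball 0 r \<Longrightarrow> x' \<in> cball 0 r \<Longrightarrow>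
        norm (g x) \<le> L * r ^ Suc p \<and> norm (g x - g x') \<le> L * r ^ p * norm (x - x')"
    and q: "q \<le> int p + 1" "q \<le> int p + l"
  shows "small_order d q (\<lambda>u r z. g (y u r z))"
    and "\<exists>C \<rho>. 0 \<le> C \<and> 0 < \<rho> \<and> (\<forall>u r z. 0 < r \<longrightarrow> r \<le> \<rho> \<longrightarrow> norm z \<le> d \<longrightarrow>
           norm (g (y u r z)) \<le> C * r powi (int p + 1))"
proof -
  define \<kappa> where "\<kappa> = K + 1"
  define \<rho>2 where "\<rho>2 = min \<rho>0 (\<rho>1 / \<kappa>)"
  have \<kappa>: "\<kappa> > 0" using yb by (simp add: \<kappa>_def)
  have \<rho>2: "\<rho>2 > 0" using yb g \<kappa> by (simp add: \<rho>2_def)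
  have yball: "y u r z \<in> cball 0 (\<kappa> * r)" if "0 < r" "r \<le> \<rho>2" "norm z \<le> d" for u r z
  proof -
    have "norm (y u r z) \<le> K * r" using that yb(3) by (simp add: \<rho>2_def)
    also have "\<dots> \<le> \<kappa> * r" using that by (intro mult_right_mono) (auto simp: \<kappa>_def)
    finally show ?thesis by simp
  qed
  have \<kappa>r: "0 < \<kappa> * r" "\<kappa> * r \<le> \<rho>1" if "0 < r" "r \<le> \<rho>2" for r
    using that \<kappa> by (auto simp: \<rho>2_def field_simps)
  have bd: "norm (g (y u r z)) \<le> L * \<kappa> ^ Suc p * r powi (int p + 1)" if "0 < r" "r \<le> \<rho>2" "norm z \<le> d" for u r z
  proof -
    have "norm (g (y u r z)) \<le> L * (\<kappa> * r) ^ Suc p"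
      using g(3)[OF \<kappa>r[OF that(1,2)] yball[OF that] yball[OF that]] by blast
    also have "\<dots> = L * \<kappa> ^ Suc p * r powi (int p + 1)"
      using that by (simp add: power_mult_distrib power_int_add)
    finally show ?thesis .
  qed
  then show "\<exists>C \<rho>. 0 \<le> C \<and> 0 < \<rho> \<and> (\<forall>u r z. 0 < r \<longrightarrow> r \<le> \<rho> \<longrightarrow> norm z \<le> d \<longrightarrow>
           norm (g (y u r z)) \<le> C * r powi (int p + 1))"
    by (rule_tac exI[of _ "L * \<kappa> ^ Suc p"], rule_tac exI[of _ \<rho>2]) (use g(1) \<kappa> \<rho>2 in auto)
  from small_orderE[OF y \<rho>2] obtain C \<rho> where C: "0 \<le> C" "0 < \<rho>" "\<rho> \<le> 1" "\<rho> \<le> \<rho>2"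
    "continuous_on (UNIV \<times> {0<..\<rho>} \<times> cball 0 d) (\<lambda>(u, r, z). y u r z)"
    "\<And>u r z z'. 0 < r \<Longrightarrow> r \<le> \<rho> \<Longrightarrow> norm z \<le> d \<Longrightarrow> norm z' \<le> d \<Longrightarrow>
          norm (y u r z - y u r z') \<le> C * r powi l * norm (z - z')"
    by metis
  have contg: "continuous_on (cball 0 \<rho>1) g"
  proof (rule lipschitz_on_continuous_on[of "L * \<rho>1 ^ p"])
    show "(L * \<rho>1 ^ p)-lipschitz_on (cball 0 \<rho>1) g"
      using g(1,2) g(3)[OF g(2) order_refl] by (auto simp: lipschitz_on_def dist_norm)
  qed
  show "small_order d q (\<lambda>u r z. g (y u r z))"
  proof (rule small_orderI[of "L * \<kappa> ^ Suc p + L * \<kappa> ^ p * C" \<rho>])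
    have "continuous_on (UNIV \<times> {0<..\<rho>} \<times> cball 0 d) (\<lambda>x. g ((\<lambda>(u, r, z). y u r z) x))"
    proof (rule continuous_on_compose2[OF contg C(5)])
      show "(\<lambda>(u, r, z). y u r z) ` (UNIV \<times> {0<..\<rho>} \<times> cball 0 d) \<subseteq> cball 0 \<rho>1"
      proof clarify
        fix u :: 'p and r and z :: 'z assume "r \<in> {0<..\<rho>}" "z \<in> cball 0 d"
        then show "y u r z \<in> cball 0 \<rho>1"
          using yball[of r z u] \<kappa>r[of r] C(4) by (auto intro: order_trans)
      qed
    qed
    then show "continuous_on (UNIV \<times> {0<..\<rho>} \<times> cball 0 d) (\<lambda>(u, r, z). g (y u r z))"
      by (simp add: case_prod_unfold)
    fix u :: 'p and r and z z' :: 'z assume r: "0 < r" "r \<le> \<rho>" and z: "norm z \<le> d"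
    have r': "r \<le> \<rho>2" "r \<le> 1" using r C by auto
    have mono: "r powi m \<le> r powi q" if "q \<le> m" for m using r r' that by (intro power_int_decreasing) auto
    have "norm (g (y u r z)) \<le> L * \<kappa> ^ Suc p * r powi (int p + 1)" by (rule bd[OF r(1) r'(1) z])
    also have "\<dots> \<le> L * \<kappa> ^ Suc p * r powi q" using g(1) \<kappa> mono[OF q(1)] by (intro mult_left_mono) auto
    also have "\<dots> \<le> (L * \<kappa> ^ Suc p + L * \<kappa> ^ p * C) * r powi q"
      using g(1) \<kappa> C(1) r by (intro mult_right_mono) auto
    finally show "norm (g (y u r z)) \<le> (L * \<kappa> ^ Suc p + L * \<kappa> ^ p * C) * r powi q" .
    assume z': "norm z' \<le> d"
    have "norm (g (y u r z) - g (y u r z')) \<le> L * (\<kappa> * r) ^ p * norm (y u r z - y u r z')"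
      using g(3)[OF \<kappa>r[OF r(1) r'(1)] yball[OF r(1) r'(1) z] yball[OF r(1) r'(1) z']] by blast
    also have "\<dots> \<le> L * (\<kappa> * r) ^ p * (C * r powi l * norm (z - z'))"
      using g(1) \<kappa> r C(6)[OF r z z'] by (intro mult_left_mono) auto
    also have "\<dots> = L * \<kappa> ^ p * C * r powi (int p + l) * norm (z - z')"
      using r by (simp add: power_mult_distrib power_int_add)
    also have "\<dots> \<le> L * \<kappa> ^ p * C * r powi q * norm (z - z')"
      using g(1) \<kappa> C(1) mono[OF q(2)] by (intro mult_right_mono mult_left_mono) auto
    also have "\<dots> \<le> (L * \<kappa> ^ Suc p + L * \<kappa> ^ p * C) * r powi q * norm (z - z')"
      using g(1) \<kappa> r by (intro mult_right_mono) auto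
    finally show "norm (g (y u r z) - g (y u r z')) \<le> (L * \<kappa> ^ Suc p + L * \<kappa> ^ p * C) * r powi q * norm (z - z')" .
  qed (use g \<kappa> C in auto)
qed

lemma small_order_bound:
  assumes "small_order d m e" "0 \<le> m"
  obtains C \<rho> where "0 \<le> C" "0 < \<rho>" "\<And>u r z. 0 < r \<Longrightarrow> r \<le> \<rho> \<Longrightarrow> norm z \<le> d \<Longrightarrow> norm (e u r z) \<le> C * r powi m"
  using small_orderE[OF assms(1) zero_less_one] by metis

section \<open>Polynomial Hamiltonians\<close>

lemma polynomial_smooth: "real_polynomial_function p \<Longrightarrow> smooth_on UNIV p"
  by (rule smooth_on_polynomial) auto

lemma polynomial_differentiable:
  fixes p :: "'a::real_normed_vector \<Rightarrow> real"
  assumes "real_polynomial_function p" shows "p differentiable (at y)"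
  using smooth_on_has_derivative[OF polynomial_smooth[OF assms], of y] differentiableI by auto

lemma polynomial_vec_nth: "real_polynomial_function (\<lambda>I :: real ^ 'n. I $ i)"
  by (rule real_polynomial_function.intros(1)) (rule bounded_linear_vec_nth)

lemma polynomial_coords:
  "real_polynomial_function (\<lambda>y :: (real ^ 'n) \<times> (real ^ 'n). fst y $ i)"
  "real_polynomial_function (\<lambda>y :: (real ^ 'n) \<times> (real ^ 'n). snd y $ i)"
  by (intro real_polynomial_function.intros(1) bounded_linear_compose[OF bounded_linear_vec_nth]
        bounded_linear_fst bounded_linear_snd)+

lemma polynomial_actions: "real_polynomial_function (\<lambda>y :: (real ^ 'n) \<times> (real ^ 'n). actions y $ i)"
  unfolding actions_def vec_lambda_beta
  by (intro real_polynomial_function_divide real_polynomial_function.intros(3) real_polynomial_function_power polynomial_coords)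

lemma homogeneous_poly_compose:
  fixes p :: "real ^ 'n \<Rightarrow> real" and f :: "'a::real_normed_vector \<Rightarrow> real ^ 'n"
  assumes "homogeneous_poly j p" and f: "\<And>i. real_polynomial_function (\<lambda>x. f x $ i)"
  shows "real_polynomial_function (\<lambda>x. p (f x))"
proof -
  from assms obtain c where p: "\<And>I. p I = (\<Sum>h | vabs h = j. c h * (\<Prod>i\<in>UNIV. (I $ i) ^ (h $ i)))"
    unfolding homogeneous_poly_def by blast
  show ?thesis
  \<comment> \<open>An infinite index set would make the sum 0, which is a polynomial too; the case
    distinction replaces a proof of finiteness.\<close>
  proof (cases "finite {h :: nat ^ 'n. vabs h = j}")
    case True
    then show ?thesis unfolding p
      by (intro real_polynomial_function_sum real_polynomial_function.intros(4) real_polynomial_function.intros(2)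
            real_polynomial_function_prod real_polynomial_function_power f) auto
  next
    case False
    then show ?thesis unfolding p by (simp add: real_polynomial_function.intros(2))
  qed
qed

lemma homogeneous_poly_polynomial: "homogeneous_poly j p \<Longrightarrow> real_polynomial_function p"
  using homogeneous_poly_compose[of j p "\<lambda>x. x"] polynomial_vec_nth by auto

lemma homogeneous_poly_scale:
  assumes "homogeneous_poly j p" shows "p (s *\<^sub>R I) = s ^ j * p I"
proof -
  from assms obtain c where p: "\<And>I. p I = (\<Sum>h | vabs h = j. c h * (\<Prod>i\<in>UNIV. (I $ i) ^ (h $ i)))"
    unfolding homogeneous_poly_def by blast
  show ?thesis unfolding p sum_distrib_left
  proof (rule sum.cong)
    fix h :: "nat ^ 'a" assume "h \<in> {h. vabs h = j}"
    then have "(\<Prod>i\<in>UNIV. ((s *\<^sub>R I) $ i) ^ (h $ i)) = s ^ j * (\<Prod>i\<in>UNIV. (I $ i) ^ (h $ i))"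
      by (simp add: power_mult_distrib prod.distrib vabs_def flip: power_sum)
    then show "c h * (\<Prod>i\<in>UNIV. ((s *\<^sub>R I) $ i) ^ (h $ i)) = s ^ j * (c h * (\<Prod>i\<in>UNIV. (I $ i) ^ (h $ i)))"
      by simp
  qed simp
qed

lemma homogeneous_derivative_scale:
  assumes p: "homogeneous_poly (Suc j) p" and s: "s > 0"
  shows "frechet_derivative p (at (s *\<^sub>R I)) v = s ^ j * frechet_derivative p (at I) v"
proof -
  have D: "(p has_derivative frechet_derivative p (at x)) (at x)" for x
    using polynomial_differentiable[OF homogeneous_poly_polynomial[OF p]] frechet_derivative_works by blast
  have lin: "linear (frechet_derivative p (at x))" for x using D by (rule has_derivative_linear)
  have "((\<lambda>I. s *\<^sub>R I) has_derivative (\<lambda>v. s *\<^sub>R v)) (at I)" by (intro derivative_intros)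
  from has_derivative_compose[where g = p, OF this D]
  have "((\<lambda>I. s ^ Suc j * p I) has_derivative (\<lambda>v. frechet_derivative p (at (s *\<^sub>R I)) (s *\<^sub>R v))) (at I)"
    by (simp only: homogeneous_poly_scale[OF p])
  moreover have "((\<lambda>I. s ^ Suc j * p I) has_derivative (\<lambda>v. s ^ Suc j * frechet_derivative p (at I) v)) (at I)"
    by (intro has_derivative_mult_right D)
  ultimately have "(\<lambda>v. frechet_derivative p (at (s *\<^sub>R I)) (s *\<^sub>R v)) = (\<lambda>v. s ^ Suc j * frechet_derivative p (at I) v)"
    by (rule has_derivative_unique)
  from fun_cong[OF this, of v] show ?thesis using s by (simp add: linear_scale[OF lin])
qed

lemma homogeneous_euler:
  assumes p: "homogeneous_poly j p"
  shows "frechet_derivative p (at I) I = real j * p I"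
proof -
  have D: "(p has_derivative frechet_derivative p (at x)) (at x)" for x
    using polynomial_differentiable[OF homogeneous_poly_polynomial[OF p]] frechet_derivative_works by blast
  have lin: "linear (frechet_derivative p (at x))" for x using D by (rule has_derivative_linear)
  have "((\<lambda>t. t *\<^sub>R I) has_derivative (\<lambda>h. h *\<^sub>R I)) (at 1)" by (auto intro!: derivative_eq_intros)
  from has_derivative_compose[where g = p, OF this D]
  have "((\<lambda>t. t ^ j * p I) has_derivative (\<lambda>h. frechet_derivative p (at (1 *\<^sub>R I)) (h *\<^sub>R I))) (at 1)"
    by (simp only: homogeneous_poly_scale[OF p])
  moreover have "((\<lambda>t :: real. t ^ j * p I) has_derivative (\<lambda>h. h * (real j * p I))) (at 1)"
    by (auto intro!: derivative_eq_intros)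
  ultimately have "(\<lambda>h. frechet_derivative p (at (1 *\<^sub>R I)) (h *\<^sub>R I)) = (\<lambda>h. h * (real j * p I))"
    by (rule has_derivative_unique)
  from fun_cong[OF this, of 1] show ?thesis by simp
qed

text \<open>Derivatives of a function homogeneous of degree 1 have degree 0, hence are constant
  along rays, and continuity at 0 makes all rays agree. For the linear part of the normal form an
  exact statement is required, because its contribution is multiplied by the large factor
  r^(2-N).\<close>

lemma homogeneous_1_derivative:
  assumes p: "homogeneous_poly 1 p"
  shows "frechet_derivative p (at I) v = frechet_derivative p (at J) v"
proof -
  define D where "D I = frechet_derivative p (at I) v" for I
  have "smooth_on UNIV D"
    unfolding D_def by (intro smooth_on_derivative polynomial_smooth homogeneous_poly_polynomial[OF p])
  then have cont: "continuous_on UNIV D" by (rule smooth_on_continuous)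
  have "D I = D 0" for I
  proof -
    have "continuous_on UNIV (\<lambda>t. D (t *\<^sub>R I))"
      by (rule continuous_on_compose2[OF cont]) (auto intro!: continuous_intros)
    then have "((\<lambda>t. D (t *\<^sub>R I)) \<longlongrightarrow> D (0 *\<^sub>R I)) (at_right 0)"
      by (metis continuous_on_def UNIV_I tendsto_within_subset subset_UNIV)
    moreover have "\<forall>\<^sub>F t in at_right 0. D (t *\<^sub>R I) = D I"
      unfolding D_def
      using homogeneous_derivative_scale[of 0 p] p by (auto simp: eventually_at_filter intro!: always_eventually)
    then have "((\<lambda>t. D (t *\<^sub>R I)) \<longlongrightarrow> D I) (at_right 0)" by (rule tendsto_eventually)
    ultimately show ?thesis using tendsto_unique[OF trivial_limit_at_right_real] by simp
  qed
  then show ?thesis unfolding D_def by metis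
qed

lemma polynomial_resonant_part:
  fixes k :: "nat ^ 'n"
  shows "real_polynomial_function (\<lambda>y. Re (\<eta> * resonant_monomial k (of_phase y)))"
proof -
  define cp where "cp f \<longleftrightarrow> real_polynomial_function (\<lambda>y. Re (f y)) \<and> real_polynomial_function (\<lambda>y. Im (f y))"
    for f :: "(real ^ 'n) \<times> (real ^ 'n) \<Rightarrow> complex"
  have c: "cp (\<lambda>y. c)" for c by (simp add: cp_def real_polynomial_function.intros(2))
  have m: "cp (\<lambda>y. f y * g y)" if "cp f" "cp g" for f g
    using that by (auto simp: cp_def intro!: real_polynomial_function_diff real_polynomial_function.intros(3) real_polynomial_function.intros(4))
  have pw: "cp (\<lambda>y. f y ^ l)" if "cp f" for f l
    by (induction l) (use c[of 1] m that in auto)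
  have pr: "cp (\<lambda>y. \<Prod>i\<in>I. f i y)" if "finite I" "\<And>i. cp (f i)" for I :: "'n set" and f
    using that by (induction I) (use c[of 1] m in auto)
  have dv: "cp (\<lambda>y. of_phase y $ i / of_real (sqrt 2))" for i
    unfolding cp_def of_phase_def
    by (auto simp: Re_divide_of_real Im_divide_of_real intro!: real_polynomial_function_divide polynomial_coords)
  have "cp (\<lambda>y. resonant_monomial k (of_phase y))"
    unfolding resonant_monomial_def by (rule pr[OF finite]) (rule pw[OF dv])
  from m[OF c[of \<eta>] this] show ?thesis by (simp add: cp_def)
qed

section \<open>Lipschitz bounds and the modes outside the resonance\<close>

lemma smooth_lipschitz:
  fixes g :: "'a::euclidean_space \<Rightarrow> real"
  assumes g: "smooth_on W g" and W: "cball 0 \<rho> \<subseteq> W"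
  shows "\<exists>L\<ge>0. \<forall>x\<in>cball 0 \<rho>. \<forall>y\<in>cball 0 \<rho>. \<bar>g x - g y\<bar> \<le> L * norm (x - y)"
proof -
  have "\<exists>B. \<forall>x\<in>cball 0 \<rho>. \<bar>frechet_derivative g (at x) b\<bar> \<le> B" for b
  proof -
    have "continuous_on (cball 0 \<rho>) (\<lambda>x. frechet_derivative g (at x) b)"
      by (rule continuous_on_subset[OF smooth_on_continuous[OF smooth_on_derivative[OF g]] W])
    then have "bounded ((\<lambda>x. frechet_derivative g (at x) b) ` cball 0 \<rho>)"
      by (intro compact_imp_bounded compact_continuous_image) auto
    then show ?thesis unfolding bounded_iff by force
  qed
  then obtain B where B: "\<And>b x. x \<in> cball 0 \<rho> \<Longrightarrow> \<bar>frechet_derivative g (at x) b\<bar> \<le> B b" by metis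
  have "\<bar>g x - g y\<bar> \<le> (\<Sum>b\<in>Basis. \<bar>B b\<bar>) * norm (x - y)" if "x \<in> cball 0 \<rho>" "y \<in> cball 0 \<rho>" for x y
    by (rule partials_lipschitz[OF convex_cball _ _ that])
       (use W B in \<open>auto intro!: smooth_on_has_derivative[OF g] intro: order_trans[OF _ abs_ge_self]\<close>)
  then show ?thesis by (intro exI[of _ "\<Sum>b\<in>Basis. \<bar>B b\<bar>"]) (auto intro: sum_nonneg)
qed

lemma interval_lipschitz:
  fixes f :: "real \<Rightarrow> real"
  assumes "\<And>x. x \<in> {l..r} \<Longrightarrow> (f has_real_derivative f' x) (at x)" "continuous_on {l..r} f'"
  shows "\<exists>L\<ge>0. \<forall>x\<in>{l..r}. \<forall>y\<in>{l..r}. \<bar>f x - f y\<bar> \<le> L * \<bar>x - y\<bar>"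
proof -
  have "bounded (f' ` {l..r})"
    by (intro compact_imp_bounded compact_continuous_image assms) auto
  then obtain B where B: "\<And>x. x \<in> {l..r} \<Longrightarrow> \<bar>f' x\<bar> \<le> B" unfolding bounded_iff by force
  have "norm (f x - f y) \<le> \<bar>B\<bar> * norm (x - y)" if "x \<in> {l..r}" "y \<in> {l..r}" for x y
    by (rule field_differentiable_bound[where S = "{l..r}"])
       (use assms(1) B that in \<open>auto intro: has_field_derivative_at_within order_trans[OF _ abs_ge_self]\<close>)
  then show ?thesis by (intro exI[of _ "\<bar>B\<bar>"]) auto
qed

text \<open>For k_i = 0 the function is invariant under rotations of z_i alone, so its i-th gradient
  component is radial and vanishes with z_i. The fundamental theorem of calculus writes it as |z_i|
  times the integral of a second derivative. That integral is the quotient by z_i, and it stays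
  Lipschitz across z_i = 0, where a division would fail.\<close>

lemma cgrad_free_mode:
  fixes g :: "(real ^ 'n) \<times> (real ^ 'n) \<Rightarrow> real"
  assumes g: "smooth_on UNIV g" and inv: "torus_invariant k g" and i: "k $ i = 0" and a: "k $ a > 0"
  shows "\<exists>\<Theta> L. 0 \<le> L \<and> (\<forall>A. cgrad g (to_phase A) $ i = of_real (\<Theta> A) * A $ i) \<and>
     (\<forall>A\<in>cball 0 1. \<forall>A'\<in>cball 0 1. \<bar>\<Theta> A - \<Theta> A'\<bar> \<le> L * norm (A - A'))"
proof -
  define D1 where "D1 y = frechet_derivative g (at y) (axis i 1, 0)" for y
  define D2 where "D2 y = frechet_derivative D1 (at y) (axis i 1, 0)" for y
  have s1: "smooth_on UNIV D1" unfolding D1_def by (rule smooth_on_derivative[OF g])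
  have s2: "smooth_on UNIV D2" unfolding D2_def by (rule smooth_on_derivative[OF s1])
  have diff: "g differentiable (at y)" for y
    using smooth_on_has_derivative[OF g, of y] differentiableI by auto
  \<comment> \<open>For s from 0 to 1 this runs along the ray of the i-th coordinate, turned to the
    real axis so that one real direction of differentiation suffices.\<close>
  define b where "b A s = (\<chi> j. if j = i then of_real (s * cmod (A $ i)) else A $ j)" for A :: "complex ^ 'n" and s
  define \<Theta> where "\<Theta> A = integral {0..1} (\<lambda>s. D2 (to_phase (b A s)))" for A
  have contb: "continuous_on S (\<lambda>s. to_phase (b A s))" for A S
  proof (rule bounded_linear.continuous_on[OF bounded_linear_to_phase])
    show "continuous_on S (b A)" unfolding b_def
    proof (rule continuous_on_vec_lambda)
      show "continuous_on S (\<lambda>s. if j = i then complex_of_real (s * cmod (A $ i)) else A $ j)" for j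
        by (cases "j = i") (auto intro!: continuous_intros)
    qed
  qed
  have contD2: "continuous_on S (\<lambda>s. D2 (to_phase (b A s)))" for A S
    by (rule continuous_on_compose2[OF smooth_on_continuous[OF s2] contb]) simp
  have rot: "(t *\<^sub>R axis i 1) \<bullet> rvec k = 0" for t :: real using i by (simp add: inner_axis' rvec_def)
  have rota: "(t *\<^sub>R axis i 1 :: real ^ 'n) $ j = (if j = i then t else 0)" for t j by (simp add: axis_def)
  have "cgrad g (to_phase A) $ i = of_real (\<Theta> A) * A $ i" for A
  proof -
    let ?\<rho> = "cmod (A $ i)"
    \<comment> \<open>Rotation of mode i by pi fixes a point with z_i = 0 and reverses the i-th
      gradient component there.\<close>
    have zero: "cgrad g (to_phase (b A 0)) $ i = 0"
    proof -
      have "torus_rotate (pi *\<^sub>R axis i 1) (to_phase (b A 0)) = to_phase (b A 0)"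
      proof -
        have "of_phase (torus_rotate (pi *\<^sub>R axis i 1) (to_phase (b A 0))) = b A 0"
          by (auto simp: vec_eq_iff axis_def b_def)
        then show ?thesis by (metis to_of_phase(1))
      qed
      then show ?thesis
        using cgrad_torus_rotate[OF inv diff rot, of pi "to_phase (b A 0)" i] by (simp add: axis_def)
    qed
    have "((\<lambda>s. ?\<rho> * D2 (to_phase (b A s))) has_integral (D1 (to_phase (b A 1)) - D1 (to_phase (b A 0)))) {0..1}"
    proof (rule fundamental_theorem_of_calculus)
      fix s :: real assume "s \<in> {0..1}"
      have lin: "linear (frechet_derivative D1 (at (to_phase (b A s))))"
        by (rule has_derivative_linear[OF smooth_on_has_derivative[OF s1 UNIV_I]])
      have "(b A has_derivative (\<lambda>h. \<chi> j. if j = i then of_real (h * ?\<rho>) else 0)) (at s)"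
        unfolding b_def[abs_def]
      proof (rule has_derivative_vec_lambda)
        show "((\<lambda>s. if j = i then of_real (s * cmod (A $ i)) else A $ j) has_derivative
          (\<lambda>h. if j = i then of_real (h * ?\<rho>) else 0)) (at s)" for j
          by (cases "j = i") (auto intro!: derivative_eq_intros)
      qed
      from bounded_linear.has_derivative[OF bounded_linear_to_phase this]
      have "((\<lambda>s. D1 (to_phase (b A s))) has_derivative (\<lambda>h. frechet_derivative D1 (at (to_phase (b A s)))
           (to_phase (\<chi> j. if j = i then of_real (h * ?\<rho>) else 0)))) (at s)"
        by (rule has_derivative_compose[where g = D1]) (rule smooth_on_has_derivative[OF s1 UNIV_I])
      moreover have "to_phase (\<chi> j. if j = i then of_real (h * ?\<rho>) else 0) = (h * ?\<rho>) *\<^sub>R (axis i 1, 0)" for h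
        by (simp add: to_phase_def prod_eq_iff vec_eq_iff axis_def)
      ultimately have "((\<lambda>s. D1 (to_phase (b A s))) has_derivative (\<lambda>h. h *\<^sub>R (?\<rho> * D2 (to_phase (b A s))))) (at s)"
        by (simp only: linear_scale[OF lin] D2_def) (simp add: mult.assoc)
      then show "((\<lambda>s. D1 (to_phase (b A s))) has_vector_derivative ?\<rho> * D2 (to_phase (b A s))) (at s within {0..1})"
        unfolding has_vector_derivative_def by (rule has_derivative_at_withinI)
    qed simp
    moreover have "D1 (to_phase (b A 0)) = 0" using zero by (simp add: cgrad_def D1_def complex_eq_iff)
    ultimately have "((\<lambda>s. ?\<rho> * D2 (to_phase (b A s))) has_integral D1 (to_phase (b A 1))) {0..1}" by simp
    moreover have "((\<lambda>s. ?\<rho> * D2 (to_phase (b A s))) has_integral ?\<rho> * \<Theta> A) {0..1}"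
      unfolding \<Theta>_def by (intro has_integral_mult_right integrable_integral integrable_continuous_real contD2)
    ultimately have re: "Re (cgrad g (to_phase (b A 1)) $ i) = ?\<rho> * \<Theta> A"
      by (simp add: has_integral_unique cgrad_def D1_def)
    \<comment> \<open>The tangential part vanishes by the conservation law with k_i = 0; at z_i = 0
      the whole component does.\<close>
    have im: "Im (cgrad g (to_phase (b A 1)) $ i) = 0"
    proof (cases "?\<rho> = 0")
      case True
      then have "b A 1 = b A 0" by (simp add: b_def vec_eq_iff)
      then show ?thesis using zero by simp
    next
      case False
      have "real (k $ a) * Im (cnj (b A 1 $ i) * cgrad g (to_phase (b A 1)) $ i) = 0"
        using cgrad_tangential[OF inv diff, of a "to_phase (b A 1)" i] i by simp
      then show ?thesis using a False by (simp add: b_def)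
    qed
    have B: "cgrad g (to_phase (b A 1)) $ i = of_real (?\<rho> * \<Theta> A)" using re im by (simp add: complex_eq_iff)
    have "torus_rotate (Arg (A $ i) *\<^sub>R axis i 1) (to_phase (b A 1)) = to_phase A"
    proof -
      have "of_phase (torus_rotate (Arg (A $ i) *\<^sub>R axis i 1) (to_phase (b A 1))) $ j = A $ j" for j
        using rcis_cmod_Arg[of "A $ i"] by (auto simp: axis_def b_def rcis_def mult.commute)
      then have "of_phase (torus_rotate (Arg (A $ i) *\<^sub>R axis i 1) (to_phase (b A 1))) = A"
        unfolding vec_eq_iff by blast
      then show ?thesis by (metis to_of_phase(1))
    qed
    then have "cgrad g (to_phase A) $ i = cis (Arg (A $ i)) * of_real (?\<rho> * \<Theta> A)"
      using cgrad_torus_rotate[OF inv diff rot, of "Arg (A $ i)" "to_phase (b A 1)" i] B by (simp add: axis_def)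
    also have "\<dots> = of_real (\<Theta> A) * rcis ?\<rho> (Arg (A $ i))" by (simp add: rcis_def)
    finally show ?thesis by (simp add: rcis_cmod_Arg)
  qed
  moreover obtain L where L: "0 \<le> L" "\<And>x y. x \<in> cball 0 1 \<Longrightarrow> y \<in> cball 0 1 \<Longrightarrow> \<bar>D2 x - D2 y\<bar> \<le> L * norm (x - y)"
    using smooth_lipschitz[OF s2 subset_UNIV, of 1] by blast
  have "\<bar>\<Theta> A - \<Theta> A'\<bar> \<le> L * norm (A - A')" if A: "A \<in> cball 0 1" "A' \<in> cball 0 1" for A A'
  proof -
    have nb: "norm (b A s) \<le> norm A" if "s \<in> {0..1}" for A s
      unfolding norm_vec_def by (rule L2_set_mono) (use that in \<open>auto simp: b_def norm_mult mult_left_le_one_le\<close>)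
    have nd: "norm (b A s - b A' s) \<le> norm (A - A')" if "s \<in> {0..1}" for s
      unfolding norm_vec_def
    proof (rule L2_set_mono)
      fix j
      have "cmod (of_real (s * cmod (A $ i)) - of_real (s * cmod (A' $ i))) = s * \<bar>cmod (A $ i) - cmod (A' $ i)\<bar>"
        using that unfolding of_real_diff[symmetric] norm_of_real right_diff_distrib[symmetric] abs_mult by simp
      also have "\<dots> \<le> 1 * cmod (A $ i - A' $ i)"
        using that norm_triangle_ineq3[of "A $ i" "A' $ i"] by (intro mult_mono) auto
      finally show "norm ((b A s - b A' s) $ j) \<le> norm ((A - A') $ j)" by (auto simp: b_def)
    qed simp
    have "\<Theta> A - \<Theta> A' = integral {0..1} (\<lambda>s. D2 (to_phase (b A s)) - D2 (to_phase (b A' s)))"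
      unfolding \<Theta>_def by (intro Henstock_Kurzweil_Integration.integral_diff[symmetric] integrable_continuous_real contD2)
    also have "norm \<dots> \<le> integral {0..1} (\<lambda>s :: real. L * norm (A - A'))"
    proof (rule integral_norm_bound_integral)
      show "norm (D2 (to_phase (b A s)) - D2 (to_phase (b A' s))) \<le> L * norm (A - A')" if s: "s \<in> {0..1}" for s
      proof -
        have "\<bar>D2 (to_phase (b A s)) - D2 (to_phase (b A' s))\<bar> \<le> L * norm (to_phase (b A s) - to_phase (b A' s))"
          using L(2)[of "to_phase (b A s)" "to_phase (b A' s)"] nb[OF s, of A] nb[OF s, of A'] A by simp
        also have "norm (to_phase (b A s) - to_phase (b A' s)) = norm (b A s - b A' s)"
          by (metis norm_to_phase linear_diff bounded_linear.linear bounded_linear_to_phase)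
        also have "L * \<dots> \<le> L * norm (A - A')" using nd[OF s] L(1) by (rule mult_left_mono)
        finally show ?thesis by simp
      qed
    next
      show "(\<lambda>s. D2 (to_phase (b A s)) - D2 (to_phase (b A' s))) integrable_on {0..1}"
        by (intro integrable_continuous_real continuous_on_diff contD2)
    qed auto
    finally show ?thesis by simp
  qed
  ultimately show ?thesis using L(1) by (intro exI[of _ \<Theta>] exI[of _ L]) auto
qed

section \<open>The resonant channel\<close>

definition amplitude :: "nat ^ 'n \<Rightarrow> real" where
  "amplitude k = (\<Prod>i\<in>UNIV. sqrt (real (k $ i)) ^ (k $ i))"

definition level :: "nat \<Rightarrow> nat ^ 'n \<Rightarrow> (nat \<Rightarrow> real ^ 'n \<Rightarrow> real) \<Rightarrow> real" where
  "level N k HB = (if even N then HB (N div 2) (rvec k) else 0)"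

type_synonym 'm unknown = "(real \<times> (complex ^ 'm)) \<times> (real ^ 'm)"

text \<open>The unknowns are ((delta, w), q): delta is the deviation of the resonant angle from its
  limit, Re w$i (for k$i > 0) and w$i (for k$i = 0) are the rescaled deviations from the channel,
  and q is the rescaled deviation of the phases from the parameter u.  The radius r is the square root of I$a / k$a.\<close>
locale resonant_channel =
  fixes k :: "nat ^ 'n" and N :: nat and a :: 'n and HB :: "nat \<Rightarrow> real ^ 'n \<Rightarrow> real" and h1 h2 :: real
    and F R :: "(real ^ 'n) \<times> (real ^ 'n) \<Rightarrow> real" and W :: "((real ^ 'n) \<times> (real ^ 'n)) set"
    and \<phi>0 d smin :: real
  assumes N3: "3 \<le> N" and kN: "vabs k = N" and ka: "0 < k $ a"
    and HBh: "\<And>j. 1 \<le> j \<Longrightarrow> j \<le> N div 2 \<Longrightarrow> homogeneous_poly j (HB j)"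
    and HB0: "\<And>j. 1 \<le> j \<Longrightarrow> 2 * j < N \<Longrightarrow> HB j (rvec k) = 0"
    and Fp: "real_polynomial_function F" and Fi: "torus_invariant k F" and Fv: "vanishes (Suc N) F"
    and W: "open W" "0 \<in> W" and Rs: "smooth_on W R" and Rv: "vanishes (3 * N + 1) R"
    and zero: "level N k HB + amplitude k * (h1 * cos \<phi>0 + h2 * sin \<phi>0) = 0"
    and d: "0 < d" "d \<le> 1 / 2" and smin: "0 < smin"
      "\<And>\<delta>. \<bar>\<delta>\<bar> \<le> d \<Longrightarrow> smin \<le> amplitude k * (h2 * cos (\<phi>0 + \<delta>) - h1 * sin (\<phi>0 + \<delta>)) / 2"
begin

section \<open>Coordinates along the channel and their orders\<close>

definition "\<eta> = Complex h1 (- h2)"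

text \<open>The normal form without its remainder, as a function on phase space. With this
  \<open>\<eta>\<close> the real part is h1 cos + h2 sin of the resonant angle, times its
  amplitude.\<close>

definition P :: "(real ^ 'n) \<times> (real ^ 'n) \<Rightarrow> real" where
  "P y = (\<Sum>j = 1..N div 2. HB j (actions y)) + Re (\<eta> * resonant_monomial k (of_phase y)) + F y"

text \<open>After division by r^(N-2), the limit of the rate at which log r decreases;
  \<open>p0\<close> is the corresponding limit of the velocity of the resonant angle. The derivative
  of \<open>p0\<close> is N times \<open>s0\<close>, which is the source of the expansion rate
  N.\<close>

definition s0 :: "real \<Rightarrow> real" where
  "s0 \<delta> = amplitude k * (h2 * cos (\<phi>0 + \<delta>) - h1 * sin (\<phi>0 + \<delta>)) / 2"

definition p0 :: "real \<Rightarrow> real" where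
  "p0 \<delta> = real N / 2 * (level N k HB + amplitude k * (h1 * cos (\<phi>0 + \<delta>) + h2 * sin (\<phi>0 + \<delta>)))"

text \<open>The ratio of the action I_i to its value k_i r^2 on the channel, for the modes with k_i
  > 0. The exponent N - 2 makes the action deviation k_i r^N times the unknown; mode
  \<open>a\<close> has ratio 1 because it defines r.\<close>

definition mu :: "real \<Rightarrow> 'n unknown \<Rightarrow> 'n \<Rightarrow> real" where
  "mu r z i = (if i = a then 1 else 1 + r ^ (N - 2) * Re (snd (fst z) $ i))"

text \<open>The point before the rotation by the transversal phases. That rotation is orthogonal to
  k, so the resonant angle has to be placed here: mode \<open>a\<close> carries all of it, and
  dividing by k_a makes <theta,k> equal to \<open>\<phi>0\<close> plus its deviation.\<close>

definition A :: "real \<Rightarrow> 'n unknown \<Rightarrow> complex ^ 'n" where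
  "A r z = (\<chi> i. if i = a then of_real (sqrt (2 * real (k $ a)) * r) * cis ((\<phi>0 + fst (fst z)) / real (k $ a))
       else if 0 < k $ i then of_real (sqrt (2 * real (k $ i)) * r * sqrt (mu r z i))
       else of_real (r ^ N) * snd (fst z) $ i)"

text \<open>Orthogonality to k leaves the phases of all modes but one free; the phase of mode
  \<open>a\<close> gives way.\<close>

definition channel_tangent :: "real ^ 'n \<Rightarrow> real ^ 'n" where
  "channel_tangent v = (\<chi> i. if i = a then - (\<Sum>j\<in>UNIV - {a}. real (k $ j) * v $ j) / real (k $ a) else v $ i)"

text \<open>The first term is the phase prescribed at the initial radius. The phases may diverge as
  r tends to 0 while the unknown q remains bounded, hence the negative power.\<close>

definition alpha :: "real ^ 'n \<Rightarrow> real \<Rightarrow> 'n unknown \<Rightarrow> real ^ 'n" where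
  "alpha u r z = channel_tangent u + (r powi (1 - int N)) *\<^sub>R channel_tangent (snd z)"

definition Y :: "real ^ 'n \<Rightarrow> real \<Rightarrow> 'n unknown \<Rightarrow> (real ^ 'n) \<times> (real ^ 'n)" where
  "Y u r z = torus_rotate (alpha u r z) (to_phase (A r z))"

definition remainder_grad :: "real ^ 'n \<Rightarrow> real \<Rightarrow> 'n unknown \<Rightarrow> complex ^ 'n" where
  "remainder_grad u r z = (\<chi> i. cis (- alpha u r z $ i) * cgrad R (Y u r z) $ i)"

text \<open>The gradient of the full Hamiltonian at \<open>Y\<close>, rotated back. By equivariance
  the truncated part is evaluated at \<open>A\<close> and does not see the phases; the remainder
  does.\<close>

definition rotated_grad :: "real ^ 'n \<Rightarrow> real \<Rightarrow> 'n unknown \<Rightarrow> complex ^ 'n" where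
  "rotated_grad u r z = cgrad P (to_phase (A r z)) + remainder_grad u r z"

abbreviation small :: "int \<Rightarrow> (real ^ 'n \<Rightarrow> real \<Rightarrow> 'n unknown \<Rightarrow> 'c::real_normed_vector) \<Rightarrow> bool" where
  "small \<equiv> small_order d"

lemma z_bounds:
  assumes "norm z \<le> d"
  shows "\<bar>fst (fst z)\<bar> \<le> d" "cmod (snd (fst z) $ i) \<le> d" "\<bar>Re (snd (fst z) $ i)\<bar> \<le> 1 / 2"
proof -
  have "norm (fst z) \<le> d" using norm_fst_snd_le(1)[of z] assms by linarith
  then have 1: "norm (fst (fst z)) \<le> d" "norm (snd (fst z)) \<le> d"
    using norm_fst_snd_le[of "fst z"] by linarith+
  then show "\<bar>fst (fst z)\<bar> \<le> d" "cmod (snd (fst z) $ i) \<le> d"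
    using Finite_Cartesian_Product.norm_nth_le[of "snd (fst z)" i] by simp_all
  then show "\<bar>Re (snd (fst z) $ i)\<bar> \<le> 1 / 2" using abs_Re_le_cmod[of "snd (fst z) $ i"] d by linarith
qed

lemma small_coords:
  "small 0 (\<lambda>u r z. fst (fst z))" "small 0 (\<lambda>u r z. snd (fst z) $ i)" "small 0 (\<lambda>u r z. Re (snd (fst z) $ i))"
proof -
  have b: "bounded_linear (\<lambda>z :: 'n unknown. snd (fst z) $ i)"
    by (intro bounded_linear_compose[OF bounded_linear_vec_nth] bounded_linear_compose[OF bounded_linear_snd] bounded_linear_fst)
  then show "small 0 (\<lambda>u r z. snd (fst z) $ i)" by (rule small_order_linear)
  show "small 0 (\<lambda>u r z. Re (snd (fst z) $ i))"
    by (intro small_order_linear bounded_linear_compose[OF bounded_linear_Re b])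
  show "small 0 (\<lambda>u r z. fst (fst z))"
    by (intro small_order_linear bounded_linear_compose[OF bounded_linear_fst] bounded_linear_fst)
qed

lemma small_const_mult:
  fixes c :: real and e :: "real ^ 'n \<Rightarrow> real \<Rightarrow> 'n unknown \<Rightarrow> real"
  shows "small m e \<Longrightarrow> small m (\<lambda>u r z. c * e u r z)"
  by (rule small_order_linear_compose[OF bounded_linear_mult_right])

lemma small_of_real:
  "small m e \<Longrightarrow> small m (\<lambda>u r z. complex_of_real (e u r z))"
  by (rule small_order_linear_compose[OF bounded_linear_of_real])

lemma small_cnj: "small m e \<Longrightarrow> small m (\<lambda>u r z. cnj (e u r z))"
  by (rule small_order_linear_compose[OF bounded_linear_cnj])

lemma small_Re: "small m e \<Longrightarrow> small m (\<lambda>u r z. Re (e u r z))"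
  by (rule small_order_linear_compose[OF bounded_linear_Re])

lemma small_Im: "small m e \<Longrightarrow> small m (\<lambda>u r z. Im (e u r z))"
  by (rule small_order_linear_compose[OF bounded_linear_Im])

lemma small_nth: "small m e \<Longrightarrow> small m (\<lambda>u r z. e u r z $ i)"
  by (rule small_order_linear_compose[OF bounded_linear_vec_nth])

lemma mu_bounds:
  assumes "0 < r" "r \<le> 1" "norm z \<le> d" shows "mu r z i \<in> {1 / 2..3 / 2}"
proof -
  have "\<bar>r ^ (N - 2) * Re (snd (fst z) $ i)\<bar> \<le> 1 * (1 / 2)"
    unfolding abs_mult using assms z_bounds(3)[OF assms(3)] by (intro mult_mono) (auto simp: power_le_one)
  then show ?thesis unfolding mu_def by (auto simp: abs_le_iff)
qed

lemma small_mu: "small (int N - 2) (\<lambda>u r z. mu r z i - 1)"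
proof (cases "i = a")
  case True
  then show ?thesis by (simp add: mu_def small_order_zero)
next
  case False
  have "small (int (N - 2) + 0) (\<lambda>u r z. r ^ (N - 2) * Re (snd (fst z) $ i))"
    by (intro small_order_mult small_order_power small_coords)
  then show ?thesis using False N3 by (simp add: mu_def of_nat_diff)
qed

lemma small_of_mu:
  assumes "\<And>x. x \<in> {1 / 2..3 / 2} \<Longrightarrow> (f has_real_derivative f' x) (at x)" "continuous_on {1 / 2..3 / 2} f'" "f 1 = 1"
  shows "small (int N - 2) (\<lambda>u r z. f (mu r z i) - 1)"
proof -
  obtain L where "\<And>x y. x \<in> {1 / 2..3 / 2} \<Longrightarrow> y \<in> {1 / 2..3 / 2} \<Longrightarrow> norm (f x - f y) \<le> L * norm (x - y)"
    using interval_lipschitz[OF assms(1,2)] unfolding real_norm_def by meson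
  from small_order_lipschitz[where e = "\<lambda>u r z. mu r z i" and S = "{1 / 2..3 / 2}", OF small_mu this _ zero_less_one]
  show ?thesis using mu_bounds assms(3) by simp
qed

lemma small_sqrt_mu: "small (int N - 2) (\<lambda>u r z. sqrt (mu r z i) - 1)"
  by (rule small_of_mu[where f' = "\<lambda>x. inverse (sqrt x) / 2"])
     (auto intro!: DERIV_real_sqrt continuous_intros)

lemma small_inverse_mu: "small (int N - 2) (\<lambda>u r z. inverse (mu r z i) - 1)"
  by (rule small_of_mu[where f' = "\<lambda>x. - (inverse x ^ 2)"])
     (auto intro!: derivative_eq_intros continuous_intros simp: power2_eq_square)

lemma small_plus_one: "0 \<le> m \<Longrightarrow> small m (\<lambda>u r z. e u r z - 1) \<Longrightarrow> small 0 e" for e :: "_ \<Rightarrow> _ \<Rightarrow> _ \<Rightarrow> real"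
  using small_order_add[OF small_order_weaken[of d m "\<lambda>u r z. e u r z - 1" 0] small_order_const[of d "1 :: real"]] by simp

lemma small_delta:
  assumes "\<And>x. x \<in> {-d..d} \<Longrightarrow> (f has_real_derivative f' x) (at x)" "continuous_on {-d..d} f'"
  shows "small 0 (\<lambda>u r z. f (fst (fst z)))"
proof -
  obtain L where L: "\<And>x y. x \<in> {-d..d} \<Longrightarrow> y \<in> {-d..d} \<Longrightarrow> norm (f x - f y) \<le> L * norm (x - y)"
    using interval_lipschitz[OF assms(1,2)] unfolding real_norm_def by meson
  have 0: "small 0 (\<lambda>u r z. fst (fst z) - 0)" using small_coords by simp
  have "small 0 (\<lambda>u r z. f (fst (fst z)) - f 0)"
  proof (rule small_order_lipschitz[where S = "{-d..d}", OF 0 L _ zero_less_one])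
    show "fst (fst z) \<in> {-d..d}" if "norm z \<le> d" for z :: "'n unknown"
      using z_bounds(1)[OF that] by (simp add: abs_le_iff)
  qed (use d in auto)
  from small_order_add[OF this small_order_const[of d "f 0"]] show ?thesis by simp
qed

lemma A_a: "A r z $ a = of_real (sqrt (2 * real (k $ a)) * r) * cis ((\<phi>0 + fst (fst z)) / real (k $ a))"
  by (simp add: A_def)

lemma cmod_A:
  assumes "0 < k $ i" "0 < r" "r \<le> 1" "norm z \<le> d"
  shows "(cmod (A r z $ i))\<^sup>2 = 2 * real (k $ i) * r\<^sup>2 * mu r z i"
  using assms mu_bounds[OF assms(2-4), of i]
  by (auto simp: A_def norm_mult power_mult_distrib mu_def[of _ _ a])

lemma small_A: "small 1 (\<lambda>u. A)"
proof -
  have "small 1 (\<lambda>u r z. A r z $ i)" for i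
  proof -
    consider "i = a" | "i \<noteq> a" "0 < k $ i" | "i \<noteq> a" "k $ i = 0" by auto
    then show ?thesis
    proof cases
      case 1
      have b: "bounded_linear (\<lambda>z :: 'n unknown. fst (fst z) / real (k $ a))"
        by (intro bounded_linear_compose[OF bounded_linear_divide] bounded_linear_compose[OF bounded_linear_fst] bounded_linear_fst)
      have "small 0 (\<lambda>u r z. cis (\<phi>0 / real (k $ a) + fst (fst z) / real (k $ a)))"
        by (rule small_order_cis[OF small_order_linear[OF b]]) auto
      then have "small (int 1 + 0) (\<lambda>u r z. of_real (sqrt (2 * real (k $ a)) * r ^ 1) * cis (\<phi>0 / real (k $ a) + fst (fst z) / real (k $ a)))"
        by (intro small_order_mult small_of_real small_const_mult small_order_power)
      then show ?thesis using 1 by (simp add: A_def add_divide_distrib)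
    next
      case 2
      have "small (int 1 + 0) (\<lambda>u r z. complex_of_real (sqrt (2 * real (k $ i)) * r ^ 1) * complex_of_real (sqrt (mu r z i)))"
        by (intro small_order_mult small_of_real small_const_mult small_order_power small_plus_one[OF _ small_sqrt_mu])
           (use N3 in auto)
      then show ?thesis using 2 by (simp add: A_def)
    next
      case 3
      have "small (int N + 0) (\<lambda>u r z. of_real (r ^ N) * snd (fst z) $ i)"
        by (intro small_order_mult small_of_real small_order_power small_coords)
      then have "small (int N) (\<lambda>u r z. A r z $ i)" using 3 by (simp add: A_def)
      then show ?thesis by (rule small_order_weaken) (use N3 in auto)
    qed
  qed
  then show ?thesis by (rule small_order_vec)
qed

lemma A_bound:
  obtains K \<rho> where "0 \<le> K" "0 < \<rho>" "\<And>r z. 0 < r \<Longrightarrow> r \<le> \<rho> \<Longrightarrow> norm z \<le> d \<Longrightarrow> norm (A r z) \<le> K * r"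
  by (rule small_order_bound[OF small_A]) (auto intro: that)

lemma channel_tangent_orthogonal: "channel_tangent v \<bullet> rvec k = 0"
proof -
  have "channel_tangent v \<bullet> rvec k = channel_tangent v $ a * real (k $ a) + (\<Sum>j\<in>UNIV - {a}. channel_tangent v $ j * real (k $ j))"
    unfolding inner_vec_def rvec_def by (subst sum.remove[of _ a]) auto
  also have "(\<Sum>j\<in>UNIV - {a}. channel_tangent v $ j * real (k $ j)) = (\<Sum>j\<in>UNIV - {a}. real (k $ j) * v $ j)"
    by (rule sum.cong) (auto simp: channel_tangent_def)
  finally show ?thesis using ka by (simp add: channel_tangent_def)
qed

lemma alpha_orthogonal: "alpha u r z \<bullet> rvec k = 0"
  by (simp add: alpha_def inner_add_left channel_tangent_orthogonal)

lemma bounded_linear_channel_tangent: "bounded_linear channel_tangent"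
  unfolding linear_conv_bounded_linear[symmetric]
  by (rule linearI) (auto simp: channel_tangent_def vec_eq_iff sum.distrib sum_distrib_left algebra_simps add_divide_distrib diff_divide_distrib)

lemma small_cis_alpha: "small (1 - int N) (\<lambda>u r z. cis (alpha u r z $ i))" "small (1 - int N) (\<lambda>u r z. cis (- alpha u r z $ i))"
proof -
  have b: "bounded_linear (\<lambda>z :: 'n unknown. channel_tangent (snd z) $ i)"
    by (intro bounded_linear_compose[OF bounded_linear_vec_nth] bounded_linear_compose[OF bounded_linear_channel_tangent] bounded_linear_snd)
  have e: "small (1 - int N + 0) (\<lambda>u r z. (r powi (1 - int N)) * channel_tangent (snd z) $ i)"
    by (intro small_order_mult small_order_powi small_order_linear[OF b])
  have c: "continuous_on UNIV (\<lambda>u. channel_tangent u $ i)"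
    by (intro bounded_linear.continuous_on[OF bounded_linear_compose[OF bounded_linear_vec_nth bounded_linear_channel_tangent]] continuous_intros)
  show "small (1 - int N) (\<lambda>u r z. cis (alpha u r z $ i))"
    using small_order_cis[OF e c] N3 by (simp add: alpha_def)
  have "small (1 - int N) (\<lambda>u r z. cis (- channel_tangent u $ i + - ((r powi (1 - int N)) * channel_tangent (snd z) $ i)))"
    using small_order_cis[OF small_order_uminus[OF e] continuous_on_minus[OF c]] N3 by simp
  then show "small (1 - int N) (\<lambda>u r z. cis (- alpha u r z $ i))" by (simp add: alpha_def)
qed

text \<open>This order is dictated by the Lipschitz constant, r times r^(1-N). The size is of order
  r, which \<open>norm_Y\<close> and \<open>A_bound\<close> provide separately.\<close>

lemma small_Y: "small (2 - int N) Y"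
proof -
  have "small (1 - int N + 1) (\<lambda>u r z. cis (alpha u r z $ i) * A r z $ i)" for i
    by (intro small_order_mult small_cis_alpha small_nth small_A)
  then have "small (2 - int N) (\<lambda>u r z. \<chi> i. cis (alpha u r z $ i) * A r z $ i)"
    by (intro small_order_vec) simp
  from small_order_linear_compose[OF bounded_linear_to_phase this]
  show ?thesis unfolding Y_def[abs_def] torus_rotate_def by simp
qed

lemma norm_Y [simp]: "norm (Y u r z) = norm (A r z)"
  by (simp add: Y_def)

text \<open>Here the order 3N + 1 is spent. The gradient of \<open>R\<close> has size r^(3N) and
  Lipschitz constant r^(3N-1); composing with \<open>Y\<close> (Lipschitz order 2 - N) leaves 2N +
  1, and the rotation factor (Lipschitz order 1 - N), meeting the size 3N, leaves 2N + 1
  again.\<close>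

lemma small_remainder_grad: "small (2 * int N + 1) remainder_grad"
proof -
  have "vanishes (Suc (Suc (3 * N - 1))) R" using Rv N3 by simp
  from cgrad_estimates[OF W Rs this]
  obtain L \<rho>1 where L: "0 \<le> L" "0 < \<rho>1" "\<And>r y y'. 0 < r \<Longrightarrow> r \<le> \<rho>1 \<Longrightarrow> y \<in> cball 0 r \<Longrightarrow> y' \<in> cball 0 r \<Longrightarrow>
      norm (cgrad R y) \<le> L * r ^ Suc (3 * N - 1) \<and> norm (cgrad R y - cgrad R y') \<le> L * r ^ (3 * N - 1) * norm (y - y')"
    by metis
  obtain K \<rho>0 where K: "0 \<le> K" "0 < \<rho>0" "\<And>r z. 0 < r \<Longrightarrow> r \<le> \<rho>0 \<Longrightarrow> norm z \<le> d \<Longrightarrow> norm (A r z) \<le> K * r"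
    by (rule A_bound) blast
  have Kb: "norm (Y u r z) \<le> K * r" if "0 < r" "r \<le> \<rho>0" "norm z \<le> d" for u r z using K(3)[OF that] by simp
  have "small (2 * int N + 1) (\<lambda>u r z. cgrad R (Y u r z))"
    by (rule small_order_ball_compose(1)[OF small_Y K(1,2) Kb L]) (use N3 in \<open>auto simp: of_nat_diff\<close>)
  then have c: "small (2 * int N + 1) (\<lambda>u r z. cgrad R (Y u r z) $ i)" for i by (rule small_nth)
  obtain C \<rho> where C: "0 \<le> C" "0 < \<rho>" "\<And>u r z. 0 < r \<Longrightarrow> r \<le> \<rho> \<Longrightarrow> norm z \<le> d \<Longrightarrow>
      norm (cgrad R (Y u r z)) \<le> C * r powi (int (3 * N - 1) + 1)"
    using small_order_ball_compose(2)[OF small_Y K(1,2) Kb L, of "2 * int N + 1"] N3 by (auto simp: of_nat_diff)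
  have C': "norm (cgrad R (Y u r z) $ i) \<le> C * r powi (int (3 * N - 1) + 1)"
    if "0 < r" "r \<le> \<rho>" "norm z \<le> d" for u r z i
    using order_trans[OF Finite_Cartesian_Product.norm_nth_le C(3)[OF that]] .
  have "small (2 * int N + 1) (\<lambda>u r z. remainder_grad u r z $ i)" for i
    unfolding remainder_grad_def vec_lambda_beta
    by (rule small_order_mult_bounded[OF small_cis_alpha(2) _ c C(1,2) C'])
       (use N3 in \<open>auto simp: of_nat_diff\<close>)
  then show ?thesis by (rule small_order_vec)
qed

text \<open>The rotation has been undone in the invariant part, so no powers are lost to the phases:
  order N + 1 of \<open>F\<close> becomes N for its gradient, in size and Lipschitz
  constant.\<close>

lemma small_cgrad_F: "small (int N) (\<lambda>u r z. cgrad F (to_phase (A r z)))"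
proof -
  have "vanishes (Suc (Suc (N - 1))) F" using Fv N3 by simp
  from cgrad_estimates[OF _ _ polynomial_smooth[OF Fp] this]
  obtain L \<rho>1 where L: "0 \<le> L" "0 < \<rho>1" "\<And>r y y'. 0 < r \<Longrightarrow> r \<le> \<rho>1 \<Longrightarrow> y \<in> cball 0 r \<Longrightarrow> y' \<in> cball 0 r \<Longrightarrow>
      norm (cgrad F y) \<le> L * r ^ Suc (N - 1) \<and> norm (cgrad F y - cgrad F y') \<le> L * r ^ (N - 1) * norm (y - y')"
    by (metis UNIV_I open_UNIV)
  obtain K \<rho>0 where K: "0 \<le> K" "0 < \<rho>0" "\<And>r z. 0 < r \<Longrightarrow> r \<le> \<rho>0 \<Longrightarrow> norm z \<le> d \<Longrightarrow> norm (A r z) \<le> K * r"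
    by (rule A_bound) blast
  have Kb: "norm (to_phase (A r z)) \<le> K * r" if "0 < r" "r \<le> \<rho>0" "norm z \<le> d" for r z using K(3)[OF that] by simp
  have "small 1 (\<lambda>u r z. to_phase (A r z))"
    by (rule small_order_linear_compose[OF bounded_linear_to_phase small_A])
  from small_order_ball_compose(1)[OF this K(1,2) Kb L, of "int N"] show ?thesis
    using N3 by (auto simp: of_nat_diff)
qed

end

lemma small_order_cong:
  assumes "small_order d m e" "0 < \<rho>0"
    and "\<And>u r z. 0 < r \<Longrightarrow> r \<le> \<rho>0 \<Longrightarrow> norm z \<le> d \<Longrightarrow> e u r z = e' u r z"
  shows "small_order d m e'"
proof -
  from small_orderE[OF assms(1,2)] obtain C \<rho> where C: "0 \<le> C" "0 < \<rho>" "\<rho> \<le> 1" "\<rho> \<le> \<rho>0"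
    "continuous_on (UNIV \<times> {0<..\<rho>} \<times> cball 0 d) (\<lambda>(u, r, z). e u r z)"
    "\<And>u r z. 0 < r \<Longrightarrow> r \<le> \<rho> \<Longrightarrow> norm z \<le> d \<Longrightarrow> norm (e u r z) \<le> C * r powi m"
    "\<And>u r z z'. 0 < r \<Longrightarrow> r \<le> \<rho> \<Longrightarrow> norm z \<le> d \<Longrightarrow> norm z' \<le> d \<Longrightarrow>
          norm (e u r z - e u r z') \<le> C * r powi m * norm (z - z')"
    by metis
  have eq: "e u r z = e' u r z" if "0 < r" "r \<le> \<rho>" "norm z \<le> d" for u r z
    using that C(4) by (intro assms(3)) auto
  show ?thesis
  proof (rule small_orderI[OF C(1-3)])
    show "continuous_on (UNIV \<times> {0<..\<rho>} \<times> cball 0 d) (\<lambda>(u, r, z). e' u r z)"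
      by (rule continuous_on_eq[OF C(5)]) (auto simp: eq)
    show "norm (e' u r z) \<le> C * r powi m" if "0 < r" "r \<le> \<rho>" "norm z \<le> d" for u r z
      using C(6)[OF that] eq[OF that] by simp
    show "norm (e' u r z - e' u r z') \<le> C * r powi m * norm (z - z')"
      if "0 < r" "r \<le> \<rho>" "norm z \<le> d" "norm z' \<le> d" for u r z z'
      using C(7)[OF that] eq[OF that(1-3)] eq[OF that(1,2,4)] by simp
  qed
qed

lemma resonant_monomial_rotate:
  "resonant_monomial k (of_phase (torus_rotate \<alpha> y)) = cis (\<alpha> \<bullet> rvec k) * resonant_monomial k (of_phase y)"
proof -
  have "resonant_monomial k (of_phase (torus_rotate \<alpha> y)) =
      (\<Prod>i\<in>UNIV. cis (\<alpha> $ i * real (k $ i)) * (of_phase y $ i / of_real (sqrt 2)) ^ (k $ i))"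
    unfolding resonant_monomial_def
    by (rule prod.cong) (auto simp: power_mult_distrib power_divide Complex.DeMoivre mult.commute)
  also have "\<dots> = (\<Prod>i\<in>UNIV. cis (\<alpha> $ i * real (k $ i))) * resonant_monomial k (of_phase y)"
    by (simp add: prod.distrib resonant_monomial_def)
  also have "(\<Prod>i\<in>UNIV. cis (\<alpha> $ i * real (k $ i))) = cis (\<alpha> \<bullet> rvec k)"
    unfolding cis_conv_exp by (simp add: exp_sum inner_vec_def rvec_def sum_distrib_left)
  finally show ?thesis .
qed

context resonant_channel
begin

section \<open>Expansion of the radial and angular velocities\<close>

definition "Q y = Re (\<eta> * resonant_monomial k (of_phase y))"

definition DH :: "nat \<Rightarrow> real ^ 'n \<Rightarrow> real ^ 'n \<Rightarrow> real" where
  "DH j I v = frechet_derivative (HB j) (at I) v"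

text \<open>The actions divided by r^2. The homogeneity of \<open>HB j\<close> then separates a
  power of r from a factor evaluated near \<open>rvec k\<close>.\<close>

definition iota :: "real \<Rightarrow> 'n unknown \<Rightarrow> real ^ 'n" where
  "iota r z = (\<chi> i. if 0 < k $ i then real (k $ i) * mu r z i else r ^ (2 * N - 2) * (cmod (snd (fst z) $ i))\<^sup>2 / 2)"

definition chi :: "real \<Rightarrow> real" where "chi \<delta> = h1 * cos (\<phi>0 + \<delta>) + h2 * sin (\<phi>0 + \<delta>)"
definition chi' :: "real \<Rightarrow> real" where "chi' \<delta> = h2 * cos (\<phi>0 + \<delta>) - h1 * sin (\<phi>0 + \<delta>)"

definition M :: "real \<Rightarrow> 'n unknown \<Rightarrow> real" where
  "M r z = (\<Prod>i\<in>UNIV. sqrt (mu r z i) ^ (k $ i))"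

definition err :: "real ^ 'n \<Rightarrow> real \<Rightarrow> 'n unknown \<Rightarrow> complex ^ 'n" where
  "err u r z = (\<chi> i. cnj (A r z $ i) * (cgrad F (to_phase (A r z)) $ i + remainder_grad u r z $ i))"

text \<open>As z' = i g, this is the rate at which log r decreases, and \<open>phase_drift\<close>
  is the velocity of <theta,k>. In the latter, modes with k_i = 0 have weight 0, so a quotient by a
  vanishing coordinate does no harm.\<close>

definition "S u r z = Im (rotated_grad u r z $ a / A r z $ a)"

definition "phase_drift u r z = (\<Sum>i\<in>UNIV. real (k $ i) * Re (rotated_grad u r z $ i / A r z $ i))"

lemma DH_derivative:
  assumes "1 \<le> j" "j \<le> N div 2" shows "(HB j has_derivative DH j I) (at I)"
  unfolding DH_def[abs_def]
  using polynomial_differentiable[OF homogeneous_poly_polynomial[OF HBh[OF assms]]] frechet_derivative_works by blast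

lemma polynomial_Q: "real_polynomial_function Q"
  unfolding Q_def[abs_def] by (rule polynomial_resonant_part)

lemma polynomial_HB_actions: "real_polynomial_function (\<lambda>y. \<Sum>j = 1..N div 2. HB j (actions y))"
  by (intro real_polynomial_function_sum homogeneous_poly_compose[OF HBh] polynomial_actions) auto

lemma P_eq: "P = (\<lambda>y. (\<Sum>j = 1..N div 2. HB j (actions y)) + Q y + F y)"
  by (rule ext) (simp add: P_def Q_def)

lemma polynomial_P: "real_polynomial_function P"
  unfolding P_eq by (intro real_polynomial_function.intros(3) polynomial_HB_actions polynomial_Q Fp)

lemma P_invariant: "torus_invariant k P"
  using Fi unfolding torus_invariant_def P_def by (simp add: resonant_monomial_rotate)

lemma cgrad_P:
  "cgrad P y $ i = of_real (\<Sum>j = 1..N div 2. DH j (actions y) (axis i 1)) * of_phase y $ i + cgrad Q y $ i + cgrad F y $ i"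
proof -
  let ?p = "\<lambda>I. \<Sum>j = 1..N div 2. HB j I"
  have p: "(?p has_derivative (\<lambda>v. \<Sum>j = 1..N div 2. DH j (actions y) v)) (at (actions y))"
    by (intro has_derivative_sum DH_derivative) auto
  then have "frechet_derivative ?p (at (actions y)) = (\<lambda>v. \<Sum>j = 1..N div 2. DH j (actions y) v)"
    by (rule frechet_derivative_at[symmetric])
  moreover have "cgrad (\<lambda>y. ?p (actions y)) y $ i = of_real (frechet_derivative ?p (at (actions y)) (axis i 1)) * of_phase y $ i"
    using p by (intro cgrad_actions) (auto simp: differentiable_def)
  moreover have "cgrad P y = cgrad (\<lambda>y. ?p (actions y)) y + cgrad Q y + cgrad F y"
    unfolding P_eq
    by (subst cgrad_add cgrad_add[where g = Q],
        (intro differentiable_add polynomial_differentiable polynomial_HB_actions polynomial_Q Fp)+)+ simp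
  ultimately show ?thesis by simp
qed

text \<open>Multiplication by the conjugate coordinate brings every part of the gradient into closed
  form. The action part is real, hence moves angles and not radii; the radii are driven by the
  resonant monomial, up to a small error.\<close>

lemma euler_term:
  "cnj (A r z $ i) * rotated_grad u r z $ i =
     of_real ((cmod (A r z $ i))\<^sup>2 * (\<Sum>j = 1..N div 2. DH j (actions (to_phase (A r z))) (axis i 1)))
     + cnj (of_nat (k $ i) * \<eta> * resonant_monomial k (A r z)) + err u r z $ i"
proof -
  have "cnj (A r z $ i) * cgrad Q (to_phase (A r z)) $ i = cnj (of_nat (k $ i) * \<eta> * resonant_monomial k (A r z))"
    using cgrad_resonant[of \<eta> k "to_phase (A r z)" i] polynomial_differentiable[OF polynomial_resonant_part]
    unfolding Q_def[abs_def] to_of_phase by blast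
  moreover have "cnj (A r z $ i) * A r z $ i = of_real ((cmod (A r z $ i))\<^sup>2)"
    by (metis complex_norm_square mult.commute of_real_power)
  ultimately show ?thesis
    by (simp add: rotated_grad_def cgrad_P err_def distrib_left mult.assoc mult.left_commute)
qed

lemma monomial_A:
  "resonant_monomial k (A r z) = of_real (r ^ N * amplitude k * M r z) * cis (\<phi>0 + fst (fst z))"
proof -
  let ?c = "cis (\<phi>0 + fst (fst z))"
  have "resonant_monomial k (A r z) =
      (\<Prod>i\<in>UNIV. (if i = a then ?c else 1) * of_real (r ^ (k $ i) * sqrt (real (k $ i)) ^ (k $ i) * sqrt (mu r z i) ^ (k $ i)))"
    unfolding resonant_monomial_def
  proof (rule prod.cong)
    fix i
    consider "i = a" | "i \<noteq> a" "0 < k $ i" | "k $ i = 0" by auto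
    then show "(A r z $ i / of_real (sqrt 2)) ^ (k $ i) =
      (if i = a then ?c else 1) * of_real (r ^ (k $ i) * sqrt (real (k $ i)) ^ (k $ i) * sqrt (mu r z i) ^ (k $ i))"
    proof cases
      case 1
      have "A r z $ i / of_real (sqrt 2) = of_real (sqrt (real (k $ a)) * r) * cis ((\<phi>0 + fst (fst z)) / real (k $ a))"
        using 1 by (simp add: A_a real_sqrt_mult)
      then show ?thesis using 1 ka by (simp add: power_mult_distrib Complex.DeMoivre mu_def mult_ac)
    next
      case 2
      then have "A r z $ i / of_real (sqrt 2) = of_real (sqrt (real (k $ i)) * r * sqrt (mu r z i))"
        by (simp add: A_def real_sqrt_mult)
      then show ?thesis using 2 by (simp add: power_mult_distrib mult_ac)
    next
      case 3
      then show ?thesis using ka by auto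
    qed
  qed simp
  also have "\<dots> = ?c * of_real (\<Prod>i\<in>UNIV. r ^ (k $ i) * sqrt (real (k $ i)) ^ (k $ i) * sqrt (mu r z i) ^ (k $ i))"
    by (simp add: prod.distrib)
  also have "(\<Prod>i\<in>UNIV. r ^ (k $ i) * sqrt (real (k $ i)) ^ (k $ i) * sqrt (mu r z i) ^ (k $ i)) = r ^ N * amplitude k * M r z"
    using power_sum[of r "\<lambda>i. k $ i" UNIV] kN by (simp add: prod.distrib amplitude_def M_def vabs_def)
  finally show ?thesis by (simp add: mult.commute)
qed

lemma resonant_term:
  "Re (cnj (of_nat (k $ i) * \<eta> * resonant_monomial k (A r z))) = real (k $ i) * r ^ N * amplitude k * M r z * chi (fst (fst z))"
  "Im (cnj (of_nat (k $ i) * \<eta> * resonant_monomial k (A r z))) = real (k $ i) * r ^ N * amplitude k * M r z * chi' (fst (fst z))"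
  unfolding monomial_A by (simp_all add: \<eta>_def chi_def chi'_def algebra_simps)

lemma small_M: "small (int N - 2) (\<lambda>u r z. M r z - 1)"
  unfolding M_def by (intro small_order_one_prod small_order_one_power small_sqrt_mu) (use N3 in auto)

lemma small_chi: "small 0 (\<lambda>u r z. chi (fst (fst z)))" "small 0 (\<lambda>u r z. chi' (fst (fst z)))"
  unfolding chi_def chi'_def
  by (rule small_delta[where f' = "\<lambda>\<delta>. - h1 * sin (\<phi>0 + \<delta>) + h2 * cos (\<phi>0 + \<delta>)"],
      auto intro!: derivative_eq_intros continuous_intros)
     (rule small_delta[where f' = "\<lambda>\<delta>. - h2 * sin (\<phi>0 + \<delta>) - h1 * cos (\<phi>0 + \<delta>)"],
      auto intro!: derivative_eq_intros continuous_intros)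

lemma small_err: "small (int N + 1) (\<lambda>u r z. err u r z $ i)"
proof -
  have "small (1 + int N) (\<lambda>u r z. cnj (A r z $ i) * (cgrad F (to_phase (A r z)) $ i + remainder_grad u r z $ i))"
    by (intro small_order_mult small_cnj small_nth[OF small_A] small_order_add small_nth[OF small_cgrad_F]
          small_nth[OF small_order_weaken[OF small_remainder_grad]]) simp
  then show ?thesis by (simp add: err_def add.commute)
qed

lemma divide_A:
  "Re (c / A r z $ i) = Re (cnj (A r z $ i) * c) / (cmod (A r z $ i))\<^sup>2"
  "Im (c / A r z $ i) = Im (cnj (A r z $ i) * c) / (cmod (A r z $ i))\<^sup>2"
  by (simp_all add: complex_div_cnj[of c] mult.commute)

lemma S_eq:
  assumes "0 < r" "r \<le> 1" "norm z \<le> d"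
  shows "S u r z * r powi (2 - int N) =
    amplitude k * M r z * chi' (fst (fst z)) / 2 + r powi (- int N) * Im (err u r z $ a) / (2 * real (k $ a))"
proof -
  have S: "S u r z = (real (k $ a) * r ^ N * amplitude k * M r z * chi' (fst (fst z)) + Im (err u r z $ a)) / (2 * real (k $ a) * r\<^sup>2)"
    unfolding S_def divide_A euler_term cmod_A[OF ka assms] plus_complex.sel resonant_term
    by (simp add: mu_def)
  have p: "r powi (2 - int N) = r\<^sup>2 / r ^ N" "r powi (- int N) = 1 / r ^ N"
    using assms by (simp_all add: power_int_diff power_int_minus divide_inverse)
  show ?thesis unfolding S p using assms ka by (simp add: field_simps)
qed

text \<open>Two deviations from the limit: M - 1, of order N - 2, and the error term divided by r^N,
  of order 1. Here \<open>N \<ge> 3\<close> enters.\<close>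

lemma small_S: "small 1 (\<lambda>u r z. S u r z * r powi (2 - int N) - s0 (fst (fst z)))"
proof -
  have 1: "small ((int N - 2) + 0) (\<lambda>u r z. (M r z - 1) * chi' (fst (fst z)))"
    by (intro small_order_mult small_M small_chi)
  have 2: "small (- int N + (int N + 1)) (\<lambda>u r z. r powi (- int N) * Im (err u r z $ a))"
    by (intro small_order_mult small_order_powi small_Im small_err)
  have "small 1 (\<lambda>u r z. (amplitude k / 2) * ((M r z - 1) * chi' (fst (fst z))) +
      (1 / (2 * real (k $ a))) * (r powi (- int N) * Im (err u r z $ a)))"
    using small_order_weaken[OF 1, of 1] 2 N3 by (intro small_order_add small_const_mult) auto
  then show ?thesis
  proof (rule small_order_cong[OF _ zero_less_one])
    fix u :: "real ^ 'n" and r :: real and z :: "'n unknown" assume "0 < r" "r \<le> 1" "norm z \<le> d"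
    note eq = S_eq[OF this, of u]
    have s0: "s0 (fst (fst z)) = amplitude k * chi' (fst (fst z)) / 2" by (simp add: s0_def chi'_def)
    show "(amplitude k / 2) * ((M r z - 1) * chi' (fst (fst z))) +
      (1 / (2 * real (k $ a))) * (r powi (- int N) * Im (err u r z $ a)) = S u r z * r powi (2 - int N) - s0 (fst (fst z))"
      unfolding eq s0 by (simp add: field_simps)
  qed
qed

lemma small_iota: "small (int N - 2) (\<lambda>u r z. iota r z - rvec k)"
proof (rule small_order_vec)
  fix i
  show "small (int N - 2) (\<lambda>u r z. (iota r z - rvec k) $ i)"
  proof (cases "0 < k $ i")
    case True
    have "small (int N - 2) (\<lambda>u r z. real (k $ i) * (mu r z i - 1))"
      by (intro small_const_mult small_mu)
    then show ?thesis using True by (simp add: iota_def rvec_def algebra_simps)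
  next
    case False
    have w: "small (int (2 * N - 2) + (0 + 0)) (\<lambda>u r z. r ^ (2 * N - 2) * Re (snd (fst z) $ i * cnj (snd (fst z) $ i)))"
      by (intro small_order_mult small_order_power small_Re small_cnj small_coords)
    have "small (int (2 * N - 2)) (\<lambda>u r z. (1 / 2) * (r ^ (2 * N - 2) * (cmod (snd (fst z) $ i))\<^sup>2))"
    proof (intro small_const_mult)
      have "Re (w * cnj w) = (cmod w)\<^sup>2" for w by (simp add: cmod_power2) (simp add: power2_eq_square)
      then show "small (int (2 * N - 2)) (\<lambda>u r z. r ^ (2 * N - 2) * (cmod (snd (fst z) $ i))\<^sup>2)"
        using w by (simp del: times_complex.sel)
    qed
    then show ?thesis using False small_order_weaken[of d "int (2 * N - 2)" _ "int N - 2"] N3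
      by (simp add: iota_def rvec_def)
  qed
qed

lemma small_DH:
  assumes "1 \<le> j" "j \<le> N div 2"
  shows "small (int N - 2) (\<lambda>u r z. DH j (iota r z) v - DH j (rvec k) v)"
proof -
  obtain C \<rho> where C: "0 \<le> C" "0 < \<rho>" "\<And>r z. 0 < r \<Longrightarrow> r \<le> \<rho> \<Longrightarrow> norm z \<le> d \<Longrightarrow> norm (iota r z - rvec k) \<le> C * r powi (int N - 2)"
    by (rule small_order_bound[OF small_iota]) (use N3 in auto)
  obtain L where L: "\<And>x y. x \<in> cball 0 (norm (rvec k) + C) \<Longrightarrow> y \<in> cball 0 (norm (rvec k) + C) \<Longrightarrow>
      norm (DH j x v - DH j y v) \<le> L * norm (x - y)"
    using smooth_lipschitz[OF smooth_on_derivative[OF polynomial_smooth[OF homogeneous_poly_polynomial[OF HBh[OF assms]]]] subset_UNIV]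
    unfolding DH_def real_norm_def by meson
  show ?thesis
  proof (rule small_order_lipschitz[where f = "\<lambda>x. DH j x v", OF small_iota L])
    show "rvec k \<in> cball 0 (norm (rvec k) + C)" using C by simp
    show "0 < min \<rho> 1" using C by simp
    show "iota r z \<in> cball 0 (norm (rvec k) + C)" if "0 < r" "r \<le> min \<rho> 1" "norm z \<le> d" for r z
    proof -
      have "norm (iota r z - rvec k) \<le> C * r powi (int N - 2)" using C(3) that by simp
      also have "\<dots> \<le> C * r powi 0"
        using that C(1) N3 by (intro mult_left_mono power_int_decreasing) auto
      finally show ?thesis using norm_triangle_sub[of "iota r z" "rvec k"] by simp
    qed
  qed
qed

lemma actions_A:
  assumes "0 < r" "r \<le> 1" "norm z \<le> d"
  shows "actions (to_phase (A r z)) = r\<^sup>2 *\<^sub>R iota r z"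
proof -
  have "actions (to_phase (A r z)) $ i = (r\<^sup>2 *\<^sub>R iota r z) $ i" for i
  proof (cases "0 < k $ i")
    case True
    then show ?thesis by (simp add: actions_cmod cmod_A[OF True assms] iota_def)
  next
    case False
    moreover have "i \<noteq> a" using False ka by auto
    moreover have "(r ^ N)\<^sup>2 = r\<^sup>2 * r ^ (2 * N - 2)"
    proof -
      have "2 + (2 * N - 2) = N * 2" using N3 by simp
      then show ?thesis by (metis power_add power_mult)
    qed
    ultimately show ?thesis
      by (simp add: actions_cmod A_def iota_def norm_mult power_mult_distrib del: of_real_power)
  qed
  then show ?thesis by (simp add: vec_eq_iff)
qed

lemma DH_A:
  assumes "0 < r" "r \<le> 1" "norm z \<le> d" "1 \<le> j" "j \<le> N div 2"
  shows "DH j (actions (to_phase (A r z))) v = r ^ (2 * (j - 1)) * DH j (iota r z) v"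
proof -
  have "homogeneous_poly (Suc (j - 1)) (HB j)" using HBh[OF assms(4,5)] assms(4) by simp
  from homogeneous_derivative_scale[OF this, of "r\<^sup>2" "iota r z" v] assms
  show ?thesis by (simp add: DH_def actions_A power_mult)
qed

lemma DH_sum:
  assumes "1 \<le> j" "j \<le> N div 2" shows "(\<Sum>i\<in>UNIV. real (k $ i) * DH j I (axis i 1)) = DH j I (rvec k)"
proof -
  have lin: "linear (DH j I)" using DH_derivative[OF assms] by (rule has_derivative_linear)
  have "rvec k = (\<Sum>i\<in>UNIV. real (k $ i) *\<^sub>R axis i 1)"
    by (simp add: vec_eq_iff rvec_def axis_def if_distrib cong: if_cong)
  then show ?thesis by (simp add: linear_sum[OF lin] linear_scale[OF lin])
qed

lemma frequency_eq:
  assumes r: "0 < r" "r \<le> 1" "norm z \<le> d" and i: "0 < k $ i"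
  shows "Re (rotated_grad u r z $ i / A r z $ i) = (\<Sum>j = 1..N div 2. r ^ (2 * (j - 1)) * DH j (iota r z) (axis i 1))
    + r ^ (N - 2) * amplitude k / 2 * (M r z * chi (fst (fst z)) * inverse (mu r z i))
    + 1 / (2 * real (k $ i)) * (r powi (- 2) * (Re (err u r z $ i) * inverse (mu r z i)))"
proof -
  have mu: "mu r z i > 0" using mu_bounds[OF r, of i] by simp
  have rN: "r ^ N = r\<^sup>2 * r ^ (N - 2)"
  proof -
    have "2 + (N - 2) = N" using N3 by simp
    then show ?thesis by (metis power_add)
  qed
  have "(\<Sum>j = 1..N div 2. DH j (actions (to_phase (A r z))) (axis i 1)) =
      (\<Sum>j = 1..N div 2. r ^ (2 * (j - 1)) * DH j (iota r z) (axis i 1))"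
    by (rule sum.cong) (auto simp: DH_A[OF r])
  then have "Re (rotated_grad u r z $ i / A r z $ i) =
      (2 * real (k $ i) * r\<^sup>2 * mu r z i * (\<Sum>j = 1..N div 2. r ^ (2 * (j - 1)) * DH j (iota r z) (axis i 1))
      + real (k $ i) * r ^ N * amplitude k * M r z * chi (fst (fst z)) + Re (err u r z $ i)) / (2 * real (k $ i) * r\<^sup>2 * mu r z i)"
    unfolding divide_A euler_term cmod_A[OF i r] plus_complex.sel resonant_term Re_complex_of_real by simp
  also have "\<dots> = (\<Sum>j = 1..N div 2. r ^ (2 * (j - 1)) * DH j (iota r z) (axis i 1))
    + r ^ (N - 2) * amplitude k / 2 * (M r z * chi (fst (fst z)) * inverse (mu r z i))
    + 1 / (2 * real (k $ i)) * (r powi (- 2) * (Re (err u r z $ i) * inverse (mu r z i)))"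
    unfolding rN using r mu i by (simp add: power_int_minus divide_simps) (simp add: algebra_simps power2_eq_square)
  finally show ?thesis .
qed

text \<open>With the weights k_i the derivatives of \<open>HB j\<close> add up to the derivative in
  the direction k. On the channel this is j times the value at k, by Euler's identity, and so it
  vanishes for 2j < N. Without this condition these terms would dominate after division by r^(N-2).
  The term with 2j = N supplies the level.\<close>

lemma small_phase_drift: "small 1 (\<lambda>u r z. phase_drift u r z * r powi (2 - int N) - p0 (fst (fst z)))"
proof -
  define T where "T j r z = r powi (2 * int j - int N) * DH j (iota r z) (rvec k) - (if 2 * j = N then real N / 2 * level N k HB else 0)"
    for j r and z :: "'n unknown"
  have T: "small 1 (\<lambda>u. T j)" if j: "1 \<le> j" "j \<le> N div 2" for j
  proof -
    have eul: "DH j (rvec k) (rvec k) = real j * HB j (rvec k)"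
      unfolding DH_def by (rule homogeneous_euler[OF HBh[OF j]])
    consider "j = 1" | "j > 1" "2 * j < N" | "2 * j = N" using j by linarith
    then show ?thesis
    proof cases
      case 1
      \<comment> \<open>For j = 1 the derivative is exactly constant, hence exactly 0. A mere
        estimate of order N - 2 would, after multiplication by r^(2-N), leave order 0 instead of
        1.\<close>
      have "HB 1 (rvec k) = 0" using HB0[of 1] N3 by simp
      moreover have "DH 1 (iota r z) (rvec k) = DH 1 (rvec k) (rvec k)" for r z
        unfolding DH_def by (rule homogeneous_1_derivative) (use HBh[OF j] 1 in simp)
      ultimately have "DH 1 (iota r z) (rvec k) = 0" for r z using eul 1 by simp
      then have "T j = (\<lambda>r z. 0)" unfolding T_def using 1 N3 by (auto simp: fun_eq_iff)
      then show ?thesis by (simp add: small_order_zero)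
    next
      case 2
      \<comment> \<open>Now an estimate suffices: of the orders 2j - N and N - 2 there remains 2j -
        2, which is at least 2.\<close>
      have "DH j (rvec k) (rvec k) = 0" using eul HB0[OF j(1) 2(2)] by simp
      then have "small (2 * int j - int N + (int N - 2)) (\<lambda>u r z. r powi (2 * int j - int N) * (DH j (iota r z) (rvec k)))"
        using small_order_mult[OF small_order_powi[of d "2 * int j - int N"] small_DH[OF j, of "rvec k"]] by simp
      then have "small (2 * int j - int N + (int N - 2)) (\<lambda>u. T j)" using 2 by (simp add: T_def[abs_def])
      then show ?thesis by (rule small_order_weaken) (use 2 in auto)
    next
      case 3
      then have "DH j (rvec k) (rvec k) = real N / 2 * level N k HB" using eul by (auto simp: level_def)
      then have "T j = (\<lambda>r z. DH j (iota r z) (rvec k) - DH j (rvec k) (rvec k))"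
        using 3 by (auto simp: T_def fun_eq_iff)
      then show ?thesis using small_order_weaken[OF small_DH[OF j, of "rvec k"], of 1] N3 by simp
    qed
  qed
  have sumlevel: "(\<Sum>j = 1..N div 2. if 2 * j = N then real N / 2 * level N k HB else 0) = real N / 2 * level N k HB"
  proof (cases "even N")
    case True
    then have "(\<Sum>j = 1..N div 2. if 2 * j = N then real N / 2 * level N k HB else 0) =
        (\<Sum>j = 1..N div 2. if j = N div 2 then real N / 2 * level N k HB else 0)"
      by (intro sum.cong) auto
    also have "\<dots> = real N / 2 * level N k HB" using N3 True by (subst sum.delta) auto
    finally show ?thesis .
  next
    case False
    then have "level N k HB = 0" by (simp add: level_def)
    then show ?thesis by (auto intro!: sum.neutral)
  qed
  \<comment> \<open>The deviation of M times the sum of k_i / mu_i from its limit N (see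
    \<open>F5\<close>), arranged so that every term contains a small factor.\<close>
  define G where "G r z = (M r z - 1) * (\<Sum>i\<in>UNIV. real (k $ i) * inverse (mu r z i)) + (\<Sum>i\<in>UNIV. real (k $ i) * (inverse (mu r z i) - 1))"
    for r z
  have inv: "small 0 (\<lambda>u r z. inverse (mu r z i))" for i
    by (rule small_plus_one[OF _ small_inverse_mu]) (use N3 in simp)
  have "small (int N - 2 + 0) (\<lambda>u r z. (M r z - 1) * (\<Sum>i\<in>UNIV. real (k $ i) * inverse (mu r z i)))"
    by (intro small_order_mult small_M small_order_sum small_const_mult inv)
  moreover have "small (int N - 2) (\<lambda>u r z. \<Sum>i\<in>UNIV. real (k $ i) * (inverse (mu r z i) - 1))"
    by (intro small_order_sum small_const_mult small_inverse_mu)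
  ultimately have "small (int N - 2) (\<lambda>u. G)" unfolding G_def[abs_def] by (intro small_order_add) auto
  then have "small (0 + (int N - 2)) (\<lambda>u r z. chi (fst (fst z)) * G r z)"
    by (intro small_order_mult small_chi)
  then have G: "small 1 (\<lambda>u r z. chi (fst (fst z)) * G r z)" by (rule small_order_weaken) (use N3 in auto)
  define E where "E u r z = (\<Sum>i\<in>UNIV. (if 0 < k $ i then 1 else 0) * (r powi (- int N) * (Re (err u r z $ i) * inverse (mu r z i))))"
    for u r z
  have "small (- int N + (int N + 1 + 0)) (\<lambda>u r z. r powi (- int N) * (Re (err u r z $ i) * inverse (mu r z i)))" for i
    by (intro small_order_mult small_order_powi small_Re small_err inv)
  then have E: "small 1 E" unfolding E_def[abs_def]
    by (intro small_order_sum small_const_mult) simp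
  have "small 1 (\<lambda>u r z. (\<Sum>j = 1..N div 2. T j r z) + (amplitude k / 2) * (chi (fst (fst z)) * G r z) + (1 / 2) * E u r z)"
    by (intro small_order_add small_order_sum small_const_mult G E T) auto
  then show ?thesis
  proof (rule small_order_cong[OF _ zero_less_one])
    fix u :: "real ^ 'n" and r :: real and z :: "'n unknown" assume r: "0 < r" "r \<le> 1" "norm z \<le> d"
    let ?X = "\<Sum>j = 1..N div 2. r ^ (2 * (j - 1)) * DH j (iota r z) (rvec k)"
    let ?I = "\<Sum>i\<in>UNIV. real (k $ i) * inverse (mu r z i)"
    have term_i: "real (k $ i) * Re (rotated_grad u r z $ i / A r z $ i) =
        (\<Sum>j = 1..N div 2. r ^ (2 * (j - 1)) * (real (k $ i) * DH j (iota r z) (axis i 1)))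
        + r ^ (N - 2) * amplitude k / 2 * M r z * chi (fst (fst z)) * (real (k $ i) * inverse (mu r z i))
        + 1 / 2 * ((if 0 < k $ i then 1 else 0) * (r powi (- 2) * (Re (err u r z $ i) * inverse (mu r z i))))" for i
    proof (cases "0 < k $ i")
      case True
      then show ?thesis unfolding frequency_eq[OF r True]
        by (simp add: distrib_left sum_distrib_left mult_ac)
    qed simp
    have "phase_drift u r z = ?X + r ^ (N - 2) * amplitude k / 2 * M r z * chi (fst (fst z)) * ?I
        + 1 / 2 * (\<Sum>i\<in>UNIV. (if 0 < k $ i then 1 else 0) * (r powi (- 2) * (Re (err u r z $ i) * inverse (mu r z i))))"
    proof -
      have "(\<Sum>i\<in>UNIV. \<Sum>j = 1..N div 2. r ^ (2 * (j - 1)) * (real (k $ i) * DH j (iota r z) (axis i 1))) = ?X"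
        by (subst sum.swap) (auto simp: sum_distrib_left[symmetric] DH_sum intro!: sum.cong)
      then show ?thesis
        unfolding phase_drift_def term_i sum.distrib sum_distrib_left[symmetric] by simp
    qed
    then have F1: "phase_drift u r z * r powi (2 - int N) = ?X * r powi (2 - int N)
        + (r ^ (N - 2) * r powi (2 - int N)) * amplitude k / 2 * M r z * chi (fst (fst z)) * ?I
        + 1 / 2 * (\<Sum>i\<in>UNIV. (if 0 < k $ i then 1 else 0) * ((r powi (- 2) * r powi (2 - int N)) * (Re (err u r z $ i) * inverse (mu r z i))))"
      by (simp add: algebra_simps sum_distrib_left sum_distrib_right)
    have F2: "r ^ (N - 2) * r powi (2 - int N) = 1"
    proof -
      have "r ^ (N - 2) * r powi (2 - int N) = r powi int (N - 2) * r powi (2 - int N)"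
        by (simp only: power_int_of_nat)
      also have "\<dots> = r powi (int (N - 2) + (2 - int N))"
        by (rule power_int_add[symmetric]) (use r in auto)
      also have "int (N - 2) + (2 - int N) = 0" using N3 by simp
      finally show ?thesis by simp
    qed
    have F3: "r powi (- 2) * r powi (2 - int N) = r powi (- int N)"
      using r power_int_add[of r "- 2" "2 - int N"] by simp
    have F4: "?X * r powi (2 - int N) = (\<Sum>j = 1..N div 2. T j r z) + real N / 2 * level N k HB"
    proof -
      have "?X * r powi (2 - int N) = (\<Sum>j = 1..N div 2. r powi (2 * int j - int N) * DH j (iota r z) (rvec k))"
        unfolding sum_distrib_right
      proof (rule sum.cong)
        fix j assume "j \<in> {1..N div 2}"
        then have "r ^ (2 * (j - 1)) * r powi (2 - int N) = r powi (2 * int j - int N)"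
          using r power_int_add[of r "int (2 * (j - 1))" "2 - int N"] by (simp add: of_nat_diff power_int_of_nat[symmetric] del: power_int_of_nat)
        then show "r ^ (2 * (j - 1)) * DH j (iota r z) (rvec k) * r powi (2 - int N) =
            r powi (2 * int j - int N) * DH j (iota r z) (rvec k)"
          by (metis mult.assoc mult.commute)
      qed simp
      then show ?thesis unfolding T_def sum_subtractf sumlevel by simp
    qed
    have F5: "M r z * ?I = G r z + real N"
    proof -
      have "real N = (\<Sum>i\<in>UNIV. real (k $ i))" by (simp add: kN[symmetric] vabs_def)
      then show ?thesis by (simp add: G_def algebra_simps sum_subtractf)
    qed
    have F6: "1 * amplitude k / 2 * M r z * chi (fst (fst z)) * ?I = amplitude k / 2 * chi (fst (fst z)) * (G r z + real N)"
      unfolding F5[symmetric] by simp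
    have p0: "p0 (fst (fst z)) = real N / 2 * (level N k HB + amplitude k * chi (fst (fst z)))"
      by (simp add: p0_def chi_def)
    show "(\<Sum>j = 1..N div 2. T j r z) + (amplitude k / 2) * (chi (fst (fst z)) * G r z) + (1 / 2) * E u r z =
       phase_drift u r z * r powi (2 - int N) - p0 (fst (fst z))"
      unfolding F1 F2 F3 F4 F6 p0 E_def by (simp only: distrib_left) simp
  qed
qed

section \<open>The rescaled vector field and its contraction property\<close>

definition free_factor :: "'n \<Rightarrow> complex ^ 'n \<Rightarrow> real" where
  "free_factor i = (SOME \<Theta>. \<exists>L\<ge>0. (\<forall>A. cgrad P (to_phase A) $ i = of_real (\<Theta> A) * A $ i) \<and>
     (\<forall>A\<in>cball 0 1. \<forall>A'\<in>cball 0 1. \<bar>\<Theta> A - \<Theta> A'\<bar> \<le> L * norm (A - A')))"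

text \<open>The angular velocity of a mode. For k_i = 0 the coordinate may vanish, so the Lipschitz
  quotient is used; the remainder is not a multiple of that coordinate and goes into the equation of
  the amplitude instead.\<close>

definition theta :: "real ^ 'n \<Rightarrow> real \<Rightarrow> 'n unknown \<Rightarrow> 'n \<Rightarrow> real" where
  "theta u r z i = (if 0 < k $ i then Re (rotated_grad u r z $ i / A r z $ i) else free_factor i (A r z))"

text \<open>Signs and factors are those of the fixed point theorem, v' = N v - G and q' = G - (N-1)
  q. In the action components the linear term cancels the derivative of the scaling factor r^N, and
  by the conservation laws only the remainder is left. The components at \<open>a\<close> are 0,
  since mode \<open>a\<close> is described by the radius and the resonant angle.\<close>

definition G :: "real ^ 'n \<Rightarrow> real \<Rightarrow> 'n unknown \<Rightarrow> 'n unknown" where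
  "G u r z = ((real N * fst (fst z) - phase_drift u r z / S u r z,
     \<chi> i. if i = a then 0
        else if 0 < k $ i then of_real (- (r powi (- int N) * (Im (cnj (A r z $ a) * remainder_grad u r z $ a) / real (k $ a)
             - Im (cnj (A r z $ i) * remainder_grad u r z $ i) / real (k $ i)) / S u r z))
        else - (\<i> * remainder_grad u r z $ i * of_real (r powi (- int N) / S u r z))),
     \<chi> i. if i = a then 0 else r powi (int N - 1) * theta u r z i / S u r z)"

text \<open>What the linear rate N leaves over in the limit equation of the resonant angle.\<close>

definition m0 :: "real \<Rightarrow> real" where "m0 \<delta> = real N * \<delta> - p0 \<delta> / s0 \<delta>"

lemma free_factor:
  assumes i: "k $ i = 0"
  shows "cgrad P (to_phase c) $ i = of_real (free_factor i c) * c $ i"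
    and "\<exists>L\<ge>0. \<forall>A\<in>cball 0 1. \<forall>A'\<in>cball 0 1. \<bar>free_factor i A - free_factor i A'\<bar> \<le> L * norm (A - A')"
proof -
  have "\<exists>\<Theta>. \<exists>L\<ge>0. (\<forall>A. cgrad P (to_phase A) $ i = of_real (\<Theta> A) * A $ i) \<and>
     (\<forall>A\<in>cball 0 1. \<forall>A'\<in>cball 0 1. \<bar>\<Theta> A - \<Theta> A'\<bar> \<le> L * norm (A - A'))"
    using cgrad_free_mode[OF polynomial_smooth[OF polynomial_P] P_invariant i ka] by blast
  from someI_ex[OF this, folded free_factor_def]
  show "cgrad P (to_phase c) $ i = of_real (free_factor i c) * c $ i"
    and "\<exists>L\<ge>0. \<forall>A\<in>cball 0 1. \<forall>A'\<in>cball 0 1. \<bar>free_factor i A - free_factor i A'\<bar> \<le> L * norm (A - A')"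
    by blast+
qed

lemma small_inv_mu: "small 0 (\<lambda>u r z. inverse (mu r z i))"
  by (rule small_plus_one[OF _ small_inverse_mu]) (use N3 in simp)

lemma small_theta: "small 0 (\<lambda>u r z. theta u r z i)"
proof (cases "0 < k $ i")
  case True
  have DHs: "small 0 (\<lambda>u r z. DH j (iota r z) v)" if "1 \<le> j" "j \<le> N div 2" for j v
    using small_order_add[OF small_order_weaken[OF small_DH[OF that, of v], of 0] small_order_const[of d "DH j (rvec k) v"]] N3
    by simp
  have p: "small 0 e" if "small (int l) e" for l and e :: "real ^ 'n \<Rightarrow> real \<Rightarrow> 'n unknown \<Rightarrow> real"
    by (rule small_order_weaken[OF that]) auto
  have 1: "small 0 (\<lambda>u r z. \<Sum>j = 1..N div 2. r ^ (2 * (j - 1)) * DH j (iota r z) (axis i 1))"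
  proof (rule small_order_sum)
    fix j assume "j \<in> {1..N div 2}"
    then have "small (int (2 * (j - 1)) + 0) (\<lambda>u r z. r ^ (2 * (j - 1)) * DH j (iota r z) (axis i 1))"
      by (intro small_order_mult small_order_power DHs) auto
    then show "small 0 (\<lambda>u r z. r ^ (2 * (j - 1)) * DH j (iota r z) (axis i 1))"
      by (intro p[of "2 * (j - 1)"]) simp
  qed
  have M: "small 0 (\<lambda>u r z. M r z)" by (rule small_plus_one[OF _ small_M]) (use N3 in simp)
  have "small (int (N - 2) + (0 + 0 + 0)) (\<lambda>u r z. r ^ (N - 2) * (M r z * chi (fst (fst z)) * inverse (mu r z i)))"
    by (intro small_order_mult small_order_power M small_chi small_inv_mu)
  then have "small 0 (\<lambda>u r z. (amplitude k / 2) * (r ^ (N - 2) * (M r z * chi (fst (fst z)) * inverse (mu r z i))))"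
    by (intro small_const_mult p) simp
  then have 2: "small 0 (\<lambda>u r z. r ^ (N - 2) * amplitude k / 2 * (M r z * chi (fst (fst z)) * inverse (mu r z i)))"
    by (simp add: mult_ac)
  have "small (- 2 + (int N + 1 + 0)) (\<lambda>u r z. r powi (- 2) * (Re (err u r z $ i) * inverse (mu r z i)))"
    by (intro small_order_mult small_order_powi small_Re small_err small_inv_mu)
  then have 3: "small 0 (\<lambda>u r z. 1 / (2 * real (k $ i)) * (r powi (- 2) * (Re (err u r z $ i) * inverse (mu r z i))))"
    by (intro small_const_mult) (rule small_order_weaken, use N3 in auto)
  show ?thesis
  proof (rule small_order_cong[OF small_order_add[OF small_order_add[OF 1 2] 3] zero_less_one])
  qed (simp add: theta_def True frequency_eq)
next
  case False
  then have i: "k $ i = 0" by simp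
  obtain L where L: "\<And>A A'. A \<in> cball 0 1 \<Longrightarrow> A' \<in> cball 0 1 \<Longrightarrow> norm (free_factor i A - free_factor i A') \<le> L * norm (A - A')"
    using free_factor(2)[OF i] unfolding real_norm_def by meson
  obtain K \<rho> where K: "0 \<le> K" "0 < \<rho>" "\<And>r z. 0 < r \<Longrightarrow> r \<le> \<rho> \<Longrightarrow> norm z \<le> d \<Longrightarrow> norm (A r z) \<le> K * r"
    by (rule A_bound) blast
  have A0: "small 0 (\<lambda>u r z. A r z - 0)" using small_order_weaken[OF small_A, of 0] by simp
  have "small 0 (\<lambda>u r z. free_factor i (A r z) - free_factor i 0)"
  proof (rule small_order_lipschitz[where f = "free_factor i", OF A0 L])
    show "0 < min \<rho> (1 / (K + 1))" using K by simp
    show "A r z \<in> cball 0 1" if "0 < r" "r \<le> min \<rho> (1 / (K + 1))" "norm z \<le> d" for r z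
    proof -
      have "norm (A r z) \<le> K * r" using K that by simp
      also have "\<dots> \<le> (K + 1) * r" using that by simp
      also have "\<dots> \<le> 1" using that K by (simp add: field_simps)
      finally show ?thesis by simp
    qed
  qed auto
  from small_order_add[OF this small_order_const[of d "free_factor i 0"]] show ?thesis
    using False by (simp add: theta_def)
qed

lemma small_inverse:
  fixes e :: "real ^ 'n \<Rightarrow> real \<Rightarrow> 'n unknown \<Rightarrow> real"
  assumes e: "small 0 e" and c: "0 < c" "0 < \<rho>0" "\<And>u r z. 0 < r \<Longrightarrow> r \<le> \<rho>0 \<Longrightarrow> norm z \<le> d \<Longrightarrow> c \<le> e u r z"
  shows "small 0 (\<lambda>u r z. inverse (e u r z))"
proof -
  have lip: "norm (inverse x - inverse y) \<le> (1 / c\<^sup>2) * norm (x - y)" if "x \<in> {c..}" "y \<in> {c..}" for x y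
  proof -
    have xy: "x > 0" "y > 0" using that c by auto
    have "norm (inverse x - inverse y) = \<bar>x - y\<bar> / (x * y)"
      using xy by (simp add: inverse_diff_inverse abs_mult divide_inverse abs_minus_commute)
    also have "\<dots> \<le> \<bar>x - y\<bar> / (c * c)"
      using that c by (intro divide_left_mono mult_mono mult_pos_pos) auto
    finally show ?thesis by (simp add: power2_eq_square)
  qed
  have "small 0 (\<lambda>u r z. e u r z - c)" by (intro small_order_diff e small_order_const)
  from small_order_lipschitz[where S = "{c..}", OF this lip _ c(2)] c
  have "small 0 (\<lambda>u r z. inverse (e u r z) - inverse c)" by auto
  from small_order_add[OF this small_order_const[of d "inverse c"]] show ?thesis by simp
qed

lemma small_s0: "small 0 (\<lambda>u r z. s0 (fst (fst z)))"
  using small_const_mult[OF small_chi(2), of "amplitude k / 2"] by (simp add: s0_def chi'_def)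

lemma S_lower: "\<exists>\<rho>>0. \<forall>u r z. 0 < r \<longrightarrow> r \<le> \<rho> \<longrightarrow> norm z \<le> d \<longrightarrow> smin / 2 \<le> S u r z * r powi (2 - int N)"
proof -
  obtain C \<rho> where C: "0 \<le> C" "0 < \<rho>" "\<And>u r z. 0 < r \<Longrightarrow> r \<le> \<rho> \<Longrightarrow> norm z \<le> d \<Longrightarrow>
      norm (S u r z * r powi (2 - int N) - s0 (fst (fst z))) \<le> C * r powi 1"
    using small_order_bound[OF small_S] by auto
  have "smin / 2 \<le> S u r z * r powi (2 - int N)"
    if r: "0 < r" "r \<le> min \<rho> (smin / (2 * (C + 1)))" and z: "norm z \<le> d" for u r z
  proof -
    have "smin \<le> s0 (fst (fst z))" using smin(2)[OF z_bounds(1)[OF z]] by (simp add: s0_def)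
    moreover have "C * r \<le> smin / 2"
    proof -
      have "C * r \<le> (C + 1) * r" using r by simp
      also have "\<dots> \<le> smin / 2" using r C by (simp add: field_simps)
      finally show ?thesis .
    qed
    moreover have "\<bar>S u r z * r powi (2 - int N) - s0 (fst (fst z))\<bar> \<le> C * r" using C(3)[of r z u] r z by simp
    ultimately show ?thesis by linarith
  qed
  then show ?thesis using C smin by (intro exI[of _ "min \<rho> (smin / (2 * (C + 1)))"]) auto
qed

lemma small_inverse_S: "small 0 (\<lambda>u r z. inverse (S u r z * r powi (2 - int N)))"
proof -
  obtain \<rho> where \<rho>: "\<rho> > 0" "\<And>u r z. 0 < r \<Longrightarrow> r \<le> \<rho> \<Longrightarrow> norm z \<le> d \<Longrightarrow> smin / 2 \<le> S u r z * r powi (2 - int N)"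
    using S_lower by blast
  have "small 0 (\<lambda>u r z. (S u r z * r powi (2 - int N) - s0 (fst (fst z))) + s0 (fst (fst z)))"
    by (intro small_order_add small_s0 small_order_weaken[OF small_S]) simp
  then have "small 0 (\<lambda>u r z. S u r z * r powi (2 - int N))" by simp
  then show ?thesis by (rule small_inverse[OF _ _ \<rho>]) (use smin in auto)
qed

lemma inverse_S: "0 < r \<Longrightarrow> e / S u r z = e * (r powi (2 - int N) * inverse (S u r z * r powi (2 - int N)))"
  by (simp add: field_simps)

lemma small_over_S: "small m e \<Longrightarrow> small (m + 2 - int N) (\<lambda>u r z. e u r z / S u r z)"
proof (rule small_order_cong[OF _ zero_less_one])
  assume "small m e"
  then have "small (m + (2 - int N + 0)) (\<lambda>u r z. e u r z * (r powi (2 - int N) * inverse (S u r z * r powi (2 - int N))))"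
    by (intro small_order_mult small_order_powi small_inverse_S)
  then show "small (m + 2 - int N) (\<lambda>u r z. e u r z * (r powi (2 - int N) * inverse (S u r z * r powi (2 - int N))))"
    by (simp add: algebra_simps)
qed (simp add: inverse_S)

text \<open>Division by \<open>S\<close> costs N - 2 powers. The action components, of order N + 2
  for k_i > 0 and N + 1 for k_i = 0, are left with 4 and 3. The phases have N - 1 powers and keep
  exactly one, which is why they are rescaled by r^(1-N) and not by r^(2-N).\<close>

lemma small_G: "small 1 (\<lambda>u r z. G u r z - ((m0 (fst (fst z)), 0), 0))"
proof -
  obtain \<rho> where \<rho>: "\<rho> > 0" "\<And>u r z. 0 < r \<Longrightarrow> r \<le> \<rho> \<Longrightarrow> norm z \<le> d \<Longrightarrow> smin / 2 \<le> S u r z * r powi (2 - int N)"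
    using S_lower by blast
  have s0pos: "0 < s0 (fst (fst z))" if "norm z \<le> d" for z :: "'n unknown"
    using smin(2)[OF z_bounds(1)[OF that]] smin(1) by (simp add: s0_def)
  have is0: "small 0 (\<lambda>u r z. inverse (s0 (fst (fst z))))"
  proof (rule small_inverse[OF small_s0 smin(1) zero_less_one])
    show "smin \<le> s0 (fst (fst z))" if "norm z \<le> d" for z :: "'n unknown"
      using smin(2)[OF z_bounds(1)[OF that]] by (simp add: s0_def)
  qed
  have p0s: "small 0 (\<lambda>u r z. p0 (fst (fst z)))"
  proof -
    have "small 0 (\<lambda>u r z. real N / 2 * (level N k HB + amplitude k * chi (fst (fst z))))"
      by (intro small_const_mult small_order_add small_order_const small_chi)
    then show ?thesis by (simp add: p0_def chi_def)
  qed
  define g1 where "g1 u r z = real N * fst (fst z) - phase_drift u r z / S u r z - m0 (fst (fst z))" for u r and z :: "'n unknown"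
  \<comment> \<open>Difference of two quotients: with p and s the rescaled drift and radial rate,
    p0/s0 - p/s equals p0 (s - s0) / (s0 s) - (p - p0) / s.\<close>
  have g1: "small 1 g1"
  proof (rule small_order_cong[OF _ \<rho>(1)])
    have "small (0 + 0 + 1 + 0) (\<lambda>u r z. p0 (fst (fst z)) * inverse (s0 (fst (fst z)))
        * (S u r z * r powi (2 - int N) - s0 (fst (fst z))) * inverse (S u r z * r powi (2 - int N)))"
      by (intro small_order_mult p0s is0 small_S small_inverse_S)
    moreover have "small (1 + 0) (\<lambda>u r z. (phase_drift u r z * r powi (2 - int N) - p0 (fst (fst z))) * inverse (S u r z * r powi (2 - int N)))"
      by (intro small_order_mult small_phase_drift small_inverse_S)
    ultimately show "small 1 (\<lambda>u r z. p0 (fst (fst z)) * inverse (s0 (fst (fst z)))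
        * (S u r z * r powi (2 - int N) - s0 (fst (fst z))) * inverse (S u r z * r powi (2 - int N))
        - (phase_drift u r z * r powi (2 - int N) - p0 (fst (fst z))) * inverse (S u r z * r powi (2 - int N)))"
      by (intro small_order_diff) auto
    fix u r and z :: "'n unknown" assume r: "0 < r" "r \<le> \<rho>" "norm z \<le> d"
    define Sh where "Sh = S u r z * r powi (2 - int N)"
    have Sh: "Sh > 0" using \<rho>(2)[OF r, of u] smin by (simp add: Sh_def)
    have FS: "phase_drift u r z / S u r z = phase_drift u r z * r powi (2 - int N) * inverse Sh"
      using inverse_S[OF r(1), of "phase_drift u r z" u z] by (simp add: Sh_def)
    show "p0 (fst (fst z)) * inverse (s0 (fst (fst z)))
        * (S u r z * r powi (2 - int N) - s0 (fst (fst z))) * inverse (S u r z * r powi (2 - int N))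
        - (phase_drift u r z * r powi (2 - int N) - p0 (fst (fst z))) * inverse (S u r z * r powi (2 - int N)) = g1 u r z"
      using Sh s0pos[OF r(3)] unfolding g1_def m0_def FS Sh_def[symmetric] by (simp add: field_simps)
  qed
  have X: "small (2 * int N + 2) (\<lambda>u r z. Im (cnj (A r z $ i) * remainder_grad u r z $ i))" for i
  proof -
    have "small (1 + (2 * int N + 1)) (\<lambda>u r z. cnj (A r z $ i) * remainder_grad u r z $ i)"
      by (intro small_order_mult small_cnj small_nth[OF small_A] small_nth[OF small_remainder_grad])
    then show ?thesis by (intro small_Im) (simp add: add.commute)
  qed
  define g2 where "g2 u r z = snd (fst (G u r z))" for u r z
  have g2: "small 1 g2"
  proof (rule small_order_vec)
    fix i
    consider "i = a" | "i \<noteq> a" "0 < k $ i" | "i \<noteq> a" "k $ i = 0" by auto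
    then show "small 1 (\<lambda>u r z. g2 u r z $ i)"
    proof cases
      case 1
      then show ?thesis by (simp add: g2_def G_def small_order_zero)
    next
      case 2
      have "small (2 * int N + 2) (\<lambda>u r z. Im (cnj (A r z $ a) * remainder_grad u r z $ a) / real (k $ a) - Im (cnj (A r z $ i) * remainder_grad u r z $ i) / real (k $ i))"
        using small_const_mult[OF X, of "1 / real (k $ a)" a] small_const_mult[OF X, of "1 / real (k $ i)" i]
        by (intro small_order_diff) auto
      then have "small (- int N + (2 * int N + 2)) (\<lambda>u r z. r powi (- int N) * (Im (cnj (A r z $ a) * remainder_grad u r z $ a) / real (k $ a) - Im (cnj (A r z $ i) * remainder_grad u r z $ i) / real (k $ i)))"
        by (intro small_order_mult small_order_powi)
      from small_order_weaken[OF small_of_real[OF small_order_uminus[OF small_over_S[OF this]]], of 1]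
      show ?thesis using 2 by (simp add: g2_def G_def)
    next
      case 3
      have "small (2 * int N + 1 + (- int N + 2 - int N)) (\<lambda>u r z. remainder_grad u r z $ i * of_real (r powi (- int N) / S u r z))"
        by (intro small_order_mult small_nth[OF small_remainder_grad] small_of_real small_over_S small_order_powi)
      from small_order_weaken[OF small_order_linear_compose[OF bounded_linear_mult_right[of "- \<i>"] this], of 1]
      show ?thesis using 3 by (simp add: g2_def G_def mult.assoc)
    qed
  qed
  define g3 where "g3 u r z = snd (G u r z)" for u r z
  have g3: "small 1 g3"
  proof (rule small_order_vec)
    fix i
    have "small (int N - 1 + 0 + 2 - int N) (\<lambda>u r z. r powi (int N - 1) * theta u r z i / S u r z)"
      by (intro small_over_S small_order_mult small_order_powi small_theta)
    then show "small 1 (\<lambda>u r z. g3 u r z $ i)"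
      by (cases "i = a") (simp_all add: g3_def G_def small_order_zero)
  qed
  have "bounded_linear (\<lambda>x :: real. ((x, 0 :: complex ^ 'n), 0 :: real ^ 'n))"
       "bounded_linear (\<lambda>x :: complex ^ 'n. ((0 :: real, x), 0 :: real ^ 'n))"
       "bounded_linear (\<lambda>x :: real ^ 'n. ((0 :: real, 0 :: complex ^ 'n), x))"
    by (intro bounded_linear_Pair bounded_linear_ident bounded_linear_zero)+
  from small_order_add[OF small_order_add[OF small_order_linear_compose[OF this(1) g1] small_order_linear_compose[OF this(2) g2]]
      small_order_linear_compose[OF this(3) g3]]
  have "small 1 (\<lambda>u r z. ((g1 u r z, 0), 0) + ((0, g2 u r z), 0) + ((0, 0), g3 u r z))" .
  moreover have "((g1 u r z, 0), 0) + ((0, g2 u r z), 0) + ((0, 0), g3 u r z) = G u r z - ((m0 (fst (fst z)), 0), 0)" for u r z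
    by (simp add: prod_eq_iff g1_def g2_def g3_def) (simp add: G_def)
  ultimately show ?thesis by simp
qed

text \<open>The derivative of \<open>m0\<close> vanishes at 0: there \<open>p0\<close> is 0 by the
  choice of \<open>\<phi>0\<close>, and \<open>p1\<close> is N times \<open>s0\<close>, both being
  derivatives of the same amplitude. Continuity of the derivative gives a small Lipschitz constant
  nearby.\<close>

lemma m0_lipschitz:
  assumes \<epsilon>: "\<epsilon> > 0"
  shows "\<exists>\<delta>0>0. \<delta>0 \<le> d \<and> (\<forall>x y. \<bar>x\<bar> \<le> \<delta>0 \<longrightarrow> \<bar>y\<bar> \<le> \<delta>0 \<longrightarrow> \<bar>m0 x - m0 y\<bar> \<le> \<epsilon> * \<bar>x - y\<bar>)"
proof -
  define p1 where "p1 x = real N / 2 * (amplitude k * (h2 * cos (\<phi>0 + x) - h1 * sin (\<phi>0 + x)))" for x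
  define s1 where "s1 x = - amplitude k * (h2 * sin (\<phi>0 + x) + h1 * cos (\<phi>0 + x)) / 2" for x
  define m1 where "m1 x = real N - (p1 x * s0 x - p0 x * s1 x) / (s0 x * s0 x)" for x
  have s0: "s0 x > 0" if "\<bar>x\<bar> \<le> d" for x using smin(2)[OF that] smin(1) by (simp add: s0_def)
  have dp: "(p0 has_real_derivative p1 x) (at x)" for x
    unfolding p0_def[abs_def] p1_def by (auto intro!: derivative_eq_intros simp: algebra_simps)
  have ds: "(s0 has_real_derivative s1 x) (at x)" for x
    unfolding s0_def[abs_def] s1_def by (auto intro!: derivative_eq_intros simp: field_simps)
  have dm: "(m0 has_real_derivative m1 x) (at x)" if "\<bar>x\<bar> \<le> d" for x
    unfolding m0_def[abs_def] m1_def using s0[OF that]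
    by (auto intro!: derivative_eq_intros dp ds)
  have m10: "m1 0 = 0"
  proof -
    have "p0 0 = 0" using zero by (simp add: p0_def)
    moreover have "p1 0 = real N * s0 0" by (simp add: p1_def s0_def)
    ultimately show ?thesis using s0[of 0] d by (simp add: m1_def)
  qed
  have "continuous_on {-d..d} m1"
  proof -
    have "continuous_on {-d..d} s0" "continuous_on {-d..d} p0" "continuous_on {-d..d} s1" "continuous_on {-d..d} p1"
      unfolding s0_def[abs_def] p0_def[abs_def] s1_def[abs_def] p1_def[abs_def] by (intro continuous_intros; simp)+
    moreover have "s0 x \<noteq> 0" if "x \<in> {-d..d}" for x using s0[of x] that by (fastforce simp: abs_le_iff)
    ultimately show ?thesis unfolding m1_def[abs_def] by (intro continuous_intros) auto
  qed
  moreover have "0 \<in> {-d..d}" using d by simp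
  ultimately have "\<exists>\<gamma>>0. \<forall>x\<in>{-d..d}. dist x 0 < \<gamma> \<longrightarrow> dist (m1 x) (m1 0) < \<epsilon>"
    unfolding continuous_on_iff using \<epsilon> by blast
  then obtain \<gamma> where \<gamma>: "\<gamma> > 0" "\<And>x. x \<in> {-d..d} \<Longrightarrow> \<bar>x\<bar> < \<gamma> \<Longrightarrow> \<bar>m1 x\<bar> < \<epsilon>"
    by (auto simp: dist_real_def m10)
  define \<delta>0 where "\<delta>0 = min d (\<gamma> / 2)"
  have "\<bar>m0 x - m0 y\<bar> \<le> \<epsilon> * \<bar>x - y\<bar>" if "\<bar>x\<bar> \<le> \<delta>0" "\<bar>y\<bar> \<le> \<delta>0" for x y
  proof -
    have "norm (m0 x - m0 y) \<le> \<epsilon> * norm (x - y)"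
    proof (rule field_differentiable_bound[where S = "{-\<delta>0..\<delta>0}"])
      fix t assume "t \<in> {-\<delta>0..\<delta>0}"
      then have t: "\<bar>t\<bar> \<le> d" "\<bar>t\<bar> < \<gamma>" using \<gamma>(1) by (auto simp: \<delta>0_def abs_le_iff)
      show "(m0 has_real_derivative m1 t) (at t within {-\<delta>0..\<delta>0})"
        using dm[OF t(1)] by (rule has_field_derivative_at_within)
      show "norm (m1 t) \<le> \<epsilon>" using \<gamma>(2)[of t] t by (auto simp: abs_le_iff)
    qed (use that in \<open>auto simp: abs_le_iff\<close>)
    then show ?thesis by simp
  qed
  moreover have "\<delta>0 > 0" "\<delta>0 \<le> d" using \<gamma> d by (auto simp: \<delta>0_def)
  ultimately show ?thesis by blast
qed

text \<open>Half of each constant 1/4 is reserved for \<open>m0\<close>, made small by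
  \<open>\<epsilon>\<close>, and half for the terms of order 1, made small by the radius. As the
  second half of the size bound depends on \<open>\<epsilon>\<close>, the radius is chosen
  last.\<close>

lemma G_contraction:
  assumes \<rho>0: "0 < \<rho>0"
  obtains \<epsilon> r0 where "0 < \<epsilon>" "\<epsilon> \<le> d" "0 < r0" "r0 \<le> 1" "r0 \<le> \<rho>0"
    "continuous_on (UNIV \<times> {0<..r0} \<times> cball 0 \<epsilon>) (\<lambda>(u, r, z). G u r z)"
    "\<And>u r z. 0 < r \<Longrightarrow> r \<le> r0 \<Longrightarrow> norm z \<le> \<epsilon> \<Longrightarrow> norm (G u r z) \<le> \<epsilon> / 4"
    "\<And>u r z z'. 0 < r \<Longrightarrow> r \<le> r0 \<Longrightarrow> norm z \<le> \<epsilon> \<Longrightarrow> norm z' \<le> \<epsilon> \<Longrightarrow> norm (G u r z - G u r z') \<le> 1 / 4 * norm (z - z')"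
proof -
  obtain \<epsilon> where \<epsilon>: "0 < \<epsilon>" "\<epsilon> \<le> d" "\<And>x y. \<bar>x\<bar> \<le> \<epsilon> \<Longrightarrow> \<bar>y\<bar> \<le> \<epsilon> \<Longrightarrow> \<bar>m0 x - m0 y\<bar> \<le> 1 / 8 * \<bar>x - y\<bar>"
    using m0_lipschitz[of "1 / 8"] by auto
  obtain C \<rho> where C: "0 \<le> C" "0 < \<rho>" "\<rho> \<le> 1" "\<rho> \<le> \<rho>0"
    "continuous_on (UNIV \<times> {0<..\<rho>} \<times> cball 0 d) (\<lambda>(u, r, z). G u r z - ((m0 (fst (fst z)), 0), 0))"
    "\<And>u r z. 0 < r \<Longrightarrow> r \<le> \<rho> \<Longrightarrow> norm z \<le> d \<Longrightarrow> norm (G u r z - ((m0 (fst (fst z)), 0), 0)) \<le> C * r powi 1"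
    "\<And>u r z z'. 0 < r \<Longrightarrow> r \<le> \<rho> \<Longrightarrow> norm z \<le> d \<Longrightarrow> norm z' \<le> d \<Longrightarrow>
      norm (G u r z - ((m0 (fst (fst z)), 0), 0) - (G u r z' - ((m0 (fst (fst z')), 0), 0))) \<le> C * r powi 1 * norm (z - z')"
    by (rule small_orderE[OF small_G \<rho>0]) blast
  define r0 where "r0 = min \<rho> (\<epsilon> / (8 * (C + 1)))"
  have r0: "0 < r0" "r0 \<le> \<rho>" using C \<epsilon> by (auto simp: r0_def)
  have Cr: "C * r \<le> \<epsilon> / 8" "C * r \<le> 1 / 8" if "0 < r" "r \<le> r0" for r
  proof -
    have "C * r \<le> (C + 1) * r" using that by simp
    also have "\<dots> \<le> \<epsilon> / 8" using that C by (simp add: r0_def field_simps)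
    finally show "C * r \<le> \<epsilon> / 8" .
    then show "C * r \<le> 1 / 8" using \<epsilon> d by simp
  qed
  have \<delta>: "\<bar>fst (fst z)\<bar> \<le> norm z" for z :: "'n unknown"
    using norm_fst_snd_le(1)[of z] norm_fst_snd_le(1)[of "fst z"] by simp
  have m00: "m0 0 = 0" using zero by (simp add: m0_def p0_def)
  have nrm: "norm ((x :: real, 0 :: complex ^ 'n), 0 :: real ^ 'n) = \<bar>x\<bar>" for x by (simp add: norm_Pair)
  show thesis
  proof (rule that[OF \<epsilon>(1,2) r0(1)])
    show "r0 \<le> 1" "r0 \<le> \<rho>0" using r0 C by auto
    have c1: "continuous_on (UNIV \<times> {0<..r0} \<times> cball 0 \<epsilon>) (\<lambda>(u, r, z). G u r z - ((m0 (fst (fst z)), 0), 0))"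
      by (rule continuous_on_subset[OF C(5)]) (use r0 \<epsilon> in auto)
    have cm: "continuous_on {-\<epsilon>..\<epsilon>} m0"
    proof (rule lipschitz_on_continuous_on[of "1 / 8"])
      show "(1 / 8)-lipschitz_on {-\<epsilon>..\<epsilon>} m0"
        using \<epsilon>(3) by (auto simp: lipschitz_on_def dist_real_def abs_le_iff)
    qed
    have c2: "continuous_on (UNIV \<times> {0<..r0} \<times> cball 0 \<epsilon>) (\<lambda>x :: (real ^ 'n) \<times> real \<times> 'n unknown. m0 (fst (fst (snd (snd x)))))"
    proof (rule continuous_on_compose2[OF cm])
      show "(\<lambda>x :: (real ^ 'n) \<times> real \<times> 'n unknown. fst (fst (snd (snd x)))) ` (UNIV \<times> {0<..r0} \<times> cball 0 \<epsilon>) \<subseteq> {-\<epsilon>..\<epsilon>}"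
      proof
        fix t assume "t \<in> (\<lambda>x :: (real ^ 'n) \<times> real \<times> 'n unknown. fst (fst (snd (snd x)))) ` (UNIV \<times> {0<..r0} \<times> cball 0 \<epsilon>)"
        then obtain z :: "'n unknown" where "t = fst (fst z)" "norm z \<le> \<epsilon>" by auto
        then show "t \<in> {-\<epsilon>..\<epsilon>}" using \<delta>[of z] by (auto simp: abs_le_iff)
      qed
    qed (intro continuous_intros)
    have "continuous_on (UNIV \<times> {0<..r0} \<times> cball 0 \<epsilon>) (\<lambda>x. (\<lambda>(u, r, z). G u r z - ((m0 (fst (fst z)), 0), 0)) x
        + ((m0 (fst (fst (snd (snd x)))), 0), 0))"
      by (intro continuous_on_add c1 continuous_on_Pair c2 continuous_on_const)
    then show "continuous_on (UNIV \<times> {0<..r0} \<times> cball 0 \<epsilon>) (\<lambda>(u, r, z). G u r z)"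
      by (simp add: case_prod_unfold)
    fix u r and z z' :: "'n unknown" assume r: "0 < r" "r \<le> r0" and z: "norm z \<le> \<epsilon>"
    have r': "r \<le> \<rho>" using r r0 by simp
    have \<delta>z: "\<bar>fst (fst z)\<bar> \<le> \<epsilon>" using \<delta>[of z] z by simp
    have "norm (G u r z) \<le> norm (G u r z - ((m0 (fst (fst z)), 0), 0)) + norm ((m0 (fst (fst z)), 0 :: complex ^ 'n), 0 :: real ^ 'n)"
      using norm_triangle_ineq[of "G u r z - ((m0 (fst (fst z)), 0), 0)" "((m0 (fst (fst z)), 0), 0)"] by simp
    also have "\<dots> \<le> C * r + 1 / 8 * \<epsilon>"
    proof (rule add_mono)
      show "norm (G u r z - ((m0 (fst (fst z)), 0), 0)) \<le> C * r" using C(6)[OF r(1) r', of z u] z \<epsilon> by simp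
      show "norm ((m0 (fst (fst z)), 0 :: complex ^ 'n), 0 :: real ^ 'n) \<le> 1 / 8 * \<epsilon>"
        using \<epsilon>(3)[of "fst (fst z)" 0] \<delta>z \<epsilon>(1) unfolding nrm by (simp add: m00)
    qed
    also have "\<dots> \<le> \<epsilon> / 4" using Cr[OF r] by simp
    finally show "norm (G u r z) \<le> \<epsilon> / 4" .
    assume z': "norm z' \<le> \<epsilon>"
    have \<delta>z': "\<bar>fst (fst z')\<bar> \<le> \<epsilon>" using \<delta>[of z'] z' by simp
    have "G u r z - G u r z' = (G u r z - ((m0 (fst (fst z)), 0), 0) - (G u r z' - ((m0 (fst (fst z')), 0), 0)))
        + ((m0 (fst (fst z)) - m0 (fst (fst z')), 0), 0)"
      by (simp add: prod_eq_iff)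
    also have "norm \<dots> \<le> C * r * norm (z - z') + 1 / 8 * norm (z - z')"
    proof (rule norm_triangle_mono)
      show "norm (G u r z - ((m0 (fst (fst z)), 0), 0) - (G u r z' - ((m0 (fst (fst z')), 0), 0))) \<le> C * r * norm (z - z')"
        using C(7)[OF r(1) r', of z z' u] z z' \<epsilon> by simp
      have "\<bar>m0 (fst (fst z)) - m0 (fst (fst z'))\<bar> \<le> 1 / 8 * \<bar>fst (fst (z - z'))\<bar>"
        using \<epsilon>(3)[OF \<delta>z \<delta>z'] by simp
      also have "\<dots> \<le> 1 / 8 * norm (z - z')" using \<delta>[of "z - z'"] by simp
      finally show "norm ((m0 (fst (fst z)) - m0 (fst (fst z')), 0 :: complex ^ 'n), 0 :: real ^ 'n) \<le> 1 / 8 * norm (z - z')"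
        unfolding nrm .
    qed
    also have "\<dots> \<le> 1 / 8 * norm (z - z') + 1 / 8 * norm (z - z')"
      using Cr(2)[OF r] by (intro add_mono mult_right_mono) auto
    finally show "norm (G u r z - G u r z') \<le> 1 / 4 * norm (z - z')" by simp
  qed
qed

end

section \<open>From the rescaled system back to Hamiltonian orbits\<close>

lemma has_vector_derivative_cis:
  assumes "(f has_real_derivative f') (at x within T)"
  shows "((\<lambda>x. cis (f x)) has_vector_derivative \<i> * of_real f' * cis (f x)) (at x within T)"
proof -
  have "(f has_derivative (\<lambda>t. t * f')) (at x within T)"
    using assms by (simp add: has_field_derivative_def mult.commute[of _ f'])
  from has_derivative_cis[OF this] show ?thesis
    unfolding has_vector_derivative_def
    by (rule has_derivative_eq_rhs) (auto simp: scaleR_conv_of_real mult_ac)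
qed

lemma has_vector_derivative_of_real':
  "(f has_real_derivative f') (at x within T) \<Longrightarrow>
    ((\<lambda>x. complex_of_real (f x)) has_vector_derivative of_real f') (at x within T)"
  using has_vector_derivative_of_real[of f f' "at x within T"]
  by (simp add: has_real_derivative_iff_has_vector_derivative)

lemma has_vector_derivative_vec:
  fixes f :: "real \<Rightarrow> ('b::real_normed_vector) ^ 'n"
  assumes "\<And>i. ((\<lambda>x. f x $ i) has_vector_derivative f' $ i) (at x within T)"
  shows "(f has_vector_derivative f') (at x within T)"
proof -
  have "((\<lambda>x. \<chi> i. f x $ i) has_derivative (\<lambda>h. \<chi> i. h *\<^sub>R f' $ i)) (at x within T)"
    using assms unfolding has_vector_derivative_def by (intro has_derivative_vec_lambda) auto
  moreover have "(\<lambda>h. \<chi> i. h *\<^sub>R f' $ i) = (\<lambda>h. h *\<^sub>R f')" by (simp add: fun_eq_iff vec_eq_iff)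
  ultimately show ?thesis by (simp add: has_vector_derivative_def)
qed

context resonant_channel
begin

text \<open>I_i / k_i and I_a / k_a have the same velocity except for the remainder, since the
  gradient of \<open>P\<close> obeys the conservation laws; and the velocity of I_a is that of r^2.
  This is the cancellation behind the action components of \<open>G\<close>.\<close>

lemma balance:
  assumes r: "0 < r" "r \<le> 1" "norm z \<le> d" and i: "0 < k $ i"
  shows "- 2 * real (k $ i) * r\<^sup>2 * S u r z + real (k $ i) * (Im (cnj (A r z $ a) * remainder_grad u r z $ a) / real (k $ a)
     - Im (cnj (A r z $ i) * remainder_grad u r z $ i) / real (k $ i)) = - Im (cnj (A r z $ i) * rotated_grad u r z $ i)"
proof -
  have S: "2 * r\<^sup>2 * S u r z = Im (cnj (A r z $ a) * rotated_grad u r z $ a) / real (k $ a)"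
    unfolding S_def divide_A cmod_A[OF ka r] using r ka by (simp add: mu_def field_simps)
  have split: "Im (cnj (A r z $ j) * rotated_grad u r z $ j) =
      Im (cnj (A r z $ j) * cgrad P (to_phase (A r z)) $ j) + Im (cnj (A r z $ j) * remainder_grad u r z $ j)" for j
    by (simp add: rotated_grad_def distrib_left algebra_simps)
  define x y where "x = Im (cnj (A r z $ i) * cgrad P (to_phase (A r z)) $ i)"
    and "y = Im (cnj (A r z $ a) * cgrad P (to_phase (A r z)) $ a)"
  have "real (k $ a) * x = real (k $ i) * y"
    using cgrad_tangential[OF P_invariant polynomial_differentiable[OF polynomial_P], of a "to_phase (A r z)" i]
    unfolding x_def y_def to_of_phase .
  then have xy: "real (k $ i) / real (k $ a) * y = x" using ka by (simp add: field_simps)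
  have "- 2 * real (k $ i) * r\<^sup>2 * S u r z = - real (k $ i) * (2 * r\<^sup>2 * S u r z)" by simp
  also have "\<dots> = - real (k $ i) * ((y + Im (cnj (A r z $ a) * remainder_grad u r z $ a)) / real (k $ a))"
    unfolding S split y_def ..
  also have "\<dots> = - x - real (k $ i) / real (k $ a) * Im (cnj (A r z $ a) * remainder_grad u r z $ a)"
    unfolding xy[symmetric] using ka by (simp only: distrib_left add_divide_distrib times_divide_eq_right times_divide_eq_left mult_minus_left)
  finally have 1: "- 2 * real (k $ i) * r\<^sup>2 * S u r z = - x - real (k $ i) / real (k $ a) * Im (cnj (A r z $ a) * remainder_grad u r z $ a)" .
  have "- x - c / e * p + c * (p / e - q / c) = - (x + q)" if "c \<noteq> 0" for c e p q :: real
    using that by (simp add: right_diff_distrib)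
  then show ?thesis unfolding 1 split x_def[symmetric] using i by simp
qed

lemma small_S_power: "small (int N - 2) S"
proof -
  have "small 0 (\<lambda>u r z. (S u r z * r powi (2 - int N) - s0 (fst (fst z))) + s0 (fst (fst z)))"
    by (intro small_order_add small_s0 small_order_weaken[OF small_S]) simp
  then have "small (0 + (int N - 2)) (\<lambda>u r z. (S u r z * r powi (2 - int N)) * r powi (int N - 2))"
    by (intro small_order_mult small_order_powi) simp
  then have "small (int N - 2) (\<lambda>u r z. (S u r z * r powi (2 - int N)) * r powi (int N - 2))" by simp
  then show ?thesis
  proof (rule small_order_cong[OF _ zero_less_one])
    fix u and r :: real and z assume r: "0 < r"
    have "r powi (2 - int N) * r powi (int N - 2) = r powi ((2 - int N) + (int N - 2))"
      using r by (intro power_int_add[symmetric]) auto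
    then show "(S u r z * r powi (2 - int N)) * r powi (int N - 2) = S u r z" by simp
  qed
qed

lemma cgrad_total:
  assumes "Y u r z \<in> W"
  shows "cgrad (\<lambda>y. P y + R y) (Y u r z) $ i = cis (alpha u r z $ i) * rotated_grad u r z $ i"
proof -
  have "R differentiable at (Y u r z)"
    using smooth_on_has_derivative[OF Rs assms] differentiableI by blast
  then have "cgrad (\<lambda>y. P y + R y) (Y u r z) $ i = cgrad P (Y u r z) $ i + cgrad R (Y u r z) $ i"
    by (simp add: cgrad_add polynomial_differentiable[OF polynomial_P])
  also have "cgrad P (Y u r z) $ i = cis (alpha u r z $ i) * cgrad P (to_phase (A r z)) $ i"
    unfolding Y_def by (rule cgrad_torus_rotate[OF P_invariant polynomial_differentiable[OF polynomial_P] alpha_orthogonal])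
  also have "cgrad R (Y u r z) $ i = cis (alpha u r z $ i) * remainder_grad u r z $ i"
    by (simp add: remainder_grad_def mult.assoc[symmetric] cis_mult)
  finally show ?thesis by (simp add: rotated_grad_def distrib_left)
qed

lemma alpha_a: "alpha u r z $ a = - (\<Sum>j\<in>UNIV - {a}. real (k $ j) * alpha u r z $ j) / real (k $ a)"
proof -
  have e: "alpha u r z = channel_tangent (u + (r powi (1 - int N)) *\<^sub>R snd z)"
    using bounded_linear_channel_tangent by (simp add: alpha_def linear_simps)
  have "(\<Sum>j\<in>UNIV - {a}. real (k $ j) * alpha u r z $ j) = (\<Sum>j\<in>UNIV - {a}. real (k $ j) * (u + (r powi (1 - int N)) *\<^sub>R snd z) $ j)"
    unfolding e by (rule sum.cong) (auto simp: channel_tangent_def)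
  then show ?thesis unfolding e by (simp add: channel_tangent_def)
qed

text \<open>In the logarithmic time in which r decreases as exp(-t), the system for the unknowns
  is equivalent to the Hamiltonian system up to the factor 1/S.\<close>
lemma Y_derivative:
  fixes \<zeta> :: "real \<Rightarrow> 'n unknown" and r :: "real \<Rightarrow> real"
  assumes r: "\<And>t. t \<in> T \<Longrightarrow> 0 < r t" "\<And>t. t \<in> T \<Longrightarrow> r t \<le> 1" "\<And>t. t \<in> T \<Longrightarrow> (r has_real_derivative - r t) (at t within T)"
    and z: "\<And>t. t \<in> T \<Longrightarrow> norm (\<zeta> t) \<le> d"
      "\<And>t. t \<in> T \<Longrightarrow> ((\<lambda>t. fst (\<zeta> t)) has_vector_derivative real N *\<^sub>R fst (\<zeta> t) - fst (G u (r t) (\<zeta> t))) (at t within T)"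
      "\<And>t. t \<in> T \<Longrightarrow> ((\<lambda>t. snd (\<zeta> t)) has_vector_derivative snd (G u (r t) (\<zeta> t)) - (real N - 1) *\<^sub>R snd (\<zeta> t)) (at t within T)"
    and S: "S u (r t) (\<zeta> t) \<noteq> 0" and W: "Y u (r t) (\<zeta> t) \<in> W" and t: "t \<in> T"
  shows "((\<lambda>t. Y u (r t) (\<zeta> t)) has_vector_derivative (1 / S u (r t) (\<zeta> t)) *\<^sub>R ham_field (\<lambda>y. P y + R y) (Y u (r t) (\<zeta> t))) (at t within T)"
proof -
  define s where "s = S u (r t) (\<zeta> t)"
  define c where "c i = rotated_grad u (r t) (\<zeta> t) $ i" for i
  define h where "h i = remainder_grad u (r t) (\<zeta> t) $ i" for i
  define A0 where "A0 i = A (r t) (\<zeta> t) $ i" for i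
  define al where "al i t = alpha u (r t) (\<zeta> t) $ i" for i t
  have s: "s \<noteq> 0" using S by (simp add: s_def)
  note rt = r(1)[OF t] r(2)[OF t] z(1)[OF t]
  have drp: "((\<lambda>t. r t powi m) has_real_derivative - of_int m * r t powi m) (at t within T)" for m
  proof -
    have "((\<lambda>t. r t powi m) has_real_derivative of_int m * r t powi (m - 1) * - r t) (at t within T)"
      by (rule DERIV_power_int[OF r(3)[OF t]]) (use rt in auto)
    moreover have "r t powi m = r t powi (m - 1) * r t"
      using power_int_add_1[of "r t" "m - 1"] rt by simp
    ultimately show ?thesis by (simp add: mult.assoc)
  qed
  have drN: "((\<lambda>t. r t ^ l) has_real_derivative - real l * r t ^ l) (at t within T)" for l
    using drp[of "int l"] by simp
  have dz: "((\<lambda>t. fst (fst (\<zeta> t))) has_real_derivative real N * fst (fst (\<zeta> t)) - fst (fst (G u (r t) (\<zeta> t)))) (at t within T)"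
    using bounded_linear.has_vector_derivative[OF bounded_linear_fst z(2)[OF t]]
    by (simp add: has_real_derivative_iff_has_vector_derivative)
  have d\<delta>: "((\<lambda>t. fst (fst (\<zeta> t))) has_real_derivative phase_drift u (r t) (\<zeta> t) / s) (at t within T)"
    using dz by (simp add: G_def s_def)
  have dw: "((\<lambda>t. snd (fst (\<zeta> t)) $ i) has_vector_derivative real N *\<^sub>R snd (fst (\<zeta> t)) $ i - snd (fst (G u (r t) (\<zeta> t))) $ i) (at t within T)" for i
    using bounded_linear.has_vector_derivative[OF bounded_linear_compose[OF bounded_linear_vec_nth[of i] bounded_linear_snd] z(2)[OF t]]
    by simp
  have dq: "((\<lambda>t. snd (\<zeta> t) $ i) has_real_derivative snd (G u (r t) (\<zeta> t)) $ i - (real N - 1) * snd (\<zeta> t) $ i) (at t within T)" for i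
    using bounded_linear.has_vector_derivative[OF bounded_linear_vec_nth[of i] z(3)[OF t]]
    by (simp add: has_real_derivative_iff_has_vector_derivative)
  \<comment> \<open>In the product rule the linear term of the equation for q cancels the derivative
    of r^(1-N), and the angular velocity divided by \<open>s\<close> remains.\<close>
  have dal: "(al i has_real_derivative theta u (r t) (\<zeta> t) i / s) (at t within T)" if "i \<noteq> a" for i
  proof -
    have "((\<lambda>t. u $ i + r t powi (1 - int N) * snd (\<zeta> t) $ i) has_real_derivative
        (- of_int (1 - int N) * r t powi (1 - int N)) * snd (\<zeta> t) $ i
        + (snd (G u (r t) (\<zeta> t)) $ i - (real N - 1) * snd (\<zeta> t) $ i) * r t powi (1 - int N)) (at t within T)"
      by (rule DERIV_cong[OF DERIV_add[OF DERIV_const DERIV_mult[OF drp dq]]]) simp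
    moreover have "(- of_int (1 - int N) * r t powi (1 - int N)) * snd (\<zeta> t) $ i
        + (snd (G u (r t) (\<zeta> t)) $ i - (real N - 1) * snd (\<zeta> t) $ i) * r t powi (1 - int N) = theta u (r t) (\<zeta> t) i / s"
    proof -
      have "r t powi (int N - 1) * r t powi (1 - int N) = r t powi ((int N - 1) + (1 - int N))"
        using rt by (intro power_int_add[symmetric]) auto
      then have "r t powi (int N - 1) * r t powi (1 - int N) = 1" by simp
      moreover have "snd (G u (r t) (\<zeta> t)) $ i = r t powi (int N - 1) * (theta u (r t) (\<zeta> t) i / s)"
        using that by (simp add: G_def s_def)
      ultimately show ?thesis by (simp add: algebra_simps)
    qed
    ultimately show ?thesis using that by (simp add: al_def[abs_def] alpha_def channel_tangent_def)
  qed
  have A0pos: "A0 i \<noteq> 0" if "0 < k $ i" for i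
  proof -
    have "(cmod (A0 i))\<^sup>2 > 0"
      unfolding A0_def cmod_A[OF that rt] using that rt mu_bounds[OF rt, of i] by simp
    then show ?thesis by auto
  qed
  have key: "((\<lambda>t. cis (al i t) * A (r t) (\<zeta> t) $ i) has_vector_derivative \<i> * cis (al i t) * c i / of_real s) (at t within T)" for i
  proof -
    \<comment> \<open>Each mode is a rotation factor times a component of \<open>A\<close>; so its
      equation reduces to one identity between the two velocities and the gradient.\<close>
    have combine: ?thesis
      if "(al i has_real_derivative al') (at t within T)" "((\<lambda>t. A (r t) (\<zeta> t) $ i) has_vector_derivative A') (at t within T)"
        "A' + \<i> * of_real al' * A0 i = \<i> * c i / of_real s" for al' A'
    proof -
      have "((\<lambda>t. cis (al i t) * A (r t) (\<zeta> t) $ i) has_vector_derivative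
          cis (al i t) * A' + \<i> * of_real al' * cis (al i t) * A (r t) (\<zeta> t) $ i) (at t within T)"
        by (rule has_vector_derivative_mult[OF has_vector_derivative_cis[OF that(1)] that(2)])
      moreover have "cis (al i t) * A' + \<i> * of_real al' * cis (al i t) * A (r t) (\<zeta> t) $ i = cis (al i t) * (A' + \<i> * of_real al' * A0 i)"
        by (simp add: A0_def algebra_simps)
      moreover have "cis (al i t) * (A' + \<i> * of_real al' * A0 i) = \<i> * cis (al i t) * c i / of_real s"
        unfolding that(3) by simp
      ultimately show ?thesis by simp
    qed
    consider "i = a" | "i \<noteq> a" "0 < k $ i" | "i \<noteq> a" "k $ i = 0" by auto
    then show ?thesis
    proof cases
      case 1
      define \<psi>' where "\<psi>' = phase_drift u (r t) (\<zeta> t) / s / real (k $ a)"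
      define al' where "al' = - (\<Sum>j\<in>UNIV - {a}. real (k $ j) * (theta u (r t) (\<zeta> t) j / s)) / real (k $ a)"
      show ?thesis
      proof (rule combine)
        have "((\<lambda>t. - (\<Sum>j\<in>UNIV - {a}. real (k $ j) * al j t) / real (k $ a)) has_real_derivative al') (at t within T)"
          unfolding al'_def by (intro DERIV_cdivide DERIV_minus DERIV_sum DERIV_cmult dal) auto
        then show "(al i has_real_derivative al') (at t within T)"
          unfolding al_def[abs_def] 1 by (subst alpha_a)
        have "((\<lambda>t. (\<phi>0 + fst (fst (\<zeta> t))) / real (k $ a)) has_real_derivative \<psi>') (at t within T)"
          unfolding \<psi>'_def by (rule DERIV_cong[OF DERIV_cdivide[OF DERIV_add[OF DERIV_const d\<delta>]]]) simp
        from has_vector_derivative_mult[OF has_vector_derivative_of_real'[OF DERIV_cmult[OF r(3)[OF t], of "sqrt (2 * real (k $ a))"]]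
            has_vector_derivative_cis[OF this]]
        show "((\<lambda>t. A (r t) (\<zeta> t) $ i) has_vector_derivative A0 i * (\<i> * of_real \<psi>' - 1)) (at t within T)"
          unfolding A0_def 1 A_a by (simp add: algebra_simps)
        \<comment> \<open>The phase of mode \<open>a\<close> is determined by the others: the drift
          of the resonant angle minus their weighted velocities, divided by k_a, leaves the angular
          velocity of mode \<open>a\<close> itself.\<close>
        have "\<psi>' + al' = Re (c a / A0 a) / s"
        proof -
          have "phase_drift u (r t) (\<zeta> t) = real (k $ a) * Re (c a / A0 a) + (\<Sum>j\<in>UNIV - {a}. real (k $ j) * Re (c j / A0 j))"
            unfolding phase_drift_def by (subst sum.remove[of _ a]) (auto simp: c_def A0_def)
          also have "(\<Sum>j\<in>UNIV - {a}. real (k $ j) * Re (c j / A0 j)) = (\<Sum>j\<in>UNIV - {a}. real (k $ j) * theta u (r t) (\<zeta> t) j)"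
            by (rule sum.cong) (auto simp: theta_def c_def A0_def)
          finally show ?thesis
            using s ka by (simp add: \<psi>'_def al'_def field_simps sum_divide_distrib[symmetric])
        qed
        moreover have "Im (c a / A0 a) = s" by (simp add: s_def S_def c_def A0_def)
        ultimately have "c a / A0 a = of_real (s * (\<psi>' + al')) + \<i> * of_real s"
          using s by (simp add: complex_eq_iff)
        then have "c a = A0 a * (of_real (s * (\<psi>' + al')) + \<i> * of_real s)"
          using A0pos[OF ka] by (simp add: field_simps)
        then have "\<i> * c a / of_real s = A0 a * (\<i> * of_real (\<psi>' + al') - 1)"
          using s by (simp add: field_simps)
        then show "A0 i * (\<i> * of_real \<psi>' - 1) + \<i> * of_real al' * A0 i = \<i> * c i / of_real s"
          unfolding 1 by (simp add: algebra_simps)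
      qed
    next
      case 2
      \<comment> \<open>The squared modulus, twice the action, is differentiated first: it is linear
        in the unknown and lets the conservation laws act. The square root follows
        afterwards.\<close>
      define B where "B t = 2 * real (k $ i) * (r t ^ 2 + r t ^ N * Re (snd (fst (\<zeta> t)) $ i))" for t
      have B: "A (r t) (\<zeta> t) $ i = of_real (sqrt (B t))" "B t > 0" if "t \<in> T" for t
      proof -
        have "r t ^ N = (r t)\<^sup>2 * r t ^ (N - 2)"
        proof -
          have "2 + (N - 2) = N" using N3 by simp
          then show ?thesis by (metis power_add)
        qed
        then have e: "B t = 2 * real (k $ i) * (r t)\<^sup>2 * mu (r t) (\<zeta> t) i" using 2 by (simp add: B_def mu_def algebra_simps)
        show "A (r t) (\<zeta> t) $ i = of_real (sqrt (B t))"
          using 2 r(1)[OF that] by (simp add: A_def e real_sqrt_mult)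
        show "B t > 0" unfolding e using 2 r(1)[OF that] mu_bounds[OF r(1,2)[OF that] z(1)[OF that], of i] by simp
      qed
      define g where "g = Re (snd (fst (G u (r t) (\<zeta> t))) $ i)"
      have dx: "((\<lambda>t. Re (snd (fst (\<zeta> t)) $ i)) has_real_derivative real N * Re (snd (fst (\<zeta> t)) $ i) - g) (at t within T)"
        using bounded_linear.has_vector_derivative[OF bounded_linear_Re dw[of i]]
        by (simp add: has_real_derivative_iff_has_vector_derivative g_def)
      have dB: "(B has_real_derivative 2 * (real (k $ i) * (- 2 * (r t)\<^sup>2 - r t ^ N * g))) (at t within T)"
        unfolding B_def[abs_def]
        by (rule DERIV_cong[OF DERIV_cmult[OF DERIV_add[OF drN[of 2] DERIV_mult[OF drN dx]]]]) (simp add: algebra_simps)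
      have rg: "r t ^ N * g = - (Im (cnj (A0 a) * h a) / real (k $ a) - Im (cnj (A0 i) * h i) / real (k $ i)) / s"
      proof -
        have "r t ^ N * r t powi (- int N) = 1" using rt by (simp add: power_int_minus)
        moreover have "g = - (r t powi (- int N) * (Im (cnj (A0 a) * h a) / real (k $ a) - Im (cnj (A0 i) * h i) / real (k $ i)) / s)"
        proof -
          have "snd (fst (G u (r t) (\<zeta> t))) $ i = of_real (- (r t powi (- int N) * (Im (cnj (A0 a) * h a) / real (k $ a) - Im (cnj (A0 i) * h i) / real (k $ i)) / s))"
            using 2 by (simp add: G_def A0_def h_def s_def)
          then show ?thesis by (simp only: g_def Re_complex_of_real)
        qed
        moreover have "x * w = - D / s" if "x * y = 1" "w = - (y * D / s)" for x y w D
          using that by (simp add: mult.assoc[symmetric])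
        ultimately show ?thesis by blast
      qed
      have bal: "real (k $ i) * (- 2 * (r t)\<^sup>2 - r t ^ N * g) = - Im (cnj (A0 i) * c i) / s"
      proof -
        have "s * (real (k $ i) * (- 2 * (r t)\<^sup>2 - r t ^ N * g)) = - Im (cnj (A0 i) * c i)"
        proof -
          have "s * (K * (- 2 * \<rho> - - D / s)) = - 2 * K * \<rho> * s + K * D" for K \<rho> D
            using s by (simp add: field_simps)
          then show ?thesis
            unfolding rg using balance[OF rt 2(2), of u] unfolding A0_def h_def c_def s_def by metis
        qed
        then show ?thesis using s by (simp add: field_simps)
      qed
      define b where "b = sqrt (B t)"
      have b: "b > 0" "A0 i = of_real b" using B[OF t] by (auto simp: b_def A0_def)
      have "((\<lambda>t. sqrt (B t)) has_real_derivative (inverse (sqrt (B t)) / 2) * (2 * (real (k $ i) * (- 2 * (r t)\<^sup>2 - r t ^ N * g)))) (at t within T)"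
        by (rule DERIV_chain2[OF DERIV_real_sqrt[OF B(2)[OF t]] dB])
      moreover have "(inverse (sqrt (B t)) / 2) * (2 * (real (k $ i) * (- 2 * (r t)\<^sup>2 - r t ^ N * g))) = - Im (c i) / s"
        unfolding bal using b by (simp add: b_def[symmetric] field_simps)
      ultimately have "((\<lambda>t. sqrt (B t)) has_real_derivative - Im (c i) / s) (at t within T)" by simp
      from has_vector_derivative_of_real'[OF this]
      have dA: "((\<lambda>t. A (r t) (\<zeta> t) $ i) has_vector_derivative of_real (- Im (c i) / s)) (at t within T)"
        by (rule has_vector_derivative_transform[OF t, rotated]) (simp add: B)
      show ?thesis
      proof (rule combine[OF dal[OF 2(1)] dA])
        have "theta u (r t) (\<zeta> t) i = Re (c i) / b"
          using 2 b by (simp add: theta_def c_def A0_def[symmetric] Re_divide_of_real)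
        then show "of_real (- Im (c i) / s) + \<i> * of_real (theta u (r t) (\<zeta> t) i / s) * A0 i = \<i> * c i / of_real s"
          using b s by (simp add: complex_eq_iff field_simps)
      qed
    next
      case 3
      define w where "w = snd (fst (\<zeta> t)) $ i"
      have "((\<lambda>t. of_real (r t ^ N) * snd (fst (\<zeta> t)) $ i) has_vector_derivative
          of_real (r t ^ N) * (real N *\<^sub>R w - snd (fst (G u (r t) (\<zeta> t))) $ i) + of_real (- real N * r t ^ N) * w) (at t within T)"
        unfolding w_def by (rule has_vector_derivative_mult[OF has_vector_derivative_of_real'[OF drN] dw])
      \<comment> \<open>The linear term of the equation for w cancels the derivative of r^N. The
        remainder moves the amplitude, and the truncated part is a pure rotation with velocity
        \<open>theta\<close>.\<close>
      moreover have "of_real (r t ^ N) * (real N *\<^sub>R w - snd (fst (G u (r t) (\<zeta> t))) $ i) + of_real (- real N * r t ^ N) * w = \<i> * h i / of_real s"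
      proof -
        have "r t ^ N * r t powi (- int N) = 1" using rt by (simp add: power_int_minus)
        then have "complex_of_real (r t ^ N) * of_real (r t powi (- int N) / s) = of_real (1 / s)"
          unfolding of_real_mult[symmetric] by simp
        moreover have "snd (fst (G u (r t) (\<zeta> t))) $ i = - (\<i> * h i * of_real (r t powi (- int N) / s))"
          using 3 by (simp add: G_def h_def s_def)
        ultimately have "of_real (r t ^ N) * snd (fst (G u (r t) (\<zeta> t))) $ i = - (\<i> * h i * of_real (1 / s))"
          by (metis mult.commute mult.left_commute mult_minus_right)
        then show ?thesis by (simp add: right_diff_distrib scaleR_conv_of_real)
      qed
      ultimately have dA: "((\<lambda>t. A (r t) (\<zeta> t) $ i) has_vector_derivative \<i> * h i / of_real s) (at t within T)"
        using 3 by (simp add: A_def)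
      show ?thesis
      proof (rule combine[OF dal[OF 3(1)] dA])
        have "c i = of_real (theta u (r t) (\<zeta> t) i) * A0 i + h i"
          using free_factor(1)[OF 3(2), of "A (r t) (\<zeta> t)"] 3 by (simp add: c_def rotated_grad_def theta_def A0_def h_def)
        then show "\<i> * h i / of_real s + \<i> * of_real (theta u (r t) (\<zeta> t) i / s) * A0 i = \<i> * c i / of_real s"
          by (simp add: algebra_simps add_divide_distrib)
      qed
    qed
  qed
  have "((\<lambda>t. \<chi> i. cis (al i t) * A (r t) (\<zeta> t) $ i) has_vector_derivative (\<chi> i. \<i> * cis (al i t) * c i / of_real s)) (at t within T)"
    by (rule has_vector_derivative_vec) (simp add: key)
  from bounded_linear.has_vector_derivative[OF bounded_linear_to_phase this]
  have "((\<lambda>t. Y u (r t) (\<zeta> t)) has_vector_derivative to_phase (\<chi> i. \<i> * cis (al i t) * c i / of_real s)) (at t within T)"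
    by (simp add: Y_def torus_rotate_def al_def)
  moreover have "to_phase (\<chi> i. \<i> * cis (al i t) * c i / of_real s) = (1 / s) *\<^sub>R ham_field (\<lambda>y. P y + R y) (Y u (r t) (\<zeta> t))"
  proof -
    have "(\<chi> i. \<i> * cis (al i t) * c i / of_real s) = (1 / s) *\<^sub>R (\<chi> i. \<i> * cgrad (\<lambda>y. P y + R y) (Y u (r t) (\<zeta> t)) $ i)"
      unfolding vec_eq_iff vector_scaleR_component vec_lambda_beta cgrad_total[OF W] al_def c_def
      unfolding scaleR_conv_of_real by (simp add: mult_ac)
    then show ?thesis
      unfolding ham_field_cgrad by (simp add: linear_scale[OF bounded_linear.linear[OF bounded_linear_to_phase]])
  qed
  ultimately show ?thesis by (simp add: s_def)
qed

text \<open>The bounded solution along r = r0 exp(-t) is returned to the original time, whose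
  element is the logarithmic one divided by \<open>S\<close>. The conclusions on mode
  \<open>a\<close> say that all curves start at the same radius and are at smaller radii ever after,
  so none meets the initial section again; the last one recovers the prescribed phases from the
  initial point.\<close>

lemma orbit_family:
  assumes \<sigma>: "0 < \<sigma>"
  obtains y :: "real ^ 'n \<Rightarrow> real \<Rightarrow> (real ^ 'n) \<times> (real ^ 'n)" and \<rho> :: real where
    "continuous_on (UNIV \<times> {0..}) (\<lambda>(u, t). y u t)"
    "\<And>u t. 0 \<le> t \<Longrightarrow> norm (y u t) \<le> \<sigma>"
    "\<And>u t. 0 \<le> t \<Longrightarrow> (y u has_vector_derivative ham_field (\<lambda>y. P y + R y) (y u t)) (at t within {0..})"
    "\<And>u. (y u \<longlongrightarrow> 0) at_top"
    "\<And>u. cmod (of_phase (y u 0) $ a) = \<rho>" "\<And>u t. 0 < t \<Longrightarrow> cmod (of_phase (y u t) $ a) < \<rho>"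
    "\<And>u i. i \<noteq> a \<Longrightarrow> 0 < k $ i \<Longrightarrow> \<exists>b>0. of_phase (y u 0) $ i = of_real b * cis (u $ i)"
proof -
  obtain K \<rho>1 where K: "0 \<le> K" "0 < \<rho>1" "\<And>r z. 0 < r \<Longrightarrow> r \<le> \<rho>1 \<Longrightarrow> norm z \<le> d \<Longrightarrow> norm (A r z) \<le> K * r"
    by (rule A_bound) blast
  obtain \<rho>2 where \<rho>2: "\<rho>2 > 0" "\<And>u r z. 0 < r \<Longrightarrow> r \<le> \<rho>2 \<Longrightarrow> norm z \<le> d \<Longrightarrow> smin / 2 \<le> S u r z * r powi (2 - int N)"
    using S_lower by blast
  obtain CS \<rho>3 where \<rho>3: "0 \<le> CS" "0 < \<rho>3" "\<rho>3 \<le> 1"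
      "continuous_on (UNIV \<times> {0<..\<rho>3} \<times> cball 0 d) (\<lambda>(u, r, z). S u r z)"
      "\<And>u r z. 0 < r \<Longrightarrow> r \<le> \<rho>3 \<Longrightarrow> norm z \<le> d \<Longrightarrow> norm (S u r z) \<le> CS * r powi (int N - 2)"
    by (rule small_orderE[OF small_S_power zero_less_one]) blast
  obtain \<rho>4 where \<rho>4: "0 < \<rho>4" "continuous_on (UNIV \<times> {0<..\<rho>4} \<times> cball 0 d) (\<lambda>(u, r, z). Y u r z)"
    by (rule small_orderE[OF small_Y zero_less_one]) blast
  obtain \<sigma>' where \<sigma>': "0 < \<sigma>'" "cball 0 \<sigma>' \<subseteq> W" using W by (meson open_contains_cball)
  define \<sigma>0 where "\<sigma>0 = min \<sigma> \<sigma>'"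
  define \<rho>5 where "\<rho>5 = Min {\<rho>1, \<rho>2, \<rho>3, \<rho>4, \<sigma>0 / (K + 1)}"
  have \<rho>5: "0 < \<rho>5" "\<rho>5 \<le> \<rho>1" "\<rho>5 \<le> \<rho>2" "\<rho>5 \<le> \<rho>3" "\<rho>5 \<le> \<rho>4" "\<rho>5 \<le> \<sigma>0 / (K + 1)"
  proof -
    show "0 < \<rho>5" using K(1,2) \<rho>2(1) \<rho>3(2) \<rho>4(1) \<sigma> \<sigma>' by (auto simp: \<rho>5_def \<sigma>0_def)
    show "\<rho>5 \<le> \<rho>1" "\<rho>5 \<le> \<rho>2" "\<rho>5 \<le> \<rho>3" "\<rho>5 \<le> \<rho>4" "\<rho>5 \<le> \<sigma>0 / (K + 1)"
      unfolding \<rho>5_def by (intro Min_le; simp)+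
  qed
  obtain \<epsilon> r0 where e: "0 < \<epsilon>" "\<epsilon> \<le> d" "0 < r0" "r0 \<le> 1" "r0 \<le> \<rho>5"
    "continuous_on (UNIV \<times> {0<..r0} \<times> cball 0 \<epsilon>) (\<lambda>(u, r, z). G u r z)"
    "\<And>u r z. 0 < r \<Longrightarrow> r \<le> r0 \<Longrightarrow> norm z \<le> \<epsilon> \<Longrightarrow> norm (G u r z) \<le> \<epsilon> / 4"
    "\<And>u r z z'. 0 < r \<Longrightarrow> r \<le> r0 \<Longrightarrow> norm z \<le> \<epsilon> \<Longrightarrow> norm z' \<le> \<epsilon> \<Longrightarrow> norm (G u r z - G u r z') \<le> 1 / 4 * norm (z - z')"
    by (rule G_contraction[OF \<rho>5(1)]) blast
  define r where "r t = r0 * exp (- t)" for t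
  have r: "0 < r t" "r t \<le> r0" if "t \<ge> 0" for t
    using that e(3) by (auto simp: r_def mult_le_cancel_left1)
  have r': "r t \<le> \<rho>1" "r t \<le> \<rho>2" "r t \<le> \<rho>3" "r t \<le> \<rho>4" "r t \<le> 1" "(K + 1) * r t \<le> \<sigma>0" if "t \<ge> 0" for t
  proof -
    show "r t \<le> \<rho>1" "r t \<le> \<rho>2" "r t \<le> \<rho>3" "r t \<le> \<rho>4" "r t \<le> 1"
      using r(2)[OF that] e(4,5) \<rho>5 by auto
    have "(K + 1) * r t \<le> (K + 1) * (\<sigma>0 / (K + 1))"
      using r(2)[OF that] e(5) \<rho>5 K(1) by (intro mult_left_mono) auto
    then show "(K + 1) * r t \<le> \<sigma>0" using K(1) by simp
  qed
  have dr: "(r has_real_derivative - r t) (at t within T)" for t T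
    unfolding r_def[abs_def] by (auto intro!: derivative_eq_intros)
  have contr: "continuous_on T r" for T unfolding r_def[abs_def] by (intro continuous_intros)
  have contG: "continuous_on (UNIV \<times> {0..} \<times> cball 0 \<epsilon>) (\<lambda>(u, t, z). G u (r t) z)"
  proof -
    have "continuous_on (UNIV \<times> {0..} \<times> cball 0 \<epsilon>) (\<lambda>x. (\<lambda>(u, r, z). G u r z) (fst x, r (fst (snd x)), snd (snd x)))"
    proof (rule continuous_on_compose2[OF e(6)])
      show "continuous_on (UNIV \<times> {0..} \<times> cball 0 \<epsilon>) (\<lambda>x :: (real ^ 'n) \<times> real \<times> 'n unknown. (fst x, r (fst (snd x)), snd (snd x)))"
        by (intro continuous_intros continuous_on_compose2[OF contr[of UNIV]]) auto
    qed (use r in auto)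
    then show ?thesis by (simp add: case_prod_unfold)
  qed
  have AB: "1 \<le> real N" "1 \<le> real N - 1" using N3 by auto
  have Gb: "norm (G u (r t) z) \<le> \<epsilon> / 4" if "t \<ge> 0" "norm z \<le> \<epsilon>" for u t z
    using that r by (intro e(7)) auto
  have Gl: "norm (G u (r t) z - G u (r t) z') \<le> 1 / 4 * norm (z - z')"
    if "t \<ge> 0" "norm z \<le> \<epsilon>" "norm z' \<le> \<epsilon>" for u t z z'
    using that r by (intro e(8)) auto
  have "\<exists>\<zeta> :: real ^ 'n \<Rightarrow> real \<Rightarrow> 'n unknown. continuous_on (UNIV \<times> {0..}) (\<lambda>(u, t). \<zeta> u t) \<and>
    (\<forall>u. snd (\<zeta> u 0) = 0) \<and> (\<forall>u. \<forall>t\<ge>0. norm (\<zeta> u t) \<le> \<epsilon> \<and>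
      ((\<lambda>t. fst (\<zeta> u t)) has_vector_derivative real N *\<^sub>R fst (\<zeta> u t) - fst (G u (r t) (\<zeta> u t))) (at t within {0..}) \<and>
      ((\<lambda>t. snd (\<zeta> u t)) has_vector_derivative snd (G u (r t) (\<zeta> u t)) - (real N - 1) *\<^sub>R snd (\<zeta> u t)) (at t within {0..}))"
    by (rule perron_solution[OF e(1) AB contG]) (fact Gb Gl)+
  then obtain \<zeta> :: "real ^ 'n \<Rightarrow> real \<Rightarrow> 'n unknown" where \<zeta>: "continuous_on (UNIV \<times> {0..}) (\<lambda>(u, t). \<zeta> u t)"
    "\<forall>u. snd (\<zeta> u 0) = 0"
    and \<zeta>': "\<forall>u. \<forall>t\<ge>0. norm (\<zeta> u t) \<le> \<epsilon> \<and>
      ((\<lambda>t. fst (\<zeta> u t)) has_vector_derivative real N *\<^sub>R fst (\<zeta> u t) - fst (G u (r t) (\<zeta> u t))) (at t within {0..}) \<and>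
      ((\<lambda>t. snd (\<zeta> u t)) has_vector_derivative snd (G u (r t) (\<zeta> u t)) - (real N - 1) *\<^sub>R snd (\<zeta> u t)) (at t within {0..})"
    by (elim exE conjE) (rule that)
  have \<zeta>3: "norm (\<zeta> u t) \<le> \<epsilon>"
    "((\<lambda>t. fst (\<zeta> u t)) has_vector_derivative real N *\<^sub>R fst (\<zeta> u t) - fst (G u (r t) (\<zeta> u t))) (at t within {0..})"
    "((\<lambda>t. snd (\<zeta> u t)) has_vector_derivative snd (G u (r t) (\<zeta> u t)) - (real N - 1) *\<^sub>R snd (\<zeta> u t)) (at t within {0..})"
    if "0 \<le> t" for u t
    using \<zeta>'[rule_format, OF that, of u] by blast+
  have \<zeta>d: "norm (\<zeta> u t) \<le> d" if "t \<ge> 0" for u t using \<zeta>3(1)[OF that, of u] e(2) by simp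
  have Spos: "0 < S u (r t) (\<zeta> u t)" if "t \<ge> 0" for u t
  proof -
    have "0 < S u (r t) (\<zeta> u t) * r t powi (2 - int N)"
      using \<rho>2(2)[OF r(1)[OF that] r'(2)[OF that] \<zeta>d[OF that, of u], of u] smin(1) by simp
    moreover have "0 < r t powi (2 - int N)" using r(1)[OF that] by (rule zero_less_power_int)
    ultimately show ?thesis by (simp add: zero_less_mult_iff)
  qed
  have Sle: "S u (r t) (\<zeta> u t) \<le> CS + 1" if "t \<ge> 0" for u t
  proof -
    have "S u (r t) (\<zeta> u t) \<le> CS * r t powi (int N - 2)"
      using \<rho>3(5)[OF r(1)[OF that] r'(3)[OF that] \<zeta>d[OF that, of u], of u] by simp
    also have "\<dots> \<le> CS * r t powi 0"
      using \<rho>3(1) r(1)[OF that] r'(5)[OF that] N3 by (intro mult_left_mono power_int_decreasing) auto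
    finally show ?thesis by simp
  qed
  have cpath: "continuous_on (UNIV \<times> {0..}) (\<lambda>x. (fst x, r (snd x), \<zeta> (fst x) (snd x)))"
    using \<zeta>(1) unfolding case_prod_unfold by (intro continuous_intros continuous_on_compose2[OF contr[of UNIV]]) auto
  have img: "(\<lambda>x. (fst x, r (snd x), \<zeta> (fst x) (snd x))) ` (UNIV \<times> {0..}) \<subseteq> UNIV \<times> {0<..\<rho>'} \<times> cball 0 d"
    if "\<And>t. t \<ge> 0 \<Longrightarrow> r t \<le> \<rho>'" for \<rho>'
    using r(1) that \<zeta>d by auto
  have contS: "continuous_on (UNIV \<times> {0..}) (\<lambda>(u, t). 1 / S u (r t) (\<zeta> u t))"
  proof -
    have "continuous_on (UNIV \<times> {0..}) (\<lambda>x. (\<lambda>(u, r, z). S u r z) (fst x, r (snd x), \<zeta> (fst x) (snd x)))"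
      by (rule continuous_on_compose2[OF \<rho>3(4) cpath img[OF r'(3)]])
    then show ?thesis unfolding case_prod_unfold fst_conv snd_conv
      by (intro continuous_intros) (use Spos in \<open>auto simp: less_imp_neq[symmetric]\<close>)
  qed
  have contY: "continuous_on (UNIV \<times> {0..}) (\<lambda>x. Y (fst x) (r (snd x)) (\<zeta> (fst x) (snd x)))"
    using continuous_on_compose2[OF \<rho>4(2) cpath img[OF r'(4)]] by (simp add: case_prod_unfold)
  \<comment> \<open>The change of time requires a positive lower bound for the time density 1 / S,
    hence an upper bound for \<open>S\<close>; its order N - 2 is nonnegative.\<close>
  have m: "1 / (CS + 1) \<le> 1 / S u (r t) (\<zeta> u t)" if "t \<ge> 0" for u t
    using Sle[OF that] Spos[OF that] by (intro divide_left_mono) (auto simp: mult_pos_pos add_nonneg_pos \<rho>3(1))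
  have "0 < 1 / (CS + 1)" using \<rho>3(1) by simp
  from time_change[OF contS this m]
  obtain X :: "real ^ 'n \<Rightarrow> real \<Rightarrow> real" where X: "continuous_on (UNIV \<times> {0..}) (\<lambda>(u, t). X u t)"
    "\<And>u. X u 0 = 0" "\<And>u. filterlim (X u) at_top at_top" "\<And>u t. 0 \<le> t \<Longrightarrow> 0 \<le> X u t"
    "\<And>u t. 0 \<le> t \<Longrightarrow> (X u has_real_derivative 1 / (1 / S u (r (X u t)) (\<zeta> u (X u t)))) (at t within {0..})"
    by blast
  define y where "y u t = Y u (r (X u t)) (\<zeta> u (X u t))" for u t
  have nY: "norm (Y u (r t) (\<zeta> u t)) \<le> K * r t" if "t \<ge> 0" for u t
    using K(3)[OF r(1)[OF that] r'(1)[OF that] \<zeta>d[OF that, of u]] by simp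
  have nY': "norm (Y u (r t) (\<zeta> u t)) \<le> \<sigma>0" if "t \<ge> 0" for u t
  proof -
    have "K * r t \<le> (K + 1) * r t" using r(1)[OF that] by simp
    then show ?thesis using nY[OF that, of u] r'(6)[OF that] by linarith
  qed
  have amp: "cmod (of_phase (y u t) $ a) = sqrt (2 * real (k $ a)) * r (X u t)" if "t \<ge> 0" for u t
    using r(1)[OF X(4)[OF that, of u]] by (simp add: y_def Y_def A_a norm_mult)
  show thesis
  proof (rule that[of y "sqrt (2 * real (k $ a)) * r0"])
    have "continuous_on (UNIV \<times> {0..}) (\<lambda>x. (fst x, X (fst x) (snd x)))"
      using X(1) unfolding case_prod_unfold by (intro continuous_intros)
    then have "continuous_on (UNIV \<times> {0..}) (\<lambda>x. (\<lambda>x. Y (fst x) (r (snd x)) (\<zeta> (fst x) (snd x))) (fst x, X (fst x) (snd x)))"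
      by (rule continuous_on_compose2[OF contY]) (use X(4) in auto)
    then show "continuous_on (UNIV \<times> {0..}) (\<lambda>(u, t). y u t)" by (simp add: y_def case_prod_unfold)
    show "norm (y u t) \<le> \<sigma>" if "0 \<le> t" for u t
      using nY'[OF X(4)[OF that], of u u] by (simp add: y_def \<sigma>0_def)
    show "(y u has_vector_derivative ham_field (\<lambda>y. P y + R y) (y u t)) (at t within {0..})" if t: "0 \<le> t" for u t
    proof -
      let ?\<tau> = "X u t"
      have \<tau>: "?\<tau> \<ge> 0" by (rule X(4)[OF t])
      have "((\<lambda>t. Y u (r t) (\<zeta> u t)) has_vector_derivative (1 / S u (r ?\<tau>) (\<zeta> u ?\<tau>)) *\<^sub>R ham_field (\<lambda>y. P y + R y) (y u t)) (at ?\<tau> within {0..})"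
        unfolding y_def
      proof (rule Y_derivative)
        show "S u (r ?\<tau>) (\<zeta> u ?\<tau>) \<noteq> 0" using Spos[OF \<tau>, of u] by simp
        have "norm (Y u (r ?\<tau>) (\<zeta> u ?\<tau>)) \<le> \<sigma>'" using nY'[OF \<tau>, of u] by (simp add: \<sigma>0_def)
        then show "Y u (r ?\<tau>) (\<zeta> u ?\<tau>) \<in> W" using \<sigma>'(2) by auto
      qed (use r r' dr \<zeta>d \<zeta>3 \<tau> in auto)
      then have "((\<lambda>t. Y u (r t) (\<zeta> u t)) has_vector_derivative (1 / S u (r ?\<tau>) (\<zeta> u ?\<tau>)) *\<^sub>R ham_field (\<lambda>y. P y + R y) (y u t)) (at ?\<tau> within X u ` {0..})"
        by (rule has_vector_derivative_within_subset) (use X(4) in auto)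
      \<comment> \<open>The factor 1 / S of the field in logarithmic time is cancelled by the
        derivative S of the new time \<open>X u\<close>.\<close>
      from vector_diff_chain_within[OF X(5)[OF t, of u, unfolded has_real_derivative_iff_has_vector_derivative] this]
      have "(((\<lambda>t. Y u (r t) (\<zeta> u t)) \<circ> X u) has_vector_derivative ham_field (\<lambda>y. P y + R y) (y u t)) (at t within {0..})"
        using Spos[OF \<tau>, of u] by simp
      then show ?thesis by (simp add: y_def[abs_def] o_def)
    qed
    show "(y u \<longlongrightarrow> 0) at_top" for u
    proof (rule Lim_null_comparison)
      show "\<forall>\<^sub>F t in at_top. norm (y u t) \<le> K * r (X u t)"
        using eventually_ge_at_top[of 0] by eventually_elim (use nY X(4) in \<open>simp add: y_def\<close>)
      have "(r \<longlongrightarrow> 0) at_top" unfolding r_def[abs_def]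
        by (intro tendsto_mult_right_zero filterlim_compose[OF exp_at_bot] filterlim_uminus_at_bot_at_top)
      then have "((\<lambda>t. r (X u t)) \<longlongrightarrow> 0) at_top" using X(3) by (rule filterlim_compose)
      then show "((\<lambda>t. K * r (X u t)) \<longlongrightarrow> 0) at_top" by (rule tendsto_mult_right_zero)
    qed
    show "cmod (of_phase (y u 0) $ a) = sqrt (2 * real (k $ a)) * r0" for u
      using amp[of 0 u] by (simp add: X(2) r_def)
    show "cmod (of_phase (y u t) $ a) < sqrt (2 * real (k $ a)) * r0" if t: "0 < t" for u t
    proof -
      \<comment> \<open>\<open>X u\<close> is strictly increasing because its derivative is the
        positive rate \<open>S\<close>.\<close>
      have "X u t \<noteq> 0"
      proof
        assume "X u t = 0"
        have nd: "\<exists>d. (X u has_real_derivative d) (at s) \<and> 0 < d" if "0 < s" for s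
        proof -
          have "at s within {0..} = at s" using that by (intro at_within_open_subset[of _ "{0<..}"]) auto
          then have "(X u has_real_derivative S u (r (X u s)) (\<zeta> u (X u s))) (at s)" using X(5)[of s u] that by simp
          then show ?thesis using Spos[OF X(4)[of s u], of u] that by (intro exI conjI) auto
        qed
        have "X u 0 < X u t"
          by (rule DERIV_pos_imp_increasing_open[OF t])
             (use nd continuous_on_subset[OF continuous_on_section[OF X(1)], of "{0..t}" u] in auto)
        then show False using \<open>X u t = 0\<close> X(2) by simp
      qed
      then have "0 < X u t" using X(4)[of t u] t by simp
      then have "r (X u t) < r0" using e(3) by (simp add: r_def)
      then show ?thesis using amp[of t u] t ka by simp
    qed
    show "\<exists>b>0. of_phase (y u 0) $ i = of_real b * cis (u $ i)" if i: "i \<noteq> a" "0 < k $ i" for u i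
    proof (intro exI[of _ "sqrt (2 * real (k $ i)) * r 0 * sqrt (mu (r 0) (\<zeta> u 0) i)"] conjI)
      have "mu (r 0) (\<zeta> u 0) i > 0" using mu_bounds[OF r(1)[of 0] r'(5)[of 0] \<zeta>d[of 0 u], of i] by simp
      then show "0 < sqrt (2 * real (k $ i)) * r 0 * sqrt (mu (r 0) (\<zeta> u 0) i)" using i r(1)[of 0] by simp
      show "of_phase (y u 0) $ i = of_real (sqrt (2 * real (k $ i)) * r 0 * sqrt (mu (r 0) (\<zeta> u 0) i)) * cis (u $ i)"
        using i by (simp add: y_def X(2) Y_def A_def alpha_def \<zeta>(2) channel_tangent_def)
    qed
  qed
qed

end

section \<open>Families of asymptotic curves\<close>

definition resonant_level :: "nat \<Rightarrow> nat ^ 'n \<Rightarrow> (nat \<Rightarrow> real ^ 'n \<Rightarrow> real) \<Rightarrow> real \<Rightarrow> real \<Rightarrow> real \<Rightarrow> real" where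
  "resonant_level N k HB h1 h2 \<phi> = level N k HB + amplitude k * (h1 * cos \<phi> + h2 * sin \<phi>)"

lemma Psi_resonant_level: "Psi N k i HB h1 h2 \<sigma> = resonant_level N k HB h1 h2 ((real (k $ i))\<^sup>2 * \<sigma>)"
  by (simp add: Psi_def H_res_def resonant_level_def level_def amplitude_def rvec_def mult.commute)

lemma deriv_Psi:
  "(Psi N k i HB h1 h2 has_real_derivative
     (real (k $ i))\<^sup>2 * (amplitude k * (h2 * cos ((real (k $ i))\<^sup>2 * c) - h1 * sin ((real (k $ i))\<^sup>2 * c)))) (at c)"
  unfolding Psi_resonant_level[abs_def] resonant_level_def
  by (auto intro!: derivative_eq_intros simp: algebra_simps)

text \<open>A simple zero of C + h1 cos + h2 sin comes with its mirror image, at which the derivative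
  has the opposite sign.\<close>
lemma zero_positive_slope:
  assumes "resonant_level N k HB h1 h2 c = 0" "amplitude k * (h2 * cos c - h1 * sin c) \<noteq> 0"
  obtains \<phi> where "resonant_level N k HB h1 h2 \<phi> = 0" "0 < amplitude k * (h2 * cos \<phi> - h1 * sin \<phi>)"
proof (cases "0 < amplitude k * (h2 * cos c - h1 * sin c)")
  case True
  then show ?thesis using assms(1) that by blast
next
  case False
  define p q where "p = h1 * cos c + h2 * sin c" and "q = h2 * cos c - h1 * sin c"
  have q: "q \<noteq> 0" using assms(2) by (auto simp: q_def)
  have Aq: "amplitude k * q < 0" using assms(2) False unfolding q_def by linarith
  define D where "D = p\<^sup>2 + q\<^sup>2"
  have D: "D > 0" using q by (simp add: D_def add_nonneg_pos)
  have "((p\<^sup>2 - q\<^sup>2) / D)\<^sup>2 + (2 * p * q / D)\<^sup>2 = 1"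
  proof -
    have "(p\<^sup>2 - q\<^sup>2)\<^sup>2 + (2 * p * q)\<^sup>2 = D\<^sup>2" by (simp add: D_def power2_eq_square algebra_simps)
    then show ?thesis using D by (simp add: power_divide add_divide_distrib[symmetric])
  qed
  \<comment> \<open>\<open>s\<close> is twice the argument of p + i q; shifting the angle by it
    reflects (p, q) to (p, -q), so that the value is kept and the slope reversed.\<close>
  then obtain s where s: "(p\<^sup>2 - q\<^sup>2) / D = cos s" "2 * p * q / D = sin s"
    by (rule sincos_total_2pi) blast
  have "h1 * cos (c + s) + h2 * sin (c + s) = p * cos s + q * sin s"
    by (simp add: p_def q_def cos_add sin_add algebra_simps)
  also have "\<dots> = p"
    unfolding s[symmetric] using D by (simp add: field_simps) (simp add: D_def power2_eq_square algebra_simps)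
  finally have 1: "resonant_level N k HB h1 h2 (c + s) = 0"
    using assms(1) by (simp add: resonant_level_def p_def)
  have "h2 * cos (c + s) - h1 * sin (c + s) = q * cos s - p * sin s"
    by (simp add: p_def q_def cos_add sin_add algebra_simps)
  also have "\<dots> = - q"
    unfolding s[symmetric] using D by (simp add: field_simps) (simp add: D_def power2_eq_square algebra_simps)
  finally have "0 < amplitude k * (h2 * cos (c + s) - h1 * sin (c + s))" using Aq by simp
  with 1 show ?thesis using that by blast
qed

section \<open>From the normal form to estimates near the origin\<close>

lemma norm_actions_le: "norm (actions y) \<le> (norm y)\<^sup>2"
proof -
  have "norm (actions y) \<le> (\<Sum>i\<in>UNIV. \<bar>actions y $ i\<bar>)" by (rule norm_le_l1_cart)
  also have "\<dots> = (\<Sum>i\<in>UNIV. (cmod (of_phase y $ i))\<^sup>2) / 2"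
    by (simp add: actions_cmod sum_divide_distrib)
  also have "\<dots> \<le> (\<Sum>i\<in>UNIV. (cmod (of_phase y $ i))\<^sup>2)" by (simp add: sum_nonneg)
  also have "\<dots> = (norm (of_phase y))\<^sup>2" by (simp add: norm_vec_def L2_set_def sum_nonneg)
  finally show ?thesis by simp
qed

text \<open>The actions are quadratic in y, so half the power of |I| is the full power of |y|. The
  asymptotic relation ignores the point 0 itself; there continuity and \<open>0 < m\<close> force
  the value 0.\<close>

lemma vanishes_bigo:
  fixes g :: "(real ^ 'n) \<times> (real ^ 'n) \<Rightarrow> real"
  assumes g: "g \<in> O[at 0](\<lambda>y. norm (actions y) powr (real m / 2))" and cont: "isCont g 0" and m: "0 < m"
  shows "vanishes m g"
proof -
  obtain c where c: "c > 0" "\<forall>\<^sub>F y in at 0. norm (g y) \<le> c * norm (norm (actions y) powr (real m / 2))"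
    by (rule landau_o.bigE[OF g]) blast
  have b: "\<forall>\<^sub>F y in at 0. norm (g y) \<le> c * norm y ^ m"
  proof -
    have "\<forall>\<^sub>F y :: (real ^ 'n) \<times> (real ^ 'n) in at 0. y \<noteq> 0" by (simp add: eventually_at_filter)
    with c(2) show ?thesis
    proof eventually_elim
      case (elim y)
      have "norm (actions y) powr (real m / 2) \<le> ((norm y)\<^sup>2) powr (real m / 2)"
        by (intro powr_mono2 norm_actions_le) auto
      also have "\<dots> = norm y ^ m"
        using elim(2) by (simp add: powr_powr powr_realpow flip: powr_numeral)
      finally show ?case using elim(1) c(1) by (auto intro: order_trans)
    qed
  qed
  have "(g \<longlongrightarrow> g 0) (at 0)" using cont by (simp add: isCont_def)
  moreover have "(g \<longlongrightarrow> 0) (at 0)"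
  proof (rule Lim_null_comparison[OF b])
    have "((\<lambda>y :: (real ^ 'n) \<times> (real ^ 'n). c * norm y ^ m) \<longlongrightarrow> c * norm (0 :: (real ^ 'n) \<times> (real ^ 'n)) ^ m) (at 0)"
      by (intro tendsto_intros)
    moreover have "c * norm (0 :: (real ^ 'n) \<times> (real ^ 'n)) ^ m = 0" using m by simp
    ultimately show "((\<lambda>y :: (real ^ 'n) \<times> (real ^ 'n). c * norm y ^ m) \<longlongrightarrow> 0) (at 0)" by metis
  qed
  ultimately have g0: "g 0 = 0" by (rule tendsto_unique[OF at_neq_bot])
  from b obtain \<rho> where \<rho>: "\<rho> > 0" "\<And>y. y \<noteq> 0 \<Longrightarrow> norm y < \<rho> \<Longrightarrow> \<bar>g y\<bar> \<le> c * norm y ^ m"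
    by (auto simp: eventually_at)
  show ?thesis unfolding vanishes_def
  proof (rule exI[of _ c], rule exI[of _ "\<rho> / 2"], intro conjI allI impI ballI)
    fix r and y :: "(real ^ 'n) \<times> (real ^ 'n)" assume r: "0 < r \<and> r \<le> \<rho> / 2" and y: "y \<in> cball 0 r"
    show "\<bar>g y\<bar> \<le> c * r ^ m"
    proof (cases "y = 0")
      case False
      then have "\<bar>g y\<bar> \<le> c * norm y ^ m" using r y by (intro \<rho>(2)) auto
      also have "\<dots> \<le> c * r ^ m" using y c(1) by (intro mult_left_mono power_mono) auto
      finally show ?thesis .
    qed (use g0 c r in auto)
  qed (use c \<rho> in auto)
qed

lemma resonant_part_action_angle:
  assumes "\<And>i. 0 \<le> I $ i"
  shows "Re (Complex h1 (- h2) * resonant_monomial k (of_phase (action_angle I \<theta>))) = H_res k h1 h2 I (\<theta> \<bullet> rvec k)"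
proof -
  define p where "p = (\<Prod>i\<in>UNIV. sqrt (I $ i) ^ (k $ i))"
  have "resonant_monomial k (of_phase (action_angle I \<theta>)) =
      (\<Prod>i\<in>UNIV. of_real (sqrt (I $ i) ^ (k $ i)) * cis (\<theta> $ i * real (k $ i)))"
    unfolding resonant_monomial_def
    by (rule prod.cong) (auto simp: of_phase_action_angle real_sqrt_mult power_mult_distrib Complex.DeMoivre mult.commute)
  also have "\<dots> = of_real p * (\<Prod>i\<in>UNIV. cis (\<theta> $ i * real (k $ i)))"
    by (simp add: prod.distrib p_def)
  also have "(\<Prod>i\<in>UNIV. cis (\<theta> $ i * real (k $ i))) = cis (\<theta> \<bullet> rvec k)"
    unfolding cis_conv_exp by (simp add: exp_sum inner_vec_def rvec_def sum_distrib_left)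
  finally show ?thesis by (simp add: H_res_def p_def[symmetric] algebra_simps)
qed

lemma ham_field_lipschitz:
  fixes g :: "(real ^ 'n) \<times> (real ^ 'n) \<Rightarrow> real"
  assumes g: "smooth_on W g" and W: "cball 0 \<sigma> \<subseteq> W"
  shows "\<exists>L. \<forall>y\<in>cball 0 \<sigma>. \<forall>y'\<in>cball 0 \<sigma>. norm (ham_field g y - ham_field g y') \<le> L * norm (y - y')"
proof -
  have "\<forall>v. \<exists>L. \<forall>y\<in>cball 0 \<sigma>. \<forall>y'\<in>cball 0 \<sigma>.
      \<bar>frechet_derivative g (at y) v - frechet_derivative g (at y') v\<bar> \<le> L * norm (y - y')"
    using smooth_lipschitz[OF smooth_on_derivative[OF g] W] by blast
  then obtain L where L: "\<And>v y y'. y \<in> cball 0 \<sigma> \<Longrightarrow> y' \<in> cball 0 \<sigma> \<Longrightarrow>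
      \<bar>frechet_derivative g (at y) v - frechet_derivative g (at y') v\<bar> \<le> L v * norm (y - y')"
    by metis
  have "norm (ham_field g y - ham_field g y') \<le>
      (\<Sum>i\<in>UNIV. L (0, axis i 1) + L (axis i 1, 0)) * norm (y - y')" if y: "y \<in> cball 0 \<sigma>" "y' \<in> cball 0 \<sigma>" for y y'
  proof -
    let ?d = "ham_field g y - ham_field g y'"
    have "norm ?d \<le> norm (fst ?d) + norm (snd ?d)" using norm_Pair_le[of "fst ?d" "snd ?d"] by (simp del: fst_diff snd_diff)
    also have "\<dots> \<le> (\<Sum>i\<in>UNIV. \<bar>fst ?d $ i\<bar>) + (\<Sum>i\<in>UNIV. \<bar>snd ?d $ i\<bar>)"
      by (intro add_mono norm_le_l1_cart)
    also have "\<dots> \<le> (\<Sum>i\<in>UNIV. L (0, axis i 1) * norm (y - y')) + (\<Sum>i\<in>UNIV. L (axis i 1, 0) * norm (y - y'))"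
      using L[OF y(2,1)] L[OF y] by (intro add_mono sum_mono) (auto simp: ham_field_def norm_minus_commute)
    finally show ?thesis by (simp add: sum_distrib_right sum.distrib distrib_right)
  qed
  then show ?thesis by blast
qed

text \<open>The bound 1 keeps the phases in an interval on which the sine is injective.\<close>

lemma cis_phase_unique:
  assumes "of_real b * cis s = of_real b' * cis t" "b > 0" "b' > 0" "\<bar>s\<bar> < 1" "\<bar>t\<bar> < 1"
  shows "s = t"
proof -
  have "cmod (of_real b * cis s) = cmod (of_real b' * cis t)" using assms(1) by simp
  then have "b = b'" using assms(2,3) by (simp add: norm_mult)
  then have "cis s = cis t" using assms(1,2) by simp
  then have "sin s = sin t" by (simp add: complex_eq_iff)
  then show ?thesis using assms(4,5) pi_ge_two by (rule_tac sin_inj_pi) auto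
qed

lemma O_plus_family:
  fixes \<Omega> :: "((real ^ 'n) \<times> (real ^ 'n)) set" and H :: "(real ^ 'n) \<times> (real ^ 'n) \<Rightarrow> real"
  assumes smooth: "smooth_on \<Omega> H"
    and N3: "N \<ge> 3" and kN: "vabs k = N"
    and BNF: "birkhoff_normal_form \<Omega> H N k HB h1 h2"
    and channel: "\<And>j. 1 \<le> j \<Longrightarrow> real j \<le> (real N - 1) / 2 \<Longrightarrow> HB j (rvec k) = 0"
    and zero: "Psi N k i1 HB h1 h2 c = 0" and slope: "deriv (Psi N k i1 HB h1 h2) c \<noteq> 0"
  shows "parameter_family (O_plus_curve \<Omega> H) {0..} {i. k $ i > 0}"
proof -
  have "(real (k $ i1))\<^sup>2 * (amplitude k * (h2 * cos ((real (k $ i1))\<^sup>2 * c) - h1 * sin ((real (k $ i1))\<^sup>2 * c))) \<noteq> 0"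
    using slope DERIV_imp_deriv[OF deriv_Psi] by metis
  \<comment> \<open>The slope contains the square of \<open>k $ i1\<close> as a factor. A simple
    zero therefore forces this entry to be positive, and \<open>i1\<close> can take the role of mode
    \<open>a\<close>.\<close>
  then have a: "0 < k $ i1" and sl: "amplitude k * (h2 * cos ((real (k $ i1))\<^sup>2 * c) - h1 * sin ((real (k $ i1))\<^sup>2 * c)) \<noteq> 0"
    by auto
  obtain \<phi>0 where \<phi>0: "resonant_level N k HB h1 h2 \<phi>0 = 0" "0 < amplitude k * (h2 * cos \<phi>0 - h1 * sin \<phi>0)"
    using zero_positive_slope[OF zero[unfolded Psi_resonant_level] sl] by blast
  \<comment> \<open>The limit rate \<open>s0\<close> as a function of the deviation; half of its
    value at the zero becomes the lower bound \<open>smin\<close> of the locale.\<close>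
  define q where "q \<delta> = amplitude k * (h2 * cos (\<phi>0 + \<delta>) - h1 * sin (\<phi>0 + \<delta>)) / 2" for \<delta>
  have "isCont q 0" unfolding q_def[abs_def] by (intro continuous_intros) auto
  moreover have "q 0 / 2 < q 0" using \<phi>0(2) by (simp add: q_def)
  ultimately have "\<forall>\<^sub>F \<delta> in at 0. q 0 / 2 < q \<delta>" unfolding isCont_def by (rule order_tendstoD)
  then obtain d0 where d0: "d0 > 0" "\<And>\<delta>. \<delta> \<noteq> 0 \<Longrightarrow> \<bar>\<delta>\<bar> < d0 \<Longrightarrow> q 0 / 2 < q \<delta>"
    by (auto simp: eventually_at dist_real_def)
  define d where "d = min (d0 / 2) (1 / 2)"
  have d: "0 < d" "d \<le> 1 / 2" "\<And>\<delta>. \<bar>\<delta>\<bar> \<le> d \<Longrightarrow> q 0 / 2 \<le> q \<delta>"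
  proof -
    show "q 0 / 2 \<le> q \<delta>" if "\<bar>\<delta>\<bar> \<le> d" for \<delta>
      using d0(2)[of \<delta>] d0(1) that \<open>q 0 / 2 < q 0\<close> by (cases "\<delta> = 0") (auto simp: d_def)
  qed (use d0 in \<open>auto simp: d_def\<close>)
  have HBh: "\<And>j. 1 \<le> j \<Longrightarrow> j \<le> N div 2 \<Longrightarrow> homogeneous_poly j (HB j)"
    using BNF unfolding birkhoff_normal_form_def by auto
  obtain V f F G R where V: "open V" "0 \<in> V" and f: "smooth_on V f" "inj_on f V" "f ` V \<subseteq> \<Omega>" "symplectic_on V f"
      "(\<lambda>y. norm (f y - y)) \<in> O[at 0](\<lambda>y. (norm y)\<^sup>2)"
    and F: "real_polynomial_function F" "F \<in> O[at 0](\<lambda>y. norm (actions y) powr ((real N + 1) / 2))"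
      "\<forall>I \<theta>. (\<forall>i. 0 \<le> I $ i) \<longrightarrow> F (action_angle I \<theta>) = G I (\<theta> \<bullet> rvec k)"
    and R: "R \<in> O[at 0](\<lambda>y. norm (actions y) powr ((3 * real N + 1) / 2))"
      "\<forall>I \<theta>. (\<forall>i. 0 \<le> I $ i) \<and> action_angle I \<theta> \<in> V \<longrightarrow>
           H (f (action_angle I \<theta>)) = (\<Sum>j = 1..N div 2. HB j I) + H_res k h1 h2 I (\<theta> \<bullet> rvec k)
             + F (action_angle I \<theta>) + R (action_angle I \<theta>)"
    using BNF unfolding birkhoff_normal_form_def by (elim conjE exE) (rule that)
  have Fi: "torus_invariant k F"
    unfolding torus_invariant_def
  proof (intro allI impI)
    fix \<alpha> :: "real ^ 'n" and y :: "(real ^ 'n) \<times> (real ^ 'n)" assume \<alpha>: "\<alpha> \<bullet> rvec k = 0"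
    obtain \<theta> where y: "y = action_angle (actions y) \<theta>" by (rule action_angle_surj)
    have "F (torus_rotate \<alpha> y) = F (action_angle (actions y) (\<theta> + \<alpha>))" by (subst y) (simp add: torus_rotate_action_angle)
    also have "\<dots> = F (action_angle (actions y) \<theta>)" using F(3) \<alpha> by (simp add: actions_nonneg inner_add_left)
    finally show "F (torus_rotate \<alpha> y) = F y" using y by simp
  qed
  have Fv: "vanishes (Suc N) F"
  proof (rule vanishes_bigo)
    show "F \<in> O[at 0](\<lambda>y. norm (actions y) powr (real (Suc N) / 2))" using F(2) by (simp add: add.commute)
    show "isCont F 0"
      using smooth_on_continuous[OF polynomial_smooth[OF F(1)]] continuous_on_eq_continuous_at[OF open_UNIV, of F] by blast
  qed simp
  define P0 where "P0 y = (\<Sum>j = 1..N div 2. HB j (actions y)) + Re (Complex h1 (- h2) * resonant_monomial k (of_phase y)) + F y" for y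
  \<comment> \<open>The remainder of the normal form comes with a size bound alone. This formula
    agrees with it on \<open>V\<close> and is visibly smooth there, which gives access to its
    gradient.\<close>
  define R0 where "R0 y = H (f y) - P0 y" for y
  have P0p: "real_polynomial_function P0"
    unfolding P0_def[abs_def]
    by (intro real_polynomial_function.intros(3) real_polynomial_function_sum homogeneous_poly_compose[OF HBh]
          polynomial_actions polynomial_resonant_part F(1)) auto
  have Hf: "smooth_on V (\<lambda>y. H (f y))" by (rule smooth_on_compose[OF V(1) f(3) smooth f(1)])
  have R0s: "smooth_on V R0"
    unfolding R0_def[abs_def]
    by (intro smooth_on_diff V Hf smooth_on_polynomial P0p)
  have R0R: "R0 y = R y" if "y \<in> V" for y
  proof -
    obtain \<theta> where y: "y = action_angle (actions y) \<theta>" by (rule action_angle_surj)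
    have "H (f (action_angle (actions y) \<theta>)) = (\<Sum>j = 1..N div 2. HB j (actions y)) + H_res k h1 h2 (actions y) (\<theta> \<bullet> rvec k)
             + F (action_angle (actions y) \<theta>) + R (action_angle (actions y) \<theta>)"
      by (rule R(2)[rule_format]) (use y that in \<open>simp add: actions_nonneg\<close>)
    moreover have "H_res k h1 h2 (actions y) (\<theta> \<bullet> rvec k) = Re (Complex h1 (- h2) * resonant_monomial k (of_phase y))"
      using resonant_part_action_angle[of "actions y" h1 h2 k \<theta>] y by (simp add: actions_nonneg)
    ultimately show ?thesis using y by (simp add: R0_def P0_def)
  qed
  have R0v: "vanishes (3 * N + 1) R0"
  proof (rule vanishes_bigo)
    have "\<forall>\<^sub>F y in at 0. R y = R0 y"
      using eventually_at_in_open'[OF V] by eventually_elim (simp add: R0R)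
    then have "R0 \<in> O[at 0](\<lambda>y. norm (actions y) powr ((3 * real N + 1) / 2))"
      using R(1) landau_o.big.in_cong by blast
    then show "R0 \<in> O[at 0](\<lambda>y. norm (actions y) powr (real (3 * N + 1) / 2))" by (simp add: add.commute)
    show "isCont R0 0"
      using smooth_on_continuous[OF R0s] V by (simp add: continuous_on_eq_continuous_at)
  qed simp
  interpret resonant_channel k N i1 HB h1 h2 F R0 V \<phi>0 d "q 0 / 2"
  proof
    show "HB j (rvec k) = 0" if "1 \<le> j" "2 * j < N" for j
      using that by (intro channel) auto
    show "level N k HB + amplitude k * (h1 * cos \<phi>0 + h2 * sin \<phi>0) = 0"
      using \<phi>0(1) by (simp add: resonant_level_def)
    show "q 0 / 2 \<le> amplitude k * (h2 * cos (\<phi>0 + \<delta>) - h1 * sin (\<phi>0 + \<delta>)) / 2" if "\<bar>\<delta>\<bar> \<le> d" for \<delta>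
      using d(3)[OF that] by (simp add: q_def)
    show "0 < q 0 / 2" using \<phi>0(2) by (simp add: q_def)
  qed (use N3 kN a HBh F(1) Fi Fv V R0s R0v d in auto)
  have PR: "(\<lambda>y. P y + R0 y) = (\<lambda>y. H (f y))"
    by (rule ext) (simp add: P_def \<eta>_def R0_def P0_def)
  obtain \<sigma> where \<sigma>: "0 < \<sigma>" "cball 0 \<sigma> \<subseteq> V" using V by (meson open_contains_cball)
  obtain y \<rho> where y: "continuous_on (UNIV \<times> {0..}) (\<lambda>(u, t). y u t)"
    "\<And>u t. 0 \<le> t \<Longrightarrow> norm (y u t) \<le> \<sigma>"
    "\<And>u t. 0 \<le> t \<Longrightarrow> (y u has_vector_derivative ham_field (\<lambda>y. H (f y)) (y u t)) (at t within {0..})"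
    "\<And>u. (y u \<longlongrightarrow> 0) at_top"
    "\<And>u. cmod (of_phase (y u 0) $ i1) = \<rho>" "\<And>u t. 0 < t \<Longrightarrow> cmod (of_phase (y u t) $ i1) < \<rho>"
    "\<And>u i. i \<noteq> i1 \<Longrightarrow> 0 < k $ i \<Longrightarrow> \<exists>b>0. of_phase (y u 0) $ i = of_real b * cis (u $ i)"
    using orbit_family[OF \<sigma>(1)] unfolding PR by blast
  have yV: "y u t \<in> V" if "0 \<le> t" for u t using y(2)[OF that, of u] \<sigma>(2) by auto
  \<comment> \<open>A cube in the hyperplane, small enough for each phase to be recovered from the
    initial point.\<close>
  define U where "U = {u :: real ^ 'n. u $ i1 = 0 \<and> (\<forall>i. \<bar>u $ i\<bar> < 1)}"
  have contf: "continuous_on V f" by (rule smooth_on_continuous[OF f(1)])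
  \<comment> \<open>The near-identity estimate concerns y different from 0; continuity of
    \<open>f\<close> at 0 carries it over to the origin.\<close>
  have f0: "f 0 = 0"
  proof -
    have "(\<lambda>y. norm (f y - y)) \<in> o[at 0](\<lambda>_. 1 :: real)"
    proof (rule landau_o.big_small_trans[OF f(5)])
      have "((\<lambda>y :: (real ^ 'n) \<times> (real ^ 'n). (norm y)\<^sup>2) \<longlongrightarrow> (norm (0 :: (real ^ 'n) \<times> (real ^ 'n)))\<^sup>2) (at 0)"
        by (intro tendsto_intros)
      then show "(\<lambda>y :: (real ^ 'n) \<times> (real ^ 'n). (norm y)\<^sup>2) \<in> o[at 0](\<lambda>_. 1)"
        by (intro smalloI_tendsto) auto
    qed
    then have "((\<lambda>y. norm (f y - y)) \<longlongrightarrow> 0) (at 0)" using smalloD_tendsto by fastforce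
    then have "((\<lambda>y. f y - y) \<longlongrightarrow> 0) (at 0)" by (simp add: tendsto_norm_zero_iff)
    moreover have "((\<lambda>y. f y - y) \<longlongrightarrow> f 0 - 0) (at 0)"
      using contf V by (intro tendsto_intros) (auto simp: continuous_on_eq_continuous_at isCont_def)
    ultimately have "0 = f 0 - 0" by (rule tendsto_unique[OF at_neq_bot])
    then show ?thesis by simp
  qed
  \<comment> \<open>Followed back by the time \<open>t1\<close>, the point \<open>y u 0\<close> lies
    on the other curve at time \<open>t2 - t1\<close>. Mode \<open>i1\<close> has its initial radius
    there, which excludes a positive time.\<close>
  have unique: "t1 = t2 \<and> y u 0 = y v 0" if t: "0 \<le> t1" "t1 \<le> t2" and eq: "y u t1 = y v t2" for u v t1 t2
  proof -
    obtain L where L: "\<And>p q. p \<in> cball 0 \<sigma> \<Longrightarrow> q \<in> cball 0 \<sigma> \<Longrightarrow>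
        norm (ham_field (\<lambda>y. H (f y)) p - ham_field (\<lambda>y. H (f y)) q) \<le> L * norm (p - q)"
      using ham_field_lipschitz[OF Hf \<sigma>(2)] by blast
    have "y u 0 = y v (0 + (t2 - t1))"
    proof (rule ode_unique_backward[where X = "ham_field (\<lambda>y. H (f y))" and S = "cball 0 \<sigma>" and L = L and b = t1])
      show "(y u has_vector_derivative ham_field (\<lambda>y. H (f y)) (y u t)) (at t within {0..t1})" if "t \<in> {0..t1}" for t
        by (rule has_vector_derivative_within_subset[OF y(3)]) (use that in auto)
      show "((\<lambda>t. y v (t + (t2 - t1))) has_vector_derivative ham_field (\<lambda>y. H (f y)) (y v (t + (t2 - t1)))) (at t within {0..t1})"
        if "t \<in> {0..t1}" for t
      proof -
        have "(y v has_vector_derivative ham_field (\<lambda>y. H (f y)) (y v (t + (t2 - t1))))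
            (at (t + (t2 - t1)) within (\<lambda>t. t + (t2 - t1)) ` {0..t1})"
          by (rule has_vector_derivative_within_subset[OF y(3)]) (use that t in auto)
        moreover have "((\<lambda>t. t + (t2 - t1)) has_vector_derivative 1) (at t within {0..t1})"
          by (auto intro!: derivative_eq_intros)
        ultimately show ?thesis
          using vector_diff_chain_within[of "\<lambda>t. t + (t2 - t1)" 1 t "{0..t1}" "y v"] by (simp add: o_def)
      qed
    qed (use y(2) t eq L in auto)
    then have e: "y u 0 = y v (t2 - t1)" by simp
    have "\<not> 0 < t2 - t1" using y(5)[of u] y(6)[of "t2 - t1" v] e by auto
    then have "t1 = t2" using t by simp
    with e show ?thesis by simp
  qed
  have phases: "u = v \<or> (\<forall>i. 0 < k $ i \<longrightarrow> u $ i = v $ i)" if uv: "u \<in> U" "v \<in> U" "y u 0 = y v 0" for u v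
  proof -
    have "u $ i = v $ i" if ki: "0 < k $ i" for i
    proof (cases "i = i1")
      case False
      obtain b b' where "b > 0" "b' > 0" "of_real b * cis (u $ i) = of_real b' * cis (v $ i)"
        using y(7)[OF False ki, of u] y(7)[OF False ki, of v] uv(3) by auto
      then show ?thesis using uv by (intro cis_phase_unique[of b "u $ i" b']) (auto simp: U_def)
    qed (use uv in \<open>simp add: U_def\<close>)
    then show ?thesis by blast
  qed
  show ?thesis
    unfolding parameter_family_def
  proof (rule exI[of _ i1], rule exI[of _ U], rule exI[of _ "\<lambda>u t. f (y u t)"], intro conjI ballI impI)
    show "i1 \<in> {i. 0 < k $ i}" using a by simp
    have "0 \<in> U" by (simp add: U_def)
    then show "U \<noteq> {}" by blast
    have "open (\<Inter>i. {u :: real ^ 'n. \<bar>u $ i\<bar> < 1})"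
      by (intro open_INT finite ballI open_Collect_less continuous_intros)
    moreover have "U = {u. u $ i1 = 0} \<inter> (\<Inter>i. {u :: real ^ 'n. \<bar>u $ i\<bar> < 1})" by (auto simp: U_def)
    ultimately show "openin (top_of_set {u. u $ i1 = 0}) U" by (auto simp: openin_open)
    have "continuous_on (U \<times> {0..}) (\<lambda>x. f ((\<lambda>(u, t). y u t) x))"
      by (rule continuous_on_compose2[OF contf continuous_on_subset[OF y(1)]]) (use yV in auto)
    then show "continuous_on (U \<times> {0..}) (\<lambda>(u, t). f (y u t))" by (simp add: case_prod_unfold)
  next
    fix u
    show "O_plus_curve \<Omega> H (\<lambda>t. f (y u t))"
      unfolding O_plus_curve_def
    proof (intro conjI)
      show "integral_curve_on \<Omega> H {0..} (\<lambda>t. f (y u t))"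
        unfolding integral_curve_on_def
      proof (intro ballI conjI)
        fix t :: real assume "t \<in> {0..}"
        then have t: "0 \<le> t" by simp
        show "f (y u t) \<in> \<Omega>" using yV[OF t] f(3) by auto
        have H': "H differentiable at (f (y u t))"
          using smooth_on_has_derivative[OF smooth, of "f (y u t)"] \<open>f (y u t) \<in> \<Omega>\<close> differentiableI by blast
        have "(y u has_derivative (\<lambda>h. h *\<^sub>R ham_field (\<lambda>y. H (f y)) (y u t))) (at t within {0..})"
          using y(3)[OF t] by (simp add: has_vector_derivative_def)
        from has_derivative_compose[where g = f, OF this smooth_on_has_derivative[OF f(1) yV[OF t]]]
        have "((\<lambda>t. f (y u t)) has_derivative
            (\<lambda>h. frechet_derivative f (at (y u t)) (h *\<^sub>R ham_field (\<lambda>y. H (f y)) (y u t)))) (at t within {0..})" .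
        moreover have "frechet_derivative f (at (y u t)) (h *\<^sub>R ham_field (\<lambda>y. H (f y)) (y u t)) = h *\<^sub>R ham_field H (f (y u t))" for h
          using symplectic_ham_field[OF f(4) yV[OF t] H']
          by (simp add: linear_scale[OF has_derivative_linear[OF smooth_on_has_derivative[OF f(1) yV[OF t]]]])
        ultimately show "((\<lambda>t. f (y u t)) has_vector_derivative ham_field H (f (y u t))) (at t within {0..})"
          by (simp add: has_vector_derivative_def)
      qed
      show "\<not> (\<lambda>t. f (y u t)) constant_on {0..}"
      proof
        assume "(\<lambda>t. f (y u t)) constant_on {0..}"
        then have "f (y u 0) = f (y u 1)" by (auto simp: constant_on_def)
        then have "y u 0 = y u 1" using f(2) yV[of 0 u] yV[of 1 u] by (auto dest: inj_onD)
        then show False using y(5)[of u] y(6)[of 1 u] by simp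
      qed
      have "isCont f 0" using V contf by (simp add: continuous_on_eq_continuous_at)
      from isCont_tendsto_compose[OF this y(4)]
      show "((\<lambda>t. f (y u t)) \<longlongrightarrow> 0) at_top" by (simp add: f0)
    qed
  next
    fix u v assume uv: "u \<in> U" "v \<in> U" "\<exists>i\<in>{i. 0 < k $ i}. u $ i \<noteq> v $ i"
    show "(\<lambda>t. f (y u t)) ` {0..} \<inter> (\<lambda>t. f (y v t)) ` {0..} = {}"
    proof (rule ccontr)
      assume "(\<lambda>t. f (y u t)) ` {0..} \<inter> (\<lambda>t. f (y v t)) ` {0..} \<noteq> {}"
      then obtain z where "z \<in> (\<lambda>t. f (y u t)) ` {0..}" "z \<in> (\<lambda>t. f (y v t)) ` {0..}" by blast
      then obtain t1 t2 where "0 \<le> t1" "0 \<le> t2" "z = f (y u t1)" "z = f (y v t2)" by auto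
      then have t: "0 \<le> t1" "0 \<le> t2" "f (y u t1) = f (y v t2)" by simp_all
      then have "y u t1 = y v t2" using inj_onD[OF f(2) t(3) yV[OF t(1)] yV[OF t(2)]] by simp
      then have "y u 0 = y v 0"
        using unique[of t1 t2 u v] unique[of t2 t1 v u] t(1,2) by (metis linorder_linear)
      then show False using phases[OF uv(1,2)] uv(3) by blast
    qed
  qed
qed

section \<open>Reversal of time\<close>

lemma birkhoff_normal_form_uminus:
  assumes "birkhoff_normal_form \<Omega> H N k HB h1 h2"
  shows "birkhoff_normal_form \<Omega> (\<lambda>x. - H x) N k (\<lambda>j I. - HB j I) (- h1) (- h2)"
proof -
  have hom: "homogeneous_poly j (\<lambda>I. - p I)" if "homogeneous_poly j p" for j and p :: "real ^ 'a \<Rightarrow> real"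
  proof -
    from that obtain c where p: "\<And>I. p I = (\<Sum>h | vabs h = j. c h * (\<Prod>i\<in>UNIV. (I $ i) ^ (h $ i)))"
      unfolding homogeneous_poly_def by blast
    show ?thesis unfolding homogeneous_poly_def by (rule exI[of _ "\<lambda>h. - c h"]) (simp add: p sum_negf)
  qed
  have res: "H_res k (- h1) (- h2) I \<phi> = - H_res k h1 h2 I \<phi>" for I \<phi>
    by (simp add: H_res_def algebra_simps)
  from assms obtain V f F G R where V: "open V" "0 \<in> V" "smooth_on V f" "inj_on f V" "f ` V \<subseteq> \<Omega>" "symplectic_on V f"
      "(\<lambda>y. norm (f y - y)) \<in> O[at 0](\<lambda>y. (norm y)\<^sup>2)"
    and F: "real_polynomial_function F" "F \<in> O[at 0](\<lambda>y. norm (actions y) powr ((real N + 1) / 2))"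
      "\<forall>I \<theta>. (\<forall>i. 0 \<le> I $ i) \<longrightarrow> F (action_angle I \<theta>) = G I (\<theta> \<bullet> rvec k)"
    and R: "R \<in> O[at 0](\<lambda>y. norm (actions y) powr ((3 * real N + 1) / 2))"
      "\<forall>I \<theta>. (\<forall>i. 0 \<le> I $ i) \<and> action_angle I \<theta> \<in> V \<longrightarrow>
           H (f (action_angle I \<theta>)) = (\<Sum>j = 1..N div 2. HB j I) + H_res k h1 h2 I (\<theta> \<bullet> rvec k)
             + F (action_angle I \<theta>) + R (action_angle I \<theta>)"
    unfolding birkhoff_normal_form_def by (elim conjE exE) (rule that)
  show ?thesis unfolding birkhoff_normal_form_def
  proof (intro conjI ballI)
    show "homogeneous_poly j (\<lambda>I. - HB j I)" if "j \<in> {1..N div 2}" for j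
      using assms that by (intro hom) (simp add: birkhoff_normal_form_def)
    show "\<exists>V f F G R.
        open V \<and> 0 \<in> V \<and> smooth_on V f \<and> inj_on f V \<and> f ` V \<subseteq> \<Omega> \<and> symplectic_on V f \<and>
        (\<lambda>y. norm (f y - y)) \<in> O[at 0](\<lambda>y. (norm y)\<^sup>2) \<and>
        real_polynomial_function F \<and>
        F \<in> O[at 0](\<lambda>y. norm (actions y) powr ((real N + 1) / 2)) \<and>
        (\<forall>I \<theta>. (\<forall>i. 0 \<le> I $ i) \<longrightarrow> F (action_angle I \<theta>) = G I (\<theta> \<bullet> rvec k)) \<and>
        R \<in> O[at 0](\<lambda>y. norm (actions y) powr ((3 * real N + 1) / 2)) \<and>
        (\<forall>I \<theta>. (\<forall>i. 0 \<le> I $ i) \<and> action_angle I \<theta> \<in> V \<longrightarrow>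
           - H (f (action_angle I \<theta>)) =
             (\<Sum>j = 1..N div 2. - HB j I) + H_res k (- h1) (- h2) I (\<theta> \<bullet> rvec k)
             + F (action_angle I \<theta>) + R (action_angle I \<theta>))"
      by (rule exI[of _ V], rule exI[of _ f], rule exI[of _ "\<lambda>y. - F y"], rule exI[of _ "\<lambda>I \<phi>. - G I \<phi>"], rule exI[of _ "\<lambda>y. - R y"])
         (use V F R in \<open>simp add: res sum_negf real_polynomial_function_minus\<close>)
  qed
qed

text \<open>The field of -H is opposite to that of H, so reflecting time exchanges the future of one
  system with the past of the other. The orbits are unchanged as sets, hence still disjoint.\<close>

lemma O_minus_family:
  fixes \<Omega> :: "((real ^ 'n::finite) \<times> (real ^ 'n)) set"
  assumes smooth: "smooth_on \<Omega> H" and fam: "parameter_family (O_plus_curve \<Omega> (\<lambda>x. - H x)) {0..} K"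
  shows "parameter_family (O_minus_curve \<Omega> H) {..0} K"
proof -
  have img: "uminus ` {..0::real} = {0..}" by (auto simp: image_iff intro: bexI[of _ "- _"])
  have curve: "O_minus_curve \<Omega> H (\<lambda>t. x (- t))" if "O_plus_curve \<Omega> (\<lambda>x. - H x) x" for x
    unfolding O_minus_curve_def
  proof (intro conjI)
    from that have x: "integral_curve_on \<Omega> (\<lambda>x. - H x) {0..} x" "\<not> x constant_on {0..}" "(x \<longlongrightarrow> 0) at_top"
      unfolding O_plus_curve_def by auto
    show "integral_curve_on \<Omega> H {..0} (\<lambda>t. x (- t))"
      unfolding integral_curve_on_def
    proof (intro ballI conjI)
      fix t :: real assume t: "t \<in> {..0}"
      then show "x (- t) \<in> \<Omega>" using x(1) by (simp add: integral_curve_on_def)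
      then have "(H has_derivative frechet_derivative H (at (x (- t)))) (at (x (- t)))"
        by (rule smooth_on_has_derivative[OF smooth])
      from frechet_derivative_at[OF has_derivative_minus[OF this]]
      have "ham_field (\<lambda>x. - H x) (x (- t)) = - ham_field H (x (- t))"
        by (simp add: ham_field_def prod_eq_iff vec_eq_iff fun_eq_iff)
      moreover have "(x has_vector_derivative ham_field (\<lambda>x. - H x) (x (- t))) (at (- t) within uminus ` {..0})"
        using x(1) t unfolding img integral_curve_on_def by simp
      ultimately have "(x has_vector_derivative - ham_field H (x (- t))) (at (- t) within uminus ` {..0})" by simp
      moreover have "(uminus has_vector_derivative (- 1 :: real)) (at t within {..0})"
        by (auto intro!: derivative_eq_intros)
      ultimately have "(x \<circ> uminus has_vector_derivative - 1 *\<^sub>R - ham_field H (x (- t))) (at t within {..0})"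
        by (rule vector_diff_chain_within[rotated])
      then show "((\<lambda>t. x (- t)) has_vector_derivative ham_field H (x (- t))) (at t within {..0})"
        by (simp add: o_def)
    qed
    show "\<not> (\<lambda>t. x (- t)) constant_on {..0}"
    proof
      assume "(\<lambda>t. x (- t)) constant_on {..0}"
      then obtain c where c: "\<And>t. t \<le> 0 \<Longrightarrow> x (- t) = c" by (auto simp: constant_on_def)
      have "x t = c" if "t \<ge> 0" for t using c[of "- t"] that by simp
      then show False using x(2) by (auto simp: constant_on_def)
    qed
    show "((\<lambda>t. x (- t)) \<longlongrightarrow> 0) at_bot"
      using x(3) by (simp add: filterlim_at_bot_mirror)
  qed
  from fam obtain a and U and \<gamma> :: "real ^ 'n \<Rightarrow> real \<Rightarrow> (real ^ 'n) \<times> (real ^ 'n)" where \<gamma>: "a \<in> K" "U \<noteq> {}" "openin (top_of_set {u. u $ a = 0}) U"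
    "continuous_on (U \<times> {0..}) (\<lambda>(u, t). \<gamma> u t)"
    "\<forall>u\<in>U. O_plus_curve \<Omega> (\<lambda>x. - H x) (\<gamma> u)"
    "\<forall>u\<in>U. \<forall>v\<in>U. (\<exists>i\<in>K. u $ i \<noteq> v $ i) \<longrightarrow> \<gamma> u ` {0..} \<inter> \<gamma> v ` {0..} = {}"
    unfolding parameter_family_def by (elim conjE exE bexE) (rule that; assumption)
  have img\<gamma>: "(\<lambda>t. \<gamma> u (- t)) ` {..0} = \<gamma> u ` {0..}" for u
    unfolding img[symmetric] image_image ..
  show ?thesis unfolding parameter_family_def
  proof (rule exI[of _ a], rule exI[of _ U], rule exI[of _ "\<lambda>u t. \<gamma> u (- t)"], intro conjI ballI impI)
    have "continuous_on (U \<times> {..0}) (\<lambda>x. (\<lambda>(u, t). \<gamma> u t) (fst x, - snd x))"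
      by (rule continuous_on_compose2[OF \<gamma>(4)]) (auto intro!: continuous_intros)
    then show "continuous_on (U \<times> {..0}) (\<lambda>(u, t). \<gamma> u (- t))" by (simp add: case_prod_unfold)
  qed (use \<gamma> curve in \<open>auto simp: img\<gamma>\<close>)
qed

theorem theorem2p3:
  fixes \<Omega> :: "((real ^ 'n) \<times> (real ^ 'n)) set"
    and H :: "(real ^ 'n) \<times> (real ^ 'n) \<Rightarrow> real"
    and \<omega> :: "real ^ 'n" and N :: nat and k :: "nat ^ 'n" and i1 :: 'n
    and HB :: "nat \<Rightarrow> real ^ 'n \<Rightarrow> real" and h1 h2 :: real
  assumes domain: "open \<Omega>" "connected \<Omega>" "0 \<in> \<Omega>"
    and smooth: "smooth_on \<Omega> H"
    and elliptic: "(\<lambda>x. H x - H2 \<omega> x) \<in> O[at 0](\<lambda>x. norm x ^ 3)"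
    and indefinite: "\<exists>x. x \<noteq> 0 \<and> H2 \<omega> x = 0"
    and N3: "N \<ge> 3"
    and nonres: "\<And>h :: nat ^ 'n. h \<noteq> 0 \<Longrightarrow> vabs h \<le> N - 1 \<Longrightarrow> \<omega> \<bullet> rvec h \<noteq> 0"
    and res: "k \<noteq> 0" "vabs k = N" "\<omega> \<bullet> rvec k = 0"
    and simple_res: "\<And>k' :: nat ^ 'n. k' \<noteq> 0 \<Longrightarrow> \<nexists>m :: int. rvec k' = of_int m *\<^sub>R rvec k \<Longrightarrow>
           \<omega> \<bullet> rvec k' = 0 \<Longrightarrow> vabs k' > 3 * N - 1"
    and BNF: "birkhoff_normal_form \<Omega> H N k HB h1 h2"
    and channel: "\<And>j. 1 \<le> j \<Longrightarrow> real j \<le> (real N - 1) / 2 \<Longrightarrow> HB j (rvec k) = 0"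
    and simple_zero: "\<exists>c. Psi N k i1 HB h1 h2 c = 0 \<and> deriv (Psi N k i1 HB h1 h2) c \<noteq> 0"
  shows "parameter_family (O_plus_curve \<Omega> H) {0..} {i. k $ i > 0} \<and>
         parameter_family (O_minus_curve \<Omega> H) {..0} {i. k $ i > 0}"
proof -
  obtain c where c: "Psi N k i1 HB h1 h2 c = 0" "deriv (Psi N k i1 HB h1 h2) c \<noteq> 0"
    using simple_zero by blast
  \<comment> \<open>A simple zero for H is one for -H. The reversed slope is harmless, because
    \<open>O_plus_family\<close> itself passes to a zero with the slope that it requires.\<close>
  have neg: "Psi N k i1 (\<lambda>j I. - HB j I) (- h1) (- h2) = (\<lambda>\<sigma>. - Psi N k i1 HB h1 h2 \<sigma>)"
    by (auto simp: Psi_def H_res_def fun_eq_iff algebra_simps)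
  have "parameter_family (O_plus_curve \<Omega> (\<lambda>x. - H x)) {0..} {i. k $ i > 0}"
  proof (rule O_plus_family[OF smooth_on_uminus[OF domain(1) smooth] N3 res(2) birkhoff_normal_form_uminus[OF BNF]])
    show "- HB j (rvec k) = 0" if "1 \<le> j" "real j \<le> (real N - 1) / 2" for j
      using channel[OF that] by simp
    show "Psi N k i1 (\<lambda>j I. - HB j I) (- h1) (- h2) c = 0" by (simp add: neg c)
    show "deriv (Psi N k i1 (\<lambda>j I. - HB j I) (- h1) (- h2)) c \<noteq> 0"
      unfolding neg using c(2) DERIV_imp_deriv[OF DERIV_minus[OF deriv_Psi[of N k i1 HB h1 h2 c]]]
        DERIV_imp_deriv[OF deriv_Psi[of N k i1 HB h1 h2 c]] by linarith
  qed
  from O_minus_family[OF smooth this] O_plus_family[OF smooth N3 res(2) BNF channel c]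
  show ?thesis by blast
qed

end
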